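(* Let $M$ be a smooth manifold, let $F$ be a closed 2-form and $H$ a 3-form on $M$ satisfying $dH+F\wedge F=0$. Then the $B_n$ generalized geometry structure on $\mathfrak XM\oplus C^\infty M\oplus\Omega^1M$ twisted by $F$ and $H$ is isomorphic to the sub dg-Leibniz algebra of fixed points of the T-duality automorphism of Courant–Dorfman algebroids $$\mathrm D\Phi:\mathrm D\mathfrak{sym}^*(\mathcal P,Q_{\mathcal P})\to\mathrm D\mathfrak{sym}^*(\mathcal P,Q_{\mathcal P})$$ on the derived dg-Leibniz algebra of the symmetries of the self T-dual dg-manifold $$\mathcal P=((T[1]M\oplus\mathbb R[1])\oplus\mathbb R[2],\ Q_{\mathcal P}=d+F\partial_q+(H+qF)\partial_t).$$
   Context: **The dg-manifold.** $q$ is a variable of degree $1$ and $t$ a variable of degree $2$. The graded commutative algebra of functions of $\mathcal P$ is $\Omega^\bullet M\otimes\Lambda[q]\otimes\mathbb R[t]$, and $Q_{\mathcal P}$ is the degree 1 graded derivation equal to the De Rham differential on $\Omega^\bullet M$ and sending $q\mapsto F$, $t\mapsto H+qF$; it squares to zero. It is self T-dual: T-duality sends the data $d+F\partial_q+(H+q\bar F)\partial_t$ (with $dF=d\bar F=0$, $dH+F\wedge\bar F=0$) to $d+\bar F\partial_q+(H+qF)\partial_t$, and here $\bar F=F$. **Derived symmetries.** Let $[\,,]$ be the graded commutator of derivations of the algebra of functions. $\mathrm D\mathfrak{sym}^*(\mathcal P,Q_{\mathcal P})$ is concentrated in degrees $0$ and $-1$: $\mathrm D\mathfrak{sym}^0$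 consists of the degree $-1$ derivations $\iota_X+f\partial_q+(C+q\bar f)\partial_t$ with $X\in\mathfrak XM$, $f,\bar f\in C^\infty M$, $C\in\Omega^1M$, and $\mathrm D\mathfrak{sym}^{-1}$ consists of the degree $-2$ derivations $h\partial_t$ with $h\in C^\infty M$. Here $\iota_X$ is contraction, extended by zero on $q,t$. The differential is $\delta=[Q_{\mathcal P},\_]:\mathrm D\mathfrak{sym}^{-1}\to\mathrm D\mathfrak{sym}^0$, and the derived bracket is $\lfloor a,b\rfloor=(-1)^{\|a\|}[[Q_{\mathcal P},a],b]$, where $\|a\|$ is the degree of $a$ in $\mathrm D\mathfrak{sym}^*$. This is a dg-Leibniz algebra: $\delta\lfloor a,b\rfloor=\lfloor\delta a,b\rfloor+(-1)^{\|a\|}\lfloor a,\delta b\rfloor$ and $\lfloor a,\lfloor b,c\rfloor\rfloor=\lfloor\lfloor a,b\rfloor,c\rfloor+(-1)^{\|a\|\|b\|}\lfloor b,\lfloor a,c\rfloor\rfloor$. **T-duality automorphism.** $\mathrm D\Phi$ is the automorphism of this dg-Leibniz algebra given by $$\iota_X+f\partial_q+(C+q\bar f)\partial_t\mapsto\iota_X+\bar f\partial_q+(C+qf)\partial_t,\qquad h\partial_t\mapsto h\partial_t.$$ **$B_n$ generalized geometry structure twisted by $(F,H)$.** This is the bracket on $\mathfrak XM\oplus C^\infty M\oplus\Omega^1M$ $$\lfloor(X,f,C),(Y,g,D)\rfloor=\big([X,Y],\ \mathcal L_Xg-\mathcal L_Yf-\iota_Y\iota_XF,\ \mathcal L_XD-\iota_YdC-\iota_Y\iota_XH-2f\,\iota_YF+2g\,\iota_XF+2g\,df\big),$$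 regarded as the degree $0$ part of a dg-Leibniz algebra whose degree $-1$ part is $C^\infty M$, with differential $h\mapsto(0,0,dh)$ and mixed brackets $\lfloor(X,f,C),h\rfloor=X(h)$, $\lfloor h,(X,f,C)\rfloor=-X(h)$, $\lfloor h,h'\rfloor=0$.
   Formalization: With zero differential on degree 0, the rule for δ⌊a,b⌋ fails for a=h, b=ι_X (as d(X(h)) need not vanish); "dg-Leibniz" here demands it only for b of negative degree, and for the derived symmetries it is also proved for all a, b with the untruncated δ=[Q_P,_]. *)

theory Defs
  imports "HOL-Analysis.Analysis" "HOL-Library.Function_Algebras"
begin

section \<open>Pointwise scalar multiplication of functions\<close>

instantiation "fun" :: (type, real_vector) real_vector
begin

definition scaleR_fun_def: "r *\<^sub>R f = (\<lambda>x. r *\<^sub>R f x)"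

instance
  by standard (simp_all add: scaleR_fun_def fun_eq_iff scaleR_add_right scaleR_add_left)

end

lemma scaleR_fun_apply [simp]: "(r *\<^sub>R f) x = r *\<^sub>R f x"
  by (simp add: scaleR_fun_def)


section \<open>Smooth manifolds\<close>

text \<open>
  The model space is \<open>Euclidean_space n\<close>, i.e. the functions \<open>nat \<Rightarrow> real\<close> that vanish at all
  indices \<open>\<ge> n\<close>, so that the dimension is an arbitrary natural number, 0 included.
  The sets \<open>V\<close> below are always open in it; hence the derivatives depend on \<open>f\<close> on \<open>V\<close> only.
\<close>

definition partial_deriv :: "nat \<Rightarrow> ((nat \<Rightarrow> real) \<Rightarrow> real) \<Rightarrow> (nat \<Rightarrow> real) \<Rightarrow> real" where
  "partial_deriv i f x = deriv (\<lambda>s. f (x(i := s))) (x i)"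

primrec Ck_on :: "nat \<Rightarrow> nat \<Rightarrow> (nat \<Rightarrow> real) set \<Rightarrow> ((nat \<Rightarrow> real) \<Rightarrow> real) \<Rightarrow> bool" where
  "Ck_on n 0 V f \<longleftrightarrow> continuous_map (subtopology (Euclidean_space n) V) euclideanreal f"
| "Ck_on n (Suc k) V f \<longleftrightarrow>
     continuous_map (subtopology (Euclidean_space n) V) euclideanreal f \<and>
     (\<forall>i<n. (\<forall>x\<in>V. (\<lambda>s. f (x(i := s))) field_differentiable at (x i)) \<and>
            Ck_on n k V (partial_deriv i f))"

definition smooth_on :: "nat \<Rightarrow> (nat \<Rightarrow> real) set \<Rightarrow> ((nat \<Rightarrow> real) \<Rightarrow> real) \<Rightarrow> bool" where
  "smooth_on n V f \<longleftrightarrow> (\<forall>k. Ck_on n k V f)"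

record 'm manifold =
  mtop :: "'m topology"
  mdim :: nat
  atlas :: "('m set \<times> ('m \<Rightarrow> nat \<Rightarrow> real)) set"

definition smooth_manifold :: "'m manifold \<Rightarrow> bool" where
  "smooth_manifold M \<longleftrightarrow>
     Hausdorff_space (mtop M) \<and> second_countable (mtop M) \<and>
     (\<Union>(U, \<phi>)\<in>atlas M. U) = topspace (mtop M) \<and>
     (\<forall>(U, \<phi>)\<in>atlas M.
        openin (mtop M) U \<and> openin (Euclidean_space (mdim M)) (\<phi> ` U) \<and>
        homeomorphic_map (subtopology (mtop M) U)
          (subtopology (Euclidean_space (mdim M)) (\<phi> ` U)) \<phi>) \<and>
     (\<forall>(U, \<phi>)\<in>atlas M. \<forall>(V, \<psi>)\<in>atlas M. \<forall>i<mdim M.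
        smooth_on (mdim M) (\<phi> ` (U \<inter> V)) (\<lambda>y. \<psi> (inv_into U \<phi> y) i))"

text \<open>
  Functions on \<open>M\<close> are represented by total functions that are 0 outside the carrier; the same
  convention (the value 0 on arguments outside the intended domain) is used for vector fields,
  forms and derivations, so that equality of HOL functions is the intended equality.
\<close>

definition smooth_functions :: "'m manifold \<Rightarrow> ('m \<Rightarrow> real) set" where
  "smooth_functions M =
     {f. (\<forall>x. x \<notin> topspace (mtop M) \<longrightarrow> f x = 0) \<and>
         (\<forall>(U, \<phi>)\<in>atlas M. smooth_on (mdim M) (\<phi> ` U) (\<lambda>y. f (inv_into U \<phi> y)))}"

definition unit_function :: "'m manifold \<Rightarrow> 'm \<Rightarrow> real" where
  "unit_function M = indicator (topspace (mtop M))"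


section \<open>Vector fields and differential forms\<close>

text \<open>Vector fields are the derivations of the algebra of smooth functions.\<close>

type_synonym 'm vf = "('m \<Rightarrow> real) \<Rightarrow> 'm \<Rightarrow> real"

definition vector_fields :: "'m manifold \<Rightarrow> 'm vf set" where
  "vector_fields M =
     {X. (\<forall>f. f \<notin> smooth_functions M \<longrightarrow> X f = 0) \<and>
         (\<forall>f\<in>smooth_functions M. X f \<in> smooth_functions M) \<and>
         (\<forall>f\<in>smooth_functions M. \<forall>g\<in>smooth_functions M. X (f + g) = X f + X g) \<and>
         (\<forall>r. \<forall>f\<in>smooth_functions M. X (r *\<^sub>R f) = r *\<^sub>R X f) \<and>
         (\<forall>f\<in>smooth_functions M. \<forall>g\<in>smooth_functions M. X (f * g) = X f * g + f * X g)}"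

definition lie_bracket :: "'m vf \<Rightarrow> 'm vf \<Rightarrow> 'm vf" where
  "lie_bracket X Y = (\<lambda>f. X (Y f) - Y (X f))"

text \<open>
  A differential \<open>k\<close>-form is an alternating map, multilinear over the smooth functions, from
  \<open>k\<close>-tuples of vector fields to smooth functions. An inhomogeneous form is one function on lists
  of vector fields; its component of degree \<open>k\<close> is its restriction to the lists of length \<open>k\<close>.
  Only finitely many components are nonzero.
\<close>

type_synonym 'm form = "'m vf list \<Rightarrow> 'm \<Rightarrow> real"

definition forms :: "'m manifold \<Rightarrow> 'm form set" where
  "forms M =
     {\<omega>. (\<forall>Xs. Xs \<notin> lists (vector_fields M) \<longrightarrow> \<omega> Xs = 0) \<and>
         (\<forall>Xs\<in>lists (vector_fields M). \<omega> Xs \<in> smooth_functions M) \<and>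
         (\<forall>Xs\<in>lists (vector_fields M). \<forall>Ys\<in>lists (vector_fields M).
            \<forall>X\<in>vector_fields M. \<forall>Y\<in>vector_fields M.
              \<omega> (Xs @ (X + Y) # Ys) = \<omega> (Xs @ X # Ys) + \<omega> (Xs @ Y # Ys)) \<and>
         (\<forall>Xs\<in>lists (vector_fields M). \<forall>Ys\<in>lists (vector_fields M).
            \<forall>X\<in>vector_fields M. \<forall>f\<in>smooth_functions M.
              \<omega> (Xs @ (\<lambda>g. f * X g) # Ys) = f * \<omega> (Xs @ X # Ys)) \<and>
         (\<forall>Xs\<in>lists (vector_fields M). \<forall>Ys\<in>lists (vector_fields M).
            \<forall>Zs\<in>lists (vector_fields M). \<forall>X\<in>vector_fields M.
              \<omega> (Xs @ X # Ys @ X # Zs) = 0) \<and>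
         (\<exists>N. \<forall>Xs. length Xs > N \<longrightarrow> \<omega> Xs = 0)}"

definition kforms :: "'m manifold \<Rightarrow> nat \<Rightarrow> 'm form set" where
  "kforms M k = {\<omega> \<in> forms M. \<forall>Xs. length Xs \<noteq> k \<longrightarrow> \<omega> Xs = 0}"

definition form0 :: "('m \<Rightarrow> real) \<Rightarrow> 'm form" where
  "form0 f = (\<lambda>Xs. if Xs = [] then f else 0)"

definition fmult :: "('m \<Rightarrow> real) \<Rightarrow> 'm form \<Rightarrow> 'm form" where
  "fmult f \<omega> = (\<lambda>Xs. f * \<omega> Xs)"

text \<open>
  Shuffle product, without factorials: \<open>S\<close> is the set of positions of the arguments given to
  \<open>\<alpha>\<close>, and the exponent is the number of inversions of the corresponding shuffle.
\<close>

definition wedge :: "'m form \<Rightarrow> 'm form \<Rightarrow> 'm form" where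
  "wedge \<alpha> \<beta> = (\<lambda>Xs. \<Sum>S\<in>Pow {..<length Xs}.
     (-1) ^ card {(i, j). i \<in> S \<and> j \<in> {..<length Xs} - S \<and> j < i} *
     \<alpha> (nths Xs S) * \<beta> (nths Xs (- S)))"

definition contraction :: "'m vf \<Rightarrow> 'm form \<Rightarrow> 'm form" where
  "contraction X \<omega> = (\<lambda>Xs. \<omega> (X # Xs))"

definition ext_deriv :: "'m manifold \<Rightarrow> 'm form \<Rightarrow> 'm form" where
  "ext_deriv M \<omega> = (\<lambda>Xs. if Xs \<in> lists (vector_fields M) then
       (\<Sum>i<length Xs. (-1) ^ i * (Xs ! i) (\<omega> (nths Xs (- {i})))) +
       (\<Sum>j<length Xs. \<Sum>i<j. (-1) ^ (i + j) *
          \<omega> (lie_bracket (Xs ! i) (Xs ! j) # nths Xs (- {i, j})))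
     else 0)"

definition lie_deriv :: "'m manifold \<Rightarrow> 'm vf \<Rightarrow> 'm form \<Rightarrow> 'm form" where
  "lie_deriv M X \<omega> = (\<lambda>Xs. if Xs \<in> lists (vector_fields M) then
       X (\<omega> Xs) - (\<Sum>i<length Xs. \<omega> (Xs[i := lie_bracket X (Xs ! i)]))
     else 0)"


section \<open>The functions on the dg-manifold and their derivations\<close>

text \<open>
  An element of \<open>\<Omega>M \<otimes> \<Lambda>[q] \<otimes> \<real>[t]\<close> is the finite sum of the \<open>a n e \<otimes> q^e \<otimes> t^n\<close>, where \<open>e\<close> is the
  exponent 0 (\<open>False\<close>) or 1 (\<open>True\<close>) of \<open>q\<close>; the coefficient is on the left.
\<close>

type_synonym 'm pfun = "nat \<Rightarrow> bool \<Rightarrow> 'm form"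
type_synonym 'm pop = "'m pfun \<Rightarrow> 'm pfun"

definition pfuns :: "'m manifold \<Rightarrow> 'm pfun set" where
  "pfuns M = {a. (\<forall>n e. a n e \<in> forms M) \<and> finite {n. \<exists>e. a n e \<noteq> 0}}"

definition pfuns_deg :: "'m manifold \<Rightarrow> int \<Rightarrow> 'm pfun set" where
  "pfuns_deg M k = {a \<in> pfuns M. \<forall>n e Xs. a n e Xs \<noteq> 0 \<longrightarrow>
     int (length Xs) + of_bool e + 2 * int n = k}"

text \<open>The sign \<open>\<omega> \<mapsto> (-1)^|\<omega>| \<omega>\<close> arises from moving \<open>q\<close> (or \<open>\<partial>\<^sub>q\<close>) past a form.\<close>

definition parity_sign :: "'m form \<Rightarrow> 'm form" where
  "parity_sign \<omega> = (\<lambda>Xs. (-1) ^ length Xs * \<omega> Xs)"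

definition pmult :: "'m pfun \<Rightarrow> 'm pfun \<Rightarrow> 'm pfun" where
  "pmult a b = (\<lambda>n e. \<Sum>i\<le>n.
     if e then wedge (a i False) (b (n - i) True) + wedge (a i True) (parity_sign (b (n - i) False))
     else wedge (a i False) (b (n - i) False))"

definition pform :: "'m form \<Rightarrow> 'm pfun" where
  "pform \<omega> = (\<lambda>n e. if n = 0 \<and> \<not> e then \<omega> else 0)"

definition q_var :: "'m manifold \<Rightarrow> 'm pfun" where
  "q_var M = (\<lambda>n e. if n = 0 \<and> e then form0 (unit_function M) else 0)"

definition int_sign :: "int \<Rightarrow> real" where
  "int_sign k = (if even k then 1 else -1)"

definition graded_derivations :: "'m manifold \<Rightarrow> int \<Rightarrow> 'm pop set" where
  "graded_derivations M k =
     {D. (\<forall>a. a \<notin> pfuns M \<longrightarrow> D a = 0) \<and>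
         (\<forall>a\<in>pfuns M. \<forall>b\<in>pfuns M. D (a + b) = D a + D b) \<and>
         (\<forall>r. \<forall>a\<in>pfuns M. D (r *\<^sub>R a) = r *\<^sub>R D a) \<and>
         (\<forall>j. \<forall>a\<in>pfuns_deg M j. D a \<in> pfuns_deg M (j + k)) \<and>
         (\<forall>j. \<forall>a\<in>pfuns_deg M j. \<forall>b\<in>pfuns M.
            D (pmult a b) = pmult (D a) b + int_sign (k * j) *\<^sub>R pmult a (D b))}"

definition graded_commutator :: "int \<Rightarrow> int \<Rightarrow> 'm pop \<Rightarrow> 'm pop \<Rightarrow> 'm pop" where
  "graded_commutator k l D E = (\<lambda>a. D (E a) - int_sign (k * l) *\<^sub>R E (D a))"

definition left_mult :: "'m pfun \<Rightarrow> 'm pop \<Rightarrow> 'm pop" where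
  "left_mult u D = (\<lambda>a. pmult u (D a))"

definition d_op :: "'m manifold \<Rightarrow> 'm pop" where
  "d_op M = (\<lambda>a. if a \<in> pfuns M then (\<lambda>n e. ext_deriv M (a n e)) else 0)"

definition iota_op :: "'m manifold \<Rightarrow> 'm vf \<Rightarrow> 'm pop" where
  "iota_op M X = (\<lambda>a. if a \<in> pfuns M then (\<lambda>n e. contraction X (a n e)) else 0)"

definition dq_op :: "'m manifold \<Rightarrow> 'm pop" where
  "dq_op M = (\<lambda>a. if a \<in> pfuns M then (\<lambda>n e. if e then 0 else parity_sign (a n True)) else 0)"

definition dt_op :: "'m manifold \<Rightarrow> 'm pop" where
  "dt_op M = (\<lambda>a. if a \<in> pfuns M then (\<lambda>n e. real (Suc n) *\<^sub>R a (Suc n) e) else 0)"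

definition Q_P :: "'m manifold \<Rightarrow> 'm form \<Rightarrow> 'm form \<Rightarrow> 'm pop" where
  "Q_P M F H = d_op M + left_mult (pform F) (dq_op M) +
     left_mult (pform H + pmult (q_var M) (pform F)) (dt_op M)"

definition homological :: "'m manifold \<Rightarrow> 'm pop \<Rightarrow> bool" where
  "homological M Q \<longleftrightarrow> Q \<in> graded_derivations M 1 \<and> (\<forall>a. Q (Q a) = 0)"


section \<open>Dg-Leibniz algebras in nonpositive degrees\<close>

text \<open>
  The operations take the degrees of their arguments as parameters:
  \<open>dgl_diff L k\<close> acts on degree \<open>k\<close> and \<open>dgl_br L i j\<close> on degrees \<open>i\<close> and \<open>j\<close>.
\<close>

record 'v dgl =
  dgl_comp :: "int \<Rightarrow> 'v set"
  dgl_diff :: "int \<Rightarrow> 'v \<Rightarrow> 'v"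
  dgl_br :: "int \<Rightarrow> int \<Rightarrow> 'v \<Rightarrow> 'v \<Rightarrow> 'v"

definition lin_between :: "'v::real_vector set \<Rightarrow> 'w::real_vector set \<Rightarrow> ('v \<Rightarrow> 'w) \<Rightarrow> bool" where
  "lin_between V W f \<longleftrightarrow> f ` V \<subseteq> W \<and> (\<forall>x\<in>V. \<forall>y\<in>V. f (x + y) = f x + f y) \<and>
     (\<forall>r. \<forall>x\<in>V. f (r *\<^sub>R x) = r *\<^sub>R f x)"

text \<open>
  In the compatibility of the differential with the bracket, \<open>b\<close> has negative degree. For \<open>b\<close>
  of degree 0 the term \<open>\<delta> b\<close> belongs to degree 1, which is cut off; replacing it by 0 would
  contradict the mixed brackets of the structures considered here, as \<open>\<lfloor>h, X\<rfloor> = - X(h)\<close> has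
  differential \<open>- d (X(h))\<close> while \<open>\<lfloor>dh, X\<rfloor> = 0\<close>. For derived brackets \<open>\<delta> b\<close> is still available as
  the commutator with \<open>Q\<close>, and \<open>derived_compatible\<close> below is the identity for all \<open>a\<close> and \<open>b\<close>.
\<close>

definition dg_leibniz :: "'v::real_vector dgl \<Rightarrow> bool" where
  "dg_leibniz L \<longleftrightarrow>
     (\<forall>k. subspace (dgl_comp L k)) \<and>
     (\<forall>k>0. dgl_comp L k = {0}) \<and>
     (\<forall>k. lin_between (dgl_comp L k) (dgl_comp L (k + 1)) (dgl_diff L k)) \<and>
     (\<forall>k. \<forall>a\<in>dgl_comp L k. dgl_diff L (k + 1) (dgl_diff L k a) = 0) \<and>
     (\<forall>i j. \<forall>a\<in>dgl_comp L i. lin_between (dgl_comp L j) (dgl_comp L (i + j)) (dgl_br L i j a)) \<and>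
     (\<forall>i j. \<forall>b\<in>dgl_comp L j.
        lin_between (dgl_comp L i) (dgl_comp L (i + j)) (\<lambda>a. dgl_br L i j a b)) \<and>
     (\<forall>i j. j < 0 \<longrightarrow> (\<forall>a\<in>dgl_comp L i. \<forall>b\<in>dgl_comp L j.
        dgl_diff L (i + j) (dgl_br L i j a b) =
          dgl_br L (i + 1) j (dgl_diff L i a) b +
          int_sign i *\<^sub>R dgl_br L i (j + 1) a (dgl_diff L j b))) \<and>
     (\<forall>i j k. \<forall>a\<in>dgl_comp L i. \<forall>b\<in>dgl_comp L j. \<forall>c\<in>dgl_comp L k.
        dgl_br L i (j + k) a (dgl_br L j k b c) =
          dgl_br L (i + j) k (dgl_br L i j a b) c +
          int_sign (i * j) *\<^sub>R dgl_br L j (i + k) b (dgl_br L i k a c))"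

definition dg_leibniz_iso ::
    "'v::real_vector dgl \<Rightarrow> 'w::real_vector dgl \<Rightarrow> (int \<Rightarrow> 'v \<Rightarrow> 'w) \<Rightarrow> bool" where
  "dg_leibniz_iso L L' \<phi> \<longleftrightarrow>
     dg_leibniz L \<and> dg_leibniz L' \<and>
     (\<forall>k. lin_between (dgl_comp L k) (dgl_comp L' k) (\<phi> k) \<and>
          bij_betw (\<phi> k) (dgl_comp L k) (dgl_comp L' k)) \<and>
     (\<forall>k. \<forall>a\<in>dgl_comp L k. \<phi> (k + 1) (dgl_diff L k a) = dgl_diff L' k (\<phi> k a)) \<and>
     (\<forall>i j. \<forall>a\<in>dgl_comp L i. \<forall>b\<in>dgl_comp L j.
        \<phi> (i + j) (dgl_br L i j a b) = dgl_br L' i j (\<phi> i a) (\<phi> j b))"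

definition dg_leibniz_isomorphic :: "'v::real_vector dgl \<Rightarrow> 'w::real_vector dgl \<Rightarrow> bool" where
  "dg_leibniz_isomorphic L L' \<longleftrightarrow> (\<exists>\<phi>. dg_leibniz_iso L L' \<phi>)"

definition dg_leibniz_sub :: "'v::real_vector dgl \<Rightarrow> 'v dgl \<Rightarrow> bool" where
  "dg_leibniz_sub S L \<longleftrightarrow>
     dg_leibniz S \<and> dg_leibniz L \<and>
     (\<forall>k. dgl_comp S k \<subseteq> dgl_comp L k) \<and>
     (\<forall>k. \<forall>a\<in>dgl_comp S k. dgl_diff S k a = dgl_diff L k a) \<and>
     (\<forall>i j. \<forall>a\<in>dgl_comp S i. \<forall>b\<in>dgl_comp S j. dgl_br S i j a b = dgl_br L i j a b)"

definition fixed_points :: "'v dgl \<Rightarrow> (int \<Rightarrow> 'v \<Rightarrow> 'v) \<Rightarrow> 'v dgl" where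
  "fixed_points L \<phi> = L\<lparr>dgl_comp := (\<lambda>k. {a \<in> dgl_comp L k. \<phi> k a = a})\<rparr>"


section \<open>Derived symmetries and the T-duality automorphism\<close>

text \<open>An element of degree \<open>k\<close> of the derived structure is a derivation of degree \<open>k - 1\<close>.\<close>

definition derived_diff :: "'m pop \<Rightarrow> int \<Rightarrow> 'm pop \<Rightarrow> 'm pop" where
  "derived_diff Q k a = graded_commutator 1 (k - 1) Q a"

definition derived_bracket :: "'m pop \<Rightarrow> int \<Rightarrow> int \<Rightarrow> 'm pop \<Rightarrow> 'm pop \<Rightarrow> 'm pop" where
  "derived_bracket Q i j a b =
     int_sign i *\<^sub>R graded_commutator i (j - 1) (graded_commutator 1 (i - 1) Q a) b"

definition sym0 ::
    "'m manifold \<Rightarrow> 'm vf \<Rightarrow> ('m \<Rightarrow> real) \<Rightarrow> ('m \<Rightarrow> real) \<Rightarrow> 'm form \<Rightarrow> 'm pop" where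
  "sym0 M X f f' C = iota_op M X + left_mult (pform (form0 f)) (dq_op M) +
     left_mult (pform C + pmult (q_var M) (pform (form0 f'))) (dt_op M)"

definition sym1 :: "'m manifold \<Rightarrow> ('m \<Rightarrow> real) \<Rightarrow> 'm pop" where
  "sym1 M h = left_mult (pform (form0 h)) (dt_op M)"

definition Dsym_comp :: "'m manifold \<Rightarrow> int \<Rightarrow> 'm pop set" where
  "Dsym_comp M k =
     (if k = 0 then {D \<in> graded_derivations M (-1).
        \<exists>X\<in>vector_fields M. \<exists>f\<in>smooth_functions M. \<exists>f'\<in>smooth_functions M. \<exists>C\<in>kforms M 1.
          D = sym0 M X f f' C}
      else if k = -1 then {D \<in> graded_derivations M (-2). \<exists>h\<in>smooth_functions M. D = sym1 M h}
      else {0})"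

definition Dsym :: "'m manifold \<Rightarrow> 'm pop \<Rightarrow> 'm pop dgl" where
  "Dsym M Q = \<lparr>dgl_comp = Dsym_comp M,
     dgl_diff = (\<lambda>k a. if k = -1 then derived_diff Q k a else 0),
     dgl_br = derived_bracket Q\<rparr>"

definition derived_compatible :: "'m manifold \<Rightarrow> 'm pop \<Rightarrow> bool" where
  "derived_compatible M Q \<longleftrightarrow> (\<forall>i j. \<forall>a\<in>Dsym_comp M i. \<forall>b\<in>Dsym_comp M j.
     derived_diff Q (i + j) (derived_bracket Q i j a b) =
       derived_bracket Q (i + 1) j (derived_diff Q i a) b +
       int_sign i *\<^sub>R derived_bracket Q i (j + 1) a (derived_diff Q j b))"

text \<open>The coefficients of an element of degree 0 are uniquely determined by it.\<close>

definition DPhi :: "'m manifold \<Rightarrow> int \<Rightarrow> 'm pop \<Rightarrow> 'm pop" where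
  "DPhi M k D =
     (if k = 0 then (THE E.
        \<exists>X\<in>vector_fields M. \<exists>f\<in>smooth_functions M. \<exists>f'\<in>smooth_functions M. \<exists>C\<in>kforms M 1.
          D = sym0 M X f f' C \<and> E = sym0 M X f' f C)
      else D)"


section \<open>The twisted \<open>B\<^sub>n\<close> generalized geometry structure\<close>

text \<open>
  An element \<open>(X, f, C, h)\<close> is the sum of \<open>(X, f, C)\<close> in degree 0 and \<open>h\<close> in degree -1; all
  brackets are then components of one bilinear operation.
\<close>

type_synonym 'm bn = "'m vf \<times> ('m \<Rightarrow> real) \<times> 'm form \<times> ('m \<Rightarrow> real)"

definition Bn_comp :: "'m manifold \<Rightarrow> int \<Rightarrow> 'm bn set" where
  "Bn_comp M k =
     (if k = 0 then {(X, f, C, h).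
        X \<in> vector_fields M \<and> f \<in> smooth_functions M \<and> C \<in> kforms M 1 \<and> h = 0}
      else if k = -1 then {(X, f, C, h). X = 0 \<and> f = 0 \<and> C = 0 \<and> h \<in> smooth_functions M}
      else {0})"

definition Bn_diff :: "'m manifold \<Rightarrow> 'm bn \<Rightarrow> 'm bn" where
  "Bn_diff M = (\<lambda>(X, f, C, h). (0, 0, ext_deriv M (form0 h), 0))"

definition Bn_bracket :: "'m manifold \<Rightarrow> 'm form \<Rightarrow> 'm form \<Rightarrow> 'm bn \<Rightarrow> 'm bn \<Rightarrow> 'm bn" where
  "Bn_bracket M F H = (\<lambda>(X, f, C, h) (Y, g, D, k).
     (lie_bracket X Y,
      X g - Y f - contraction Y (contraction X F) [],
      lie_deriv M X D - contraction Y (ext_deriv M C) - contraction Y (contraction X H)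
        - 2 *\<^sub>R fmult f (contraction Y F) + 2 *\<^sub>R fmult g (contraction X F)
        + 2 *\<^sub>R fmult g (ext_deriv M (form0 f)),
      X k - Y h))"

definition Bn_structure :: "'m manifold \<Rightarrow> 'm form \<Rightarrow> 'm form \<Rightarrow> 'm bn dgl" where
  "Bn_structure M F H = \<lparr>dgl_comp = Bn_comp M, dgl_diff = (\<lambda>k. Bn_diff M),
     dgl_br = (\<lambda>i j. Bn_bracket M F H)\<rparr>"

end

theory Submission
  imports Defs
begin

text \<open>
  Contraction by a vector field is an antiderivation of the shuffle product, and Cartan's formulas
  \<open>\<iota>\<^sub>Y \<L>\<^sub>X = \<L>\<^sub>X \<iota>\<^sub>Y - \<iota>\<^bsub>[X,Y]\<^esub>\<close> and \<open>\<iota>\<^sub>X d = \<L>\<^sub>X - d \<iota>\<^sub>X\<close> hold by inspection of the defining sums.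
  Since a form is determined by its contractions, they yield the whole calculus (\<open>d\<close> and \<open>\<L>\<^sub>X\<close>
  preserve forms and are derivations, \<open>d\<^sup>2 = 0\<close>, \<open>[\<L>\<^sub>X, d] = 0\<close>) by induction on the number of arguments;
  of the manifold one only uses that its smooth functions form an algebra.

  All operators in question have the shape \<open>\<Theta> + \<alpha> \<partial>\<^sub>q + (\<beta> + \<gamma> q) \<partial>\<^sub>t\<close> with a derivation \<open>\<Theta>\<close> of the
  algebra of forms, and one formula for the graded commutator of two of them gives \<open>Q\<^sup>2 = 0\<close>, the
  differential and the derived brackets. The dg-Leibniz identities follow from the graded Jacobi
  identity and \<open>Q\<^sup>2 = 0\<close>. The bracket of the elements with coefficients \<open>(X, f, f', C)\<close> and
  \<open>(Y, g, g', D)\<close> is equivariant under the simultaneous exchange of \<open>f, f'\<close> and \<open>g, g'\<close>, and for \<open>f = f'\<close>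
  and \<open>g = g'\<close> it is the \<open>B\<^sub>n\<close> bracket.
\<close>

section \<open>Smooth functions\<close>

text \<open>The factors 2 of the B_n bracket have one source: F enters Q twice, in the coefficient
  of the q-derivative and in the qF of the t-derivative. A degree 0 element pairs f' with the first
  and f with the second, so the terms of the one-form component that contain these functions come in
  two copies, which add up on the diagonal. Signs are carried by the operators
  \<open>parity_sign\<close>, \<open>qsign\<close> and \<open>psign\<close>, since forms are
  inhomogeneous and contraction mixes parities; degrees return where two coefficients have to be
  interchanged. The obstacle in the calculus is linearity over functions: the Koszul sum for d is
  visibly additive but not visibly tensorial, and the defects of the Lie derivative and of d of a
  product have to cancel. The Leibniz identity of the B_n bracket is never expanded; it is pulled
  back along an injective map into the fixed points. Truncation to the degrees 0 and -1 costs one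
  extra fact: elements of degree -1 have zero bracket with each other.\<close>

lemma Euclidean_space_line_open:
  assumes V: "openin (Euclidean_space n) V" and x: "x \<in> V" and i: "i < n"
  shows "eventually (\<lambda>s. x(i := s) \<in> V) (nhds (x i))"
proof -
  have xV: "\<forall>j\<ge>n. x j = 0"
    using V x openin_subset topspace_Euclidean_space by blast
  have "continuous_map euclideanreal (powertop_real UNIV) (\<lambda>s. x(i := s))"
    by (auto simp: continuous_map_componentwise_UNIV fun_upd_def)
  then have "continuous_map euclideanreal (Euclidean_space n) (\<lambda>s. x(i := s))"
    using xV i by (auto simp: Euclidean_space_def continuous_map_in_subtopology)
  then have "openin euclideanreal {s \<in> topspace euclideanreal. x(i := s) \<in> V}"
    using V by (rule openin_continuous_map_preimage)
  then have "open {s. x(i := s) \<in> V}" by simp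
  then show ?thesis
    using x by (auto simp: eventually_nhds)
qed

lemma eventually_line_eq:
  assumes "openin (Euclidean_space n) V" "x \<in> V" "i < n" "\<And>y. y \<in> V \<Longrightarrow> f y = g y"
  shows "eventually (\<lambda>s. f (x(i := s)) = g (x(i := s))) (nhds (x i))"
  using Euclidean_space_line_open[OF assms(1-3)] by eventually_elim (rule assms(4))

text \<open>A derivative depends on a neighbourhood only, and for \<open>i < n\<close> the line
  through \<open>x\<close> in direction \<open>i\<close> stays in the open set \<open>V\<close> for
  parameters near \<open>x i\<close>.\<close>

lemma partial_deriv_cong:
  assumes "openin (Euclidean_space n) V" "x \<in> V" "i < n" "\<And>y. y \<in> V \<Longrightarrow> f y = g y"
  shows "partial_deriv i f x = partial_deriv i g x"
  unfolding partial_deriv_def using eventually_line_eq[OF assms] by (intro deriv_cong_ev) auto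

lemma field_differentiable_line_cong:
  assumes "openin (Euclidean_space n) V" "x \<in> V" "i < n" "\<And>y. y \<in> V \<Longrightarrow> f y = g y"
    and "(\<lambda>s. f (x(i := s))) field_differentiable at (x i)"
  shows "(\<lambda>s. g (x(i := s))) field_differentiable at (x i)"
proof -
  obtain c where c: "((\<lambda>s. f (x(i := s))) has_field_derivative c) (at (x i))"
    using assms(5) by (auto simp: field_differentiable_def)
  have "((\<lambda>s. g (x(i := s))) has_field_derivative c) (at (x i))"
    using c DERIV_cong_ev[OF refl eventually_line_eq[OF assms(1-3), of f g] refl] assms(4) by blast
  then show ?thesis by (auto simp: field_differentiable_def)
qed

text \<open>The sum and product rules for \<open>partial_deriv\<close> are equations on
  \<open>V\<close> only, since \<open>deriv\<close> is unspecified where differentiability fails.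
  This lemma lets them be used inside the recursion of \<open>Ck_on\<close>; both functions are
  generalised because their partial derivatives again agree on \<open>V\<close>.\<close>

lemma Ck_on_cong:
  assumes V: "openin (Euclidean_space n) V"
    and "\<And>y. y \<in> V \<Longrightarrow> f y = g y" and "Ck_on n k V f"
  shows "Ck_on n k V g"
  using assms(2,3)
proof (induction k arbitrary: f g)
  case 0
  then show ?case by (auto elim!: continuous_map_eq)
next
  case (Suc k)
  have "continuous_map (subtopology (Euclidean_space n) V) euclideanreal g"
    using Suc.prems by (auto elim!: continuous_map_eq)
  moreover have "(\<lambda>s. g (x(i := s))) field_differentiable at (x i)" if "i < n" "x \<in> V" for i x
    using field_differentiable_line_cong[OF V that(2,1), of f g] Suc.prems that by auto
  moreover have "Ck_on n k V (partial_deriv i g)" if "i < n" for i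
    using Suc.IH[of "partial_deriv i f" "partial_deriv i g"] Suc.prems that
      partial_deriv_cong[OF V _ that, of _ f g] by auto
  ultimately show ?case by simp
qed

lemma Ck_on_Suc_D: "Ck_on n (Suc k) V f \<Longrightarrow> Ck_on n k V f"
  by (induction k arbitrary: f) auto

lemma Ck_on_const: "openin (Euclidean_space n) V \<Longrightarrow> Ck_on n k V (\<lambda>_. c)"
proof (induction k arbitrary: c)
  case (Suc k)
  have "partial_deriv i (\<lambda>_. c) = (\<lambda>_. 0)" for i
    by (simp add: partial_deriv_def fun_eq_iff)
  with Suc show ?case by simp
qed simp

lemma Ck_on_add:
  assumes V: "openin (Euclidean_space n) V" and "Ck_on n k V f" "Ck_on n k V g"
  shows "Ck_on n k V (\<lambda>x. f x + g x)"
  using assms(2,3)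
proof (induction k arbitrary: f g)
  case 0
  then show ?case by (auto intro: continuous_map_add)
next
  case (Suc k)
  have "Ck_on n k V (partial_deriv i (\<lambda>x. f x + g x))" if i: "i < n" for i
  proof (rule Ck_on_cong[OF V])
    show "Ck_on n k V (\<lambda>x. partial_deriv i f x + partial_deriv i g x)"
      using Suc i by simp
    show "partial_deriv i f x + partial_deriv i g x = partial_deriv i (\<lambda>x. f x + g x) x"
      if "x \<in> V" for x
      unfolding partial_deriv_def using Suc.prems i that by (intro deriv_add[symmetric]) auto
  qed
  then show ?case
    using Suc.prems by (auto intro: continuous_map_add Derivative.field_differentiable_add)
qed

lemma Ck_on_mult:
  assumes V: "openin (Euclidean_space n) V" and "Ck_on n k V f" "Ck_on n k V g"
  shows "Ck_on n k V (\<lambda>x. f x * g x)"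
  using assms(2,3)
proof (induction k arbitrary: f g)
  case 0
  then show ?case by (auto intro: continuous_map_real_mult)
next
  case (Suc k)
  have "Ck_on n k V (partial_deriv i (\<lambda>x. f x * g x))" if i: "i < n" for i
  proof (rule Ck_on_cong[OF V])
    show "Ck_on n k V (\<lambda>x. f x * partial_deriv i g x + partial_deriv i f x * g x)"
      \<comment> \<open>The undifferentiated factors are C^(k+1), one order more than the induction
        hypothesis asks for; \<open>Ck_on_Suc_D\<close> lowers them.\<close>
      using Suc i by (intro Ck_on_add V Suc.IH) (auto intro: Ck_on_Suc_D simp del: Ck_on.simps(2), auto)
    show "f x * partial_deriv i g x + partial_deriv i f x * g x = partial_deriv i (\<lambda>x. f x * g x) x"
      if "x \<in> V" for x
      unfolding partial_deriv_def using Suc.prems i that by (subst deriv_mult) auto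
  qed
  then show ?case
    using Suc.prems by (auto intro: continuous_map_real_mult field_differentiable_mult)
qed

section \<open>The algebra of smooth functions on a manifold\<close>

locale smooth_mfd =
  fixes M :: "'m manifold"
  assumes smooth_manifold: "smooth_manifold M"
begin

abbreviation CM where "CM \<equiv> smooth_functions M"

lemma chart_open:
  assumes "(U, \<phi>) \<in> atlas M"
  shows "openin (Euclidean_space (mdim M)) (\<phi> ` U)" "U \<subseteq> topspace (mtop M)"
  using smooth_manifold assms openin_subset unfolding smooth_manifold_def by fastforce+

lemma smooth_zero_outside: "f \<in> CM \<Longrightarrow> x \<notin> topspace (mtop M) \<Longrightarrow> f x = 0"
  by (auto simp: smooth_functions_def)

lemma smooth_add [intro]: "f \<in> CM \<Longrightarrow> g \<in> CM \<Longrightarrow> f + g \<in> CM"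
  using chart_open(1) by (fastforce simp: smooth_functions_def smooth_on_def intro!: Ck_on_add)

lemma smooth_mult [intro]: "f \<in> CM \<Longrightarrow> g \<in> CM \<Longrightarrow> f * g \<in> CM"
  using chart_open(1) by (fastforce simp: smooth_functions_def smooth_on_def intro!: Ck_on_mult)

lemma smooth_scaleR [intro]: "f \<in> CM \<Longrightarrow> r *\<^sub>R f \<in> CM"
  using chart_open(1)
  by (fastforce simp: smooth_functions_def smooth_on_def intro!: Ck_on_mult Ck_on_const)

lemma smooth_zero [simp, intro]: "0 \<in> CM"
  using chart_open(1) by (fastforce simp: smooth_functions_def smooth_on_def intro!: Ck_on_const)

lemma smooth_uminus [intro]: "f \<in> CM \<Longrightarrow> - f \<in> CM"
  using smooth_scaleR[of f "-1"] by simp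

lemma smooth_diff [intro]: "f \<in> CM \<Longrightarrow> g \<in> CM \<Longrightarrow> f - g \<in> CM"
  using smooth_add[of f "- g"] smooth_uminus[of g] by simp

text \<open>Functions vanish off the carrier, so the unit of the algebra is the indicator of the
  carrier, which reads as the constant 1 in every chart.\<close>

lemma smooth_unit [intro]: "unit_function M \<in> CM"
proof -
  have "Ck_on (mdim M) k (\<phi> ` U) (\<lambda>y. unit_function M (inv_into U \<phi> y))"
    if "(U, \<phi>) \<in> atlas M" for U \<phi> k
  proof (rule Ck_on_cong[OF chart_open(1)[OF that] _ Ck_on_const[OF chart_open(1)[OF that]]])
    show "1 = unit_function M (inv_into U \<phi> y)" if "y \<in> \<phi> ` U" for y
      using inv_into_into[OF that] chart_open(2)[OF \<open>(U, \<phi>) \<in> atlas M\<close>]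
      by (auto simp: unit_function_def)
  qed
  then show ?thesis by (auto simp: smooth_functions_def smooth_on_def unit_function_def)
qed

lemma unit_mult [simp]: "f \<in> CM \<Longrightarrow> unit_function M * f = f" "f \<in> CM \<Longrightarrow> f * unit_function M = f"
  using smooth_zero_outside[of f] by (auto simp: fun_eq_iff unit_function_def indicator_def)

end

section \<open>The shuffle product\<close>

text \<open>A set of positions of \<open>x # xs\<close> is the shift by \<open>Suc\<close> of a set
  of positions of \<open>xs\<close>, with or without 0. The following lemmas translate sublists,
  inversions and sums along this correspondence.\<close>

lemma nths_Cons_in: "nths (x # xs) (insert 0 (Suc ` S)) = x # nths xs S"
  by (auto simp: nths_Cons intro!: arg_cong[where f = "nths xs"])

lemma nths_Cons_notin: "nths (x # xs) (Suc ` S) = nths xs S"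
  by (auto simp: nths_Cons intro!: arg_cong[where f = "nths xs"])

lemma nths_Compl_Cons_in: "nths (x # xs) (- insert 0 (Suc ` S)) = nths xs (- S)"
proof -
  have "{j. Suc j \<in> - insert 0 (Suc ` S)} = - S" by auto
  then show ?thesis by (simp add: nths_Cons)
qed

lemma nths_Compl_Cons_notin: "nths (x # xs) (- (Suc ` S)) = x # nths xs (- S)"
proof -
  have "{j. Suc j \<in> - (Suc ` S)} = - S" by auto
  then show ?thesis by (auto simp add: nths_Cons)
qed

abbreviation inversions :: "nat \<Rightarrow> nat set \<Rightarrow> (nat \<times> nat) set" where
  "inversions n S \<equiv> {(i, j). i \<in> S \<and> j \<in> {..<n} - S \<and> j < i}"

lemma inversions_Cons_in:
  "inversions (Suc n) (insert 0 (Suc ` S)) = map_prod Suc Suc ` inversions n S"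
proof (intro set_eqI iffI)
  fix p assume "p \<in> inversions (Suc n) (insert 0 (Suc ` S))"
  then obtain i j where "p = (i, j)" "i \<in> insert 0 (Suc ` S)" "j < Suc n"
      "j \<notin> insert 0 (Suc ` S)" "j < i" by auto
  then show "p \<in> map_prod Suc Suc ` inversions n S"
    by (cases i; cases j) (auto simp: image_iff)
qed (auto simp: image_iff)

lemma inversions_Cons_notin:
  "inversions (Suc n) (Suc ` S) = map_prod Suc Suc ` inversions n S \<union> (\<lambda>i. (Suc i, 0)) ` S"
proof (intro set_eqI iffI)
  fix p assume "p \<in> inversions (Suc n) (Suc ` S)"
  then obtain i j where "p = (i, j)" "i \<in> Suc ` S" "j < Suc n" "j \<notin> Suc ` S" "j < i" by auto
  then show "p \<in> map_prod Suc Suc ` inversions n S \<union> (\<lambda>i. (Suc i, 0)) ` S"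
    by (cases i; cases j) (auto simp: image_iff)
qed (auto simp: image_iff)

lemma finite_inversions: "S \<subseteq> {..<n} \<Longrightarrow> finite (inversions n S)"
  by (rule finite_subset[of _ "{..<n} \<times> {..<n}"]) auto

lemma card_inversions_Cons_in:
  "card (inversions (Suc n) (insert 0 (Suc ` S))) = card (inversions n S)"
  unfolding inversions_Cons_in by (rule card_image) (auto simp: inj_on_def)

text \<open>When position 0 belongs to the complement, every element of the shifted set forms one
  new inversion with it.\<close>

lemma card_inversions_Cons_notin:
  assumes "S \<subseteq> {..<n}"
  shows "card (inversions (Suc n) (Suc ` S)) = card (inversions n S) + card S"
proof -
  have "finite S" using assms finite_subset by blast
  then have "card (inversions (Suc n) (Suc ` S)) =
      card (map_prod Suc Suc ` inversions n S) + card ((\<lambda>i. (Suc i, 0::nat)) ` S)"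
    unfolding inversions_Cons_notin using finite_inversions[OF assms]
    by (intro card_Un_disjoint) auto
  also have "card (map_prod Suc Suc ` inversions n S) = card (inversions n S)"
    by (rule card_image) (auto simp: inj_on_def)
  also have "card ((\<lambda>i. (Suc i, 0::nat)) ` S) = card S"
    by (rule card_image) (auto simp: inj_on_def)
  finally show ?thesis .
qed

lemma Pow_lessThan_Suc_shift:
  "Pow {..<Suc n} = (\<lambda>S. insert 0 (Suc ` S)) ` Pow {..<n} \<union> (\<lambda>S. Suc ` S) ` Pow {..<n}"
proof (intro set_eqI iffI)
  fix T assume T: "T \<in> Pow {..<Suc n}"
  define S where "S = Suc -` T"
  have "S \<in> Pow {..<n}" using T by (auto simp: S_def)
  moreover have "T = (if 0 \<in> T then insert 0 (Suc ` S) else Suc ` S)"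
  proof (rule set_eqI)
    show "x \<in> T \<longleftrightarrow> x \<in> (if 0 \<in> T then insert 0 (Suc ` S) else Suc ` S)" for x
      by (cases x) (auto simp: S_def)
  qed
  ultimately show "T \<in> (\<lambda>S. insert 0 (Suc ` S)) ` Pow {..<n} \<union> (\<lambda>S. Suc ` S) ` Pow {..<n}"
    by (auto split: if_splits)
qed (auto simp: image_iff)

lemma sum_Pow_lessThan_Suc:
  fixes g :: "nat set \<Rightarrow> 'a::comm_monoid_add"
  shows "(\<Sum>S\<in>Pow {..<Suc n}. g S) =
    (\<Sum>S\<in>Pow {..<n}. g (insert 0 (Suc ` S))) + (\<Sum>S\<in>Pow {..<n}. g (Suc ` S))"
proof -
  have "(\<Sum>S\<in>Pow {..<Suc n}. g S) =
    (\<Sum>S\<in>(\<lambda>S. insert 0 (Suc ` S)) ` Pow {..<n}. g S) + (\<Sum>S\<in>(\<lambda>S. Suc ` S) ` Pow {..<n}. g S)"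
    unfolding Pow_lessThan_Suc_shift by (rule sum.union_disjoint) auto
  also have "(\<Sum>S\<in>(\<lambda>S. insert 0 (Suc ` S)) ` Pow {..<n}. g S) =
      (\<Sum>S\<in>Pow {..<n}. g (insert 0 (Suc ` S)))"
    by (subst sum.reindex) (auto simp: inj_on_def inj_image_eq_iff)
  also have "(\<Sum>S\<in>(\<lambda>S. Suc ` S) ` Pow {..<n}. g S) = (\<Sum>S\<in>Pow {..<n}. g (Suc ` S))"
    by (subst sum.reindex) (auto simp: inj_on_def inj_image_eq_iff)
  finally show ?thesis .
qed

lemma length_nths_subset: "S \<subseteq> {..<length xs} \<Longrightarrow> length (nths xs S) = card S"
  unfolding length_nths by (rule arg_cong[where f = card]) auto

lemma wedge_Nil [simp]: "wedge \<alpha> \<beta> [] = \<alpha> [] * \<beta> []"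
  by (simp add: wedge_def)

text \<open>The shuffles are split by the factor that receives \<open>X\<close>. If it is the second
  one, the additional \<open>card S\<close> inversions amount to
  \<open>parity_sign \<alpha>\<close>. Together with \<open>wedge_Nil\<close> this is a recursion on
  the argument list, which replaces shuffles in the proofs of associativity, commutativity and
  closure.\<close>

lemma wedge_Cons:
  "wedge \<alpha> \<beta> (X # Xs) =
     wedge (contraction X \<alpha>) \<beta> Xs + wedge (parity_sign \<alpha>) (contraction X \<beta>) Xs"
proof -
  let ?n = "length Xs"
  let ?t = "\<lambda>S. (-1) ^ card (inversions (Suc ?n) S) *
     \<alpha> (nths (X # Xs) S) * \<beta> (nths (X # Xs) (- S))"
  have "wedge \<alpha> \<beta> (X # Xs) = (\<Sum>S\<in>Pow {..<?n}. ?t (insert 0 (Suc ` S))) +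
      (\<Sum>S\<in>Pow {..<?n}. ?t (Suc ` S))"
    unfolding wedge_def by (simp only: list.size add_Suc_right add_0_right sum_Pow_lessThan_Suc)
  also have "(\<Sum>S\<in>Pow {..<?n}. ?t (insert 0 (Suc ` S))) = wedge (contraction X \<alpha>) \<beta> Xs"
    unfolding wedge_def contraction_def card_inversions_Cons_in nths_Cons_in nths_Compl_Cons_in ..
  also have "(\<Sum>S\<in>Pow {..<?n}. ?t (Suc ` S)) = wedge (parity_sign \<alpha>) (contraction X \<beta>) Xs"
    unfolding wedge_def
  proof (rule sum.cong[OF refl])
    fix S assume "S \<in> Pow {..<?n}"
    then have S: "S \<subseteq> {..<?n}" by simp
    show "?t (Suc ` S) = (-1) ^ card (inversions ?n S) * parity_sign \<alpha> (nths Xs S) *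
        contraction X \<beta> (nths Xs (- S))"
      by (simp only: card_inversions_Cons_notin[OF S] nths_Cons_notin nths_Compl_Cons_notin
          parity_sign_def contraction_def length_nths_subset[OF S] power_add mult.assoc)
  qed
  finally show ?thesis .
qed

lemma contraction_wedge:
  "contraction X (wedge \<alpha> \<beta>) =
     wedge (contraction X \<alpha>) \<beta> + wedge (parity_sign \<alpha>) (contraction X \<beta>)"
  by (rule ext) (simp add: contraction_def[of X "wedge \<alpha> \<beta>"] wedge_Cons)

lemma wedge_add_left: "wedge (\<alpha> + \<alpha>') \<beta> = wedge \<alpha> \<beta> + wedge \<alpha>' \<beta>"
  by (rule ext) (simp add: wedge_def distrib_left distrib_right sum.distrib)

lemma wedge_add_right: "wedge \<alpha> (\<beta> + \<beta>') = wedge \<alpha> \<beta> + wedge \<alpha> \<beta>'"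
  by (rule ext) (simp add: wedge_def distrib_left distrib_right sum.distrib)

lemma sum_function_apply: "(\<Sum>i\<in>A. f i) x = (\<Sum>i\<in>A. f i x)"
  by (induction A rule: infinite_finite_induct) auto

lemma wedge_scaleR_left: "wedge (r *\<^sub>R \<alpha>) \<beta> = r *\<^sub>R wedge \<alpha> \<beta>"
  by (intro ext) (simp add: wedge_def sum_function_apply sum_distrib_left mult_ac)

lemma wedge_scaleR_right: "wedge \<alpha> (r *\<^sub>R \<beta>) = r *\<^sub>R wedge \<alpha> \<beta>"
  by (intro ext) (simp add: wedge_def sum_function_apply sum_distrib_left mult_ac)

lemma wedge_zero_left [simp]: "wedge 0 \<beta> = 0"
  using wedge_scaleR_left[of 0 0 \<beta>] by simp

lemma wedge_zero_right [simp]: "wedge \<alpha> 0 = 0"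
  using wedge_scaleR_right[of \<alpha> 0 0] by simp

lemma wedge_uminus_left: "wedge (- \<alpha>) \<beta> = - wedge \<alpha> \<beta>"
  using wedge_scaleR_left[of "-1" \<alpha> \<beta>] by simp

lemma wedge_uminus_right: "wedge \<alpha> (- \<beta>) = - wedge \<alpha> \<beta>"
  using wedge_scaleR_right[of \<alpha> "-1" \<beta>] by simp

lemma wedge_diff_left: "wedge (\<alpha> - \<alpha>') \<beta> = wedge \<alpha> \<beta> - wedge \<alpha>' \<beta>"
  using wedge_add_left[of \<alpha> "- \<alpha>'" \<beta>] by (simp add: wedge_uminus_left)

lemma wedge_diff_right: "wedge \<alpha> (\<beta> - \<beta>') = wedge \<alpha> \<beta> - wedge \<alpha> \<beta>'"
  using wedge_add_right[of \<alpha> \<beta> "- \<beta>'"] by (simp add: wedge_uminus_right)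

lemmas wedge_linear =
  wedge_add_left wedge_add_right wedge_diff_left wedge_diff_right
  wedge_uminus_left wedge_uminus_right wedge_scaleR_left wedge_scaleR_right

lemma wedge_fmult_left: "wedge (fmult f \<alpha>) \<beta> = fmult f (wedge \<alpha> \<beta>)"
  by (rule ext) (simp add: wedge_def fmult_def sum_distrib_left mult_ac)

lemma wedge_fmult_right: "wedge \<alpha> (fmult f \<beta>) = fmult f (wedge \<alpha> \<beta>)"
  by (rule ext) (simp add: wedge_def fmult_def sum_distrib_left mult_ac)

lemma fmult_add: "fmult f (\<alpha> + \<beta>) = fmult f \<alpha> + fmult f \<beta>"
  and fmult_diff: "fmult f (\<alpha> - \<beta>) = fmult f \<alpha> - fmult f \<beta>"
  and fmult_uminus: "fmult f (- \<alpha>) = - fmult f \<alpha>"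
  and fmult_zero [simp]: "fmult f 0 = 0"
  by (auto simp: fmult_def fun_eq_iff algebra_simps)

lemma contraction_add: "contraction X (\<alpha> + \<beta>) = contraction X \<alpha> + contraction X \<beta>"
  and contraction_diff: "contraction X (\<alpha> - \<beta>) = contraction X \<alpha> - contraction X \<beta>"
  and contraction_uminus: "contraction X (- \<alpha>) = - contraction X \<alpha>"
  and contraction_scaleR: "contraction X (r *\<^sub>R \<alpha>) = r *\<^sub>R contraction X \<alpha>"
  and contraction_fmult: "contraction X (fmult f \<alpha>) = fmult f (contraction X \<alpha>)"
  and contraction_zero [simp]: "contraction X 0 = 0"
  by (auto simp: contraction_def fun_eq_iff fmult_def)

lemma contraction_form0 [simp]: "contraction X (form0 f) = 0"
  by (auto simp: contraction_def fun_eq_iff form0_def)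

lemma contraction_parity_sign: "contraction X (parity_sign \<alpha>) = - parity_sign (contraction X \<alpha>)"
  by (auto simp: contraction_def fun_eq_iff parity_sign_def)

lemma parity_sign_add: "parity_sign (\<alpha> + \<beta>) = parity_sign \<alpha> + parity_sign \<beta>"
  and parity_sign_diff: "parity_sign (\<alpha> - \<beta>) = parity_sign \<alpha> - parity_sign \<beta>"
  and parity_sign_uminus: "parity_sign (- \<alpha>) = - parity_sign \<alpha>"
  and parity_sign_scaleR: "parity_sign (r *\<^sub>R \<alpha>) = r *\<^sub>R parity_sign \<alpha>"
  and parity_sign_zero [simp]: "parity_sign 0 = 0"
  by (auto simp: parity_sign_def fun_eq_iff fmult_def algebra_simps)

lemmas parity_sign_linear =
  parity_sign_add parity_sign_diff parity_sign_uminus parity_sign_scaleR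

lemma parity_sign_idem [simp]: "parity_sign (parity_sign \<alpha>) = \<alpha>"
proof -
  have "(-1) ^ n * ((-1) ^ n * f) = f" for n and f :: "'a \<Rightarrow> real"
    by (cases "even n") auto
  then show ?thesis by (simp add: parity_sign_def)
qed

lemma parity_sign_form0 [simp]: "parity_sign (form0 f) = form0 f"
  by (auto simp: parity_sign_def fun_eq_iff form0_def)

lemma contraction_apply: "contraction X \<omega> Xs = \<omega> (X # Xs)"
  by (simp add: contraction_def)

lemma parity_sign_wedge: "parity_sign (wedge \<alpha> \<beta>) = wedge (parity_sign \<alpha>) (parity_sign \<beta>)"
proof
  fix Xs show "parity_sign (wedge \<alpha> \<beta>) Xs = wedge (parity_sign \<alpha>) (parity_sign \<beta>) Xs"
  proof (induction Xs arbitrary: \<alpha> \<beta>)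
    case (Cons X Xs)
    have "parity_sign (wedge \<alpha> \<beta>) (X # Xs) = - parity_sign (contraction X (wedge \<alpha> \<beta>)) Xs"
      by (simp add: parity_sign_def contraction_apply)
    then show ?case
      by (simp add: contraction_wedge parity_sign_add Cons.IH wedge_Cons contraction_parity_sign wedge_linear)
  qed (simp add: parity_sign_def)
qed

text \<open>Contracting either side yields three products, one for each factor that is hit, with
  signs on the factors before it. They are instances of the claim on a shorter list, hence the
  generalisation over all three factors.\<close>

lemma wedge_assoc: "wedge (wedge \<alpha> \<beta>) \<gamma> = wedge \<alpha> (wedge \<beta> \<gamma>)"
proof
  fix Xs show "wedge (wedge \<alpha> \<beta>) \<gamma> Xs = wedge \<alpha> (wedge \<beta> \<gamma>) Xs"
    by (induction Xs arbitrary: \<alpha> \<beta> \<gamma>)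
      (simp_all add: wedge_Cons contraction_wedge parity_sign_wedge wedge_linear mult.assoc add.assoc)
qed

text \<open>Contraction changes the parity of \<open>\<alpha>\<close>, so the even and the odd case
  feed each other and are proved together. \<open>\<beta>\<close> may be inhomogeneous:
  \<open>parity_sign\<close> gives each of its components the right sign.\<close>

lemma wedge_commute_aux:
  "(parity_sign \<alpha> = \<alpha> \<longrightarrow> wedge \<alpha> \<beta> Xs = wedge \<beta> \<alpha> Xs) \<and>
   (parity_sign \<alpha> = - \<alpha> \<longrightarrow> wedge \<alpha> \<beta> Xs = wedge (parity_sign \<beta>) \<alpha> Xs)"
proof (induction Xs arbitrary: \<alpha> \<beta>)
  case Nil
  then show ?case by (simp add: parity_sign_def mult.commute)
next
  case (Cons X Xs)
  have e: "parity_sign (contraction X \<alpha>) = - contraction X \<alpha>" if "parity_sign \<alpha> = \<alpha>"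
    using contraction_parity_sign[of X \<alpha>] that by (metis minus_minus)
  have o: "parity_sign (contraction X \<alpha>) = contraction X \<alpha>" if "parity_sign \<alpha> = - \<alpha>"
    using contraction_parity_sign[of X \<alpha>] that by (simp add: contraction_uminus)
  show ?case
  proof (intro conjI impI)
    assume *: "parity_sign \<alpha> = \<alpha>"
    have "wedge (contraction X \<alpha>) \<beta> Xs = wedge (parity_sign \<beta>) (contraction X \<alpha>) Xs"
      using Cons.IH[of "contraction X \<alpha>" \<beta>] e[OF *] by blast
    moreover have "wedge \<alpha> (contraction X \<beta>) Xs = wedge (contraction X \<beta>) \<alpha> Xs"
      using Cons.IH[of \<alpha> "contraction X \<beta>"] * by blast
    ultimately show "wedge \<alpha> \<beta> (X # Xs) = wedge \<beta> \<alpha> (X # Xs)"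
      by (simp only: wedge_Cons * add.commute)
  next
    assume *: "parity_sign \<alpha> = - \<alpha>"
    have "wedge (contraction X \<alpha>) \<beta> Xs = wedge \<beta> (contraction X \<alpha>) Xs"
      using Cons.IH[of "contraction X \<alpha>" \<beta>] o[OF *] by blast
    moreover have "wedge \<alpha> (contraction X \<beta>) Xs = wedge (parity_sign (contraction X \<beta>)) \<alpha> Xs"
      using Cons.IH[of \<alpha> "contraction X \<beta>"] * by blast
    ultimately show "wedge \<alpha> \<beta> (X # Xs) = wedge (parity_sign \<beta>) \<alpha> (X # Xs)"
      by (simp only: wedge_Cons * contraction_parity_sign wedge_uminus_left parity_sign_idem
          uminus_apply add.commute)
  qed
qed

lemma wedge_commute_even: "parity_sign \<alpha> = \<alpha> \<Longrightarrow> wedge \<alpha> \<beta> = wedge \<beta> \<alpha>"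
  using wedge_commute_aux by blast

lemma wedge_commute_odd: "parity_sign \<alpha> = - \<alpha> \<Longrightarrow> wedge \<alpha> \<beta> = wedge (parity_sign \<beta>) \<alpha>"
  using wedge_commute_aux by blast

lemma wedge_form0 [simp]: "wedge (form0 f) \<beta> = fmult f \<beta>"
proof
  fix Xs show "wedge (form0 f) \<beta> Xs = fmult f \<beta> Xs"
  proof (induction Xs arbitrary: \<beta>)
    case Nil
    show ?case by (simp add: fmult_def form0_def)
  next
    case (Cons X Xs)
    have "wedge (form0 f) \<beta> (X # Xs) = wedge (form0 f) (contraction X \<beta>) Xs"
      by (simp add: wedge_Cons)
    also have "\<dots> = fmult f \<beta> (X # Xs)"
      by (simp only: Cons.IH fmult_def contraction_apply)
    finally show ?case .
  qed
qed

lemma wedge_form0_right [simp]: "wedge \<beta> (form0 f) = fmult f \<beta>"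
  using wedge_commute_even[of "form0 f" \<beta>] by simp

section \<open>Cartan calculus\<close>

lemmas fun_apply = plus_fun_apply zero_fun_apply one_fun_apply minus_apply uminus_apply times_fun_apply
  scaleR_fun_apply

text \<open>As simplification rules these act below the abstraction of an eta-expanded form and so hide
  sums of forms from the bilinearity rules.\<close>

declare fun_apply [simp del]

lemma nths_Cons_Compl_0: "nths (x # xs) (- {0}) = xs"
  by (simp add: nths_Cons nths_all)

lemma nths_Cons_Compl_Suc: "nths (x # xs) (- {Suc i}) = x # nths xs (- {i})"
  by (auto simp: nths_Cons intro!: arg_cong[where f = "nths xs"])

lemma nths_Cons_Compl_0_Suc: "nths (x # xs) (- {0, Suc j}) = nths xs (- {j})"
  by (auto simp: nths_Cons intro!: arg_cong[where f = "nths xs"])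

lemma nths_Cons_Compl_Suc_Suc: "nths (x # xs) (- {Suc i, Suc j}) = x # nths xs (- {i, j})"
  by (auto simp: nths_Cons intro!: arg_cong[where f = "nths xs"])

context smooth_mfd
begin

abbreviation VF where "VF \<equiv> vector_fields M"
abbreviation \<Omega> where "\<Omega> \<equiv> forms M"

section \<open>Vector fields and their Lie bracket\<close>

lemma vf_smooth [simp]: "X \<in> VF \<Longrightarrow> X f \<in> CM"
  unfolding vector_fields_def by (cases "f \<in> CM") (blast, metis (mono_tags, lifting) mem_Collect_eq smooth_zero)

lemma vf_nonsmooth: "X \<in> VF \<Longrightarrow> f \<notin> CM \<Longrightarrow> X f = 0"
  unfolding vector_fields_def by blast

lemma vf_add: "X \<in> VF \<Longrightarrow> f \<in> CM \<Longrightarrow> g \<in> CM \<Longrightarrow> X (f + g) = X f + X g"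
  unfolding vector_fields_def by blast

lemma vf_scaleR: "X \<in> VF \<Longrightarrow> f \<in> CM \<Longrightarrow> X (r *\<^sub>R f) = r *\<^sub>R X f"
  unfolding vector_fields_def by blast

lemma vf_mult: "X \<in> VF \<Longrightarrow> f \<in> CM \<Longrightarrow> g \<in> CM \<Longrightarrow> X (f * g) = X f * g + f * X g"
  unfolding vector_fields_def by blast

lemma vf_zero_arg [simp]: "X \<in> VF \<Longrightarrow> X 0 = 0"
  using vf_scaleR[of X 0 0] by simp

lemma vf_uminus_arg: "X \<in> VF \<Longrightarrow> f \<in> CM \<Longrightarrow> X (- f) = - X f"
  using vf_scaleR[of X f "-1"] by simp

lemma vf_diff: "X \<in> VF \<Longrightarrow> f \<in> CM \<Longrightarrow> g \<in> CM \<Longrightarrow> X (f - g) = X f - X g"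
  using vf_add[of X f "- g"] vf_uminus_arg[of X g] smooth_uminus[of g] by simp

lemma vf_signed: "X \<in> VF \<Longrightarrow> f \<in> CM \<Longrightarrow> X ((-1) ^ n * f) = (-1) ^ n * X f"
  by (cases "even n") (auto simp: vf_uminus_arg)

lemma smooth_signed: "f \<in> CM \<Longrightarrow> (-1) ^ n * f \<in> CM" "f \<in> CM \<Longrightarrow> f * (-1) ^ n \<in> CM"
  by (cases "even n"; auto)+

lemma vfI:
  assumes "\<And>f. f \<notin> CM \<Longrightarrow> X f = 0" "\<And>f. f \<in> CM \<Longrightarrow> X f \<in> CM"
    "\<And>f g. f \<in> CM \<Longrightarrow> g \<in> CM \<Longrightarrow> X (f + g) = X f + X g"
    "\<And>r f. f \<in> CM \<Longrightarrow> X (r *\<^sub>R f) = r *\<^sub>R X f"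
    "\<And>f g. f \<in> CM \<Longrightarrow> g \<in> CM \<Longrightarrow> X (f * g) = X f * g + f * X g"
  shows "X \<in> VF"
  unfolding vector_fields_def by (rule CollectI, intro conjI allI ballI impI; rule assms; assumption)

lemma scaleR_mult_fun: "(r *\<^sub>R f) * g = r *\<^sub>R (f * g)" "f * (r *\<^sub>R g) = r *\<^sub>R (f * g)"
  for f g :: "'m \<Rightarrow> real"
  by (auto simp: fun_apply fun_eq_iff)

lemma vf_add_closed [intro]:
  assumes "X \<in> VF" "Y \<in> VF" shows "X + Y \<in> VF"
  by (rule vfI; simp only: plus_fun_apply[where f = X])
    (use assms in \<open>auto simp: vf_nonsmooth vf_add vf_scaleR vf_mult scaleR_add_right distrib_left distrib_right\<close>)

lemma vf_scaleR_closed [intro]: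
  assumes "X \<in> VF" shows "r *\<^sub>R X \<in> VF"
  by (rule vfI; simp only: scaleR_fun_apply[where f = X])
    (use assms in \<open>auto simp: vf_nonsmooth vf_add vf_scaleR vf_mult scaleR_add_right scaleR_mult_fun\<close>)

lemma vf_zero [simp, intro]: "0 \<in> VF"
  by (rule vfI) (simp_all add: zero_fun_apply)

lemma vf_fmult [intro]:
  assumes "f \<in> CM" "X \<in> VF" shows "(\<lambda>g. f * X g) \<in> VF"
  by (rule vfI)
    (use assms in \<open>auto simp: vf_nonsmooth vf_add vf_scaleR vf_mult scaleR_mult_fun algebra_simps\<close>)

lemma lie_bracket_apply: "lie_bracket X Y f = X (Y f) - Y (X f)"
  by (simp add: lie_bracket_def)

lemma lie_bracket_closed [intro]:
  assumes "X \<in> VF" "Y \<in> VF" shows "lie_bracket X Y \<in> VF"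
  by (rule vfI; simp only: lie_bracket_apply)
    (use assms in \<open>auto simp: vf_nonsmooth vf_add vf_scaleR vf_mult smooth_mult smooth_diff
      scaleR_diff_right algebra_simps\<close>)

lemma lie_bracket_swap: "lie_bracket Y X = - lie_bracket X Y"
  by (auto simp: fun_eq_iff lie_bracket_apply fun_apply)

lemma lie_bracket_add_right:
  "X \<in> VF \<Longrightarrow> Y \<in> VF \<Longrightarrow> Z \<in> VF \<Longrightarrow> lie_bracket X (Y + Z) = lie_bracket X Y + lie_bracket X Z"
  by (auto simp: fun_eq_iff lie_bracket_apply plus_fun_apply[where f = Y]
      plus_fun_apply[where f = "lie_bracket _ _"] vf_add algebra_simps)

lemma lie_bracket_add_left:
  "X \<in> VF \<Longrightarrow> Y \<in> VF \<Longrightarrow> Z \<in> VF \<Longrightarrow> lie_bracket (X + Y) Z = lie_bracket X Z + lie_bracket Y Z"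
  by (simp add: lie_bracket_swap[of _ Z] lie_bracket_add_right)

lemma lie_bracket_fmult_right:
  "f \<in> CM \<Longrightarrow> X \<in> VF \<Longrightarrow> Y \<in> VF \<Longrightarrow>
    lie_bracket X (\<lambda>g. f * Y g) = (\<lambda>g. X f * Y g) + (\<lambda>g. f * lie_bracket X Y g)"
  by (rule ext, subst plus_fun_apply) (simp add: lie_bracket_apply vf_mult algebra_simps)

lemma lie_bracket_fmult_left:
  "f \<in> CM \<Longrightarrow> X \<in> VF \<Longrightarrow> Y \<in> VF \<Longrightarrow>
    lie_bracket (\<lambda>g. f * X g) Y = (\<lambda>g. f * lie_bracket X Y g) + (\<lambda>g. (- Y f) * X g)"
  by (rule ext, subst plus_fun_apply) (simp add: lie_bracket_apply vf_mult algebra_simps)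

lemma lie_bracket_jacobi:
  "X \<in> VF \<Longrightarrow> Y \<in> VF \<Longrightarrow> Z \<in> VF \<Longrightarrow>
    lie_bracket X (lie_bracket Y Z) = lie_bracket (lie_bracket X Y) Z + lie_bracket Y (lie_bracket X Z)"
  by (rule ext, subst plus_fun_apply) (simp add: lie_bracket_apply vf_diff algebra_simps)

section \<open>Differential forms and contraction\<close>

lemma form_outside: "\<omega> \<in> \<Omega> \<Longrightarrow> Xs \<notin> lists VF \<Longrightarrow> \<omega> Xs = 0"
  by (auto simp: forms_def)

lemma form_smooth [simp]: "\<omega> \<in> \<Omega> \<Longrightarrow> \<omega> Xs \<in> CM"
  by (cases "Xs \<in> lists VF") (auto simp: forms_def)

lemma form_add_slot:
  "\<omega> \<in> \<Omega> \<Longrightarrow> Xs \<in> lists VF \<Longrightarrow> Ys \<in> lists VF \<Longrightarrow> X \<in> VF \<Longrightarrow> Y \<in> VF \<Longrightarrow>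
    \<omega> (Xs @ (X + Y) # Ys) = \<omega> (Xs @ X # Ys) + \<omega> (Xs @ Y # Ys)"
  unfolding forms_def by blast

lemma form_fmult_slot:
  "\<omega> \<in> \<Omega> \<Longrightarrow> Xs \<in> lists VF \<Longrightarrow> Ys \<in> lists VF \<Longrightarrow> X \<in> VF \<Longrightarrow> f \<in> CM \<Longrightarrow>
    \<omega> (Xs @ (\<lambda>g. f * X g) # Ys) = f * \<omega> (Xs @ X # Ys)"
  unfolding forms_def by blast

lemma form_alternating:
  "\<omega> \<in> \<Omega> \<Longrightarrow> Xs \<in> lists VF \<Longrightarrow> Ys \<in> lists VF \<Longrightarrow> Zs \<in> lists VF \<Longrightarrow> X \<in> VF \<Longrightarrow>
    \<omega> (Xs @ X # Ys @ X # Zs) = 0"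
  unfolding forms_def by blast

lemma formI:
  assumes "\<And>Xs. Xs \<notin> lists VF \<Longrightarrow> \<omega> Xs = 0" "\<And>Xs. Xs \<in> lists VF \<Longrightarrow> \<omega> Xs \<in> CM"
    "\<And>Xs Ys X Y. Xs \<in> lists VF \<Longrightarrow> Ys \<in> lists VF \<Longrightarrow> X \<in> VF \<Longrightarrow> Y \<in> VF \<Longrightarrow>
      \<omega> (Xs @ (X + Y) # Ys) = \<omega> (Xs @ X # Ys) + \<omega> (Xs @ Y # Ys)"
    "\<And>Xs Ys X f. Xs \<in> lists VF \<Longrightarrow> Ys \<in> lists VF \<Longrightarrow> X \<in> VF \<Longrightarrow> f \<in> CM \<Longrightarrow>
      \<omega> (Xs @ (\<lambda>g. f * X g) # Ys) = f * \<omega> (Xs @ X # Ys)"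
    "\<And>Xs Ys Zs X. Xs \<in> lists VF \<Longrightarrow> Ys \<in> lists VF \<Longrightarrow> Zs \<in> lists VF \<Longrightarrow> X \<in> VF \<Longrightarrow>
      \<omega> (Xs @ X # Ys @ X # Zs) = 0"
    "\<And>Xs. N < length Xs \<Longrightarrow> \<omega> Xs = 0"
  shows "\<omega> \<in> \<Omega>"
  unfolding forms_def
  by (rule CollectI, intro conjI exI[of _ N] allI ballI impI; rule assms; assumption)

lemma form_bounded: "\<omega> \<in> \<Omega> \<Longrightarrow> \<exists>N. \<forall>Xs. N < length Xs \<longrightarrow> \<omega> Xs = 0"
  unfolding forms_def by blast

lemma form_zero [simp, intro]: "0 \<in> \<Omega>"
  by (rule formI[where N = 0]) (simp_all add: zero_fun_apply)

text \<open>A filtration that serves as induction measure: contraction lowers the bound by one, and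
  only the zero form has bound 0. The bound is exclusive so that the base case is trivial.\<close>

definition forms_below :: "nat \<Rightarrow> 'm form set" where
  "forms_below N = {\<omega> \<in> \<Omega>. \<forall>Xs. N \<le> length Xs \<longrightarrow> \<omega> Xs = 0}"

lemma forms_below_form: "\<omega> \<in> forms_below N \<Longrightarrow> \<omega> \<in> \<Omega>"
  by (simp add: forms_below_def)

lemma forms_below_ex: "\<omega> \<in> \<Omega> \<Longrightarrow> \<exists>N. \<omega> \<in> forms_below N"
proof -
  assume \<omega>: "\<omega> \<in> \<Omega>"
  then obtain N where "\<forall>Xs. length Xs > N \<longrightarrow> \<omega> Xs = 0"
    unfolding forms_def by blast
  then have "\<omega> \<in> forms_below (Suc N)"
    using \<omega> by (simp add: forms_below_def)
  then show ?thesis by blast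
qed

lemma forms_below_0: "\<omega> \<in> forms_below 0 \<longleftrightarrow> \<omega> = 0"
proof
  assume "\<omega> \<in> forms_below 0"
  then have "\<omega> Xs = 0 Xs" for Xs by (simp add: forms_below_def zero_fun_apply)
  then show "\<omega> = 0" by blast
qed (simp add: forms_below_def zero_fun_apply)

lemma form_add [intro]:
  assumes a: "\<alpha> \<in> \<Omega>" and b: "\<beta> \<in> \<Omega>" shows "\<alpha> + \<beta> \<in> \<Omega>"
proof -
  obtain N N' where N: "\<forall>Xs. N < length Xs \<longrightarrow> \<alpha> Xs = 0" "\<forall>Xs. N' < length Xs \<longrightarrow> \<beta> Xs = 0"
    using form_bounded[OF a] form_bounded[OF b] by blast
  show ?thesis
    by (rule formI[where N = "max N N'"]; simp only: plus_fun_apply[where f = \<alpha>])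
      (use a b N in \<open>auto simp: form_outside form_add_slot form_fmult_slot form_alternating
        algebra_simps\<close>)
qed

lemma form_fmult [intro]:
  assumes a: "\<alpha> \<in> \<Omega>" and f: "f \<in> CM" shows "fmult f \<alpha> \<in> \<Omega>"
proof -
  obtain N where N: "\<forall>Xs. N < length Xs \<longrightarrow> \<alpha> Xs = 0"
    using form_bounded[OF a] by blast
  show ?thesis
    unfolding fmult_def
    by (rule formI[where N = N])
      (use a f N in \<open>auto simp: form_outside form_add_slot form_fmult_slot form_alternating
        algebra_simps\<close>)
qed

lemma form_scaleR [intro]:
  assumes a: "\<alpha> \<in> \<Omega>" shows "r *\<^sub>R \<alpha> \<in> \<Omega>"
proof -
  obtain N where N: "\<forall>Xs. N < length Xs \<longrightarrow> \<alpha> Xs = 0"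
    using form_bounded[OF a] by blast
  show ?thesis
    by (rule formI[where N = N]; simp only: scaleR_fun_apply[where f = \<alpha>])
      (use a N in \<open>auto simp: form_outside form_add_slot form_fmult_slot form_alternating
        scaleR_add_right scaleR_mult_fun\<close>)
qed

lemma form_uminus [intro]: "\<alpha> \<in> \<Omega> \<Longrightarrow> - \<alpha> \<in> \<Omega>"
  using form_scaleR[of \<alpha> "-1"] by simp

lemma form_diff [intro]: "\<alpha> \<in> \<Omega> \<Longrightarrow> \<beta> \<in> \<Omega> \<Longrightarrow> \<alpha> - \<beta> \<in> \<Omega>"
  using form_add[of \<alpha> "- \<beta>"] form_uminus[of \<beta>] by simp

lemma form_sum [intro]: "(\<And>i. i \<in> A \<Longrightarrow> f i \<in> \<Omega>) \<Longrightarrow> (\<Sum>i\<in>A. f i) \<in> \<Omega>"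
  by (induction A rule: infinite_finite_induct) auto

lemma form_parity_sign [intro]:
  assumes a: "\<alpha> \<in> \<Omega>" shows "parity_sign \<alpha> \<in> \<Omega>"
proof -
  obtain N where N: "\<forall>Xs. N < length Xs \<longrightarrow> \<alpha> Xs = 0"
    using form_bounded[OF a] by blast
  show ?thesis
    unfolding parity_sign_def
    by (rule formI[where N = N])
      (use a N in \<open>auto simp: form_outside form_add_slot form_fmult_slot form_alternating
        smooth_signed algebra_simps\<close>)
qed

lemma contraction_outside: "\<omega> \<in> \<Omega> \<Longrightarrow> X \<notin> VF \<Longrightarrow> contraction X \<omega> = 0"
  by (rule ext) (auto simp: contraction_apply fun_apply form_outside)

lemma form_contraction [simp, intro]: 
  assumes "\<omega> \<in> \<Omega>" shows "contraction X \<omega> \<in> \<Omega>"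
proof (cases "X \<in> VF")
  case X: True
  have "\<exists>N. \<forall>Xs. length Xs > N \<longrightarrow> contraction X \<omega> Xs = 0"
  proof -
    obtain N where "\<forall>Xs. length Xs > N \<longrightarrow> \<omega> Xs = 0"
      using assms unfolding forms_def by blast
    then have "\<forall>Xs. length Xs > N \<longrightarrow> contraction X \<omega> Xs = 0" by (simp add: contraction_apply)
    then show ?thesis by blast
  qed
  then obtain N where N: "\<forall>Xs. length Xs > N \<longrightarrow> contraction X \<omega> Xs = 0" by blast
  show ?thesis
    by (rule formI[where N = N]; (simp only: contraction_apply)?)
      (use form_add_slot[OF assms, of "X # _"] form_fmult_slot[OF assms, of "X # _"]
        form_alternating[OF assms, of "X # _"] X assms N
        in \<open>auto simp: form_outside contraction_apply\<close>)
qed (simp add: contraction_outside assms)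

lemma contraction_form_add:
  "\<omega> \<in> \<Omega> \<Longrightarrow> X \<in> VF \<Longrightarrow> Y \<in> VF \<Longrightarrow> contraction (X + Y) \<omega> = contraction X \<omega> + contraction Y \<omega>"
proof
  fix Xs assume *: "\<omega> \<in> \<Omega>" "X \<in> VF" "Y \<in> VF"
  show "contraction (X + Y) \<omega> Xs = (contraction X \<omega> + contraction Y \<omega>) Xs"
    using form_add_slot[OF *(1), of "[]" Xs X Y] form_outside[OF *(1), of "_ # Xs"] *
    by (cases "Xs \<in> lists VF") (simp_all add: contraction_apply fun_apply[where x = Xs])
qed

lemma contraction_form_fmult:
  "\<omega> \<in> \<Omega> \<Longrightarrow> X \<in> VF \<Longrightarrow> f \<in> CM \<Longrightarrow> contraction (\<lambda>g. f * X g) \<omega> = fmult f (contraction X \<omega>)"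
proof
  fix Xs assume *: "\<omega> \<in> \<Omega>" "X \<in> VF" "f \<in> CM"
  show "contraction (\<lambda>g. f * X g) \<omega> Xs = fmult f (contraction X \<omega>) Xs"
    using form_fmult_slot[OF *(1), of "[]" Xs X f] form_outside[OF *(1), of "_ # Xs"] *
    by (cases "Xs \<in> lists VF") (simp_all add: contraction_apply fmult_def)
qed

lemma contraction_contraction_self: "\<omega> \<in> \<Omega> \<Longrightarrow> contraction X (contraction X \<omega>) = 0"
proof
  fix Xs assume *: "\<omega> \<in> \<Omega>"
  show "contraction X (contraction X \<omega>) Xs = 0 Xs"
    using form_alternating[OF *, of "[]" "[]" Xs X] form_outside[OF *, of "X # X # Xs"]
    by (cases "X # Xs \<in> lists VF") (auto simp add: contraction_apply zero_fun_apply)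
qed

text \<open>Polarisation of \<open>contraction_contraction_self\<close> at \<open>X + Y\<close>.
  Both sides vanish if an argument is not a vector field, so the identity can be used without side
  conditions on \<open>X\<close> and \<open>Y\<close>.\<close>

lemma contraction_swap:
  assumes "\<omega> \<in> \<Omega>"
  shows "contraction X (contraction Y \<omega>) = - contraction Y (contraction X \<omega>)"
proof (cases "X \<in> VF \<and> Y \<in> VF")
  case True
  have "contraction (X + Y) (contraction (X + Y) \<omega>) = 0"
    using assms by (rule contraction_contraction_self)
  then have "contraction X (contraction Y \<omega>) + contraction Y (contraction X \<omega>) = 0"
    using True assms
    by (simp add: contraction_form_add contraction_add contraction_contraction_self add.commute)
  then show ?thesis by (simp add: eq_neg_iff_add_eq_0)
next
  case False
  then show ?thesis using assms by (auto simp: contraction_outside)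
qed

lemma contraction_form_uminus: "\<omega> \<in> \<Omega> \<Longrightarrow> X \<in> VF \<Longrightarrow> contraction (- X) \<omega> = - contraction X \<omega>"
proof -
  assume *: "\<omega> \<in> \<Omega>" "X \<in> VF"
  have "contraction (X + 0) \<omega> = contraction X \<omega> + contraction 0 \<omega>"
    using * by (intro contraction_form_add) auto
  then have "contraction 0 \<omega> = 0" by simp
  moreover have "- X \<in> VF" using vf_scaleR_closed[OF *(2), of "-1"] by simp
  ultimately show ?thesis
    using contraction_form_add[OF *, of "- X"] by (simp add: eq_neg_iff_add_eq_0 add.commute)
qed

lemma contraction_below: "\<omega> \<in> forms_below (Suc N) \<Longrightarrow> contraction X \<omega> \<in> forms_below N"
  by (auto simp: forms_below_def contraction_apply)

text \<open>Recognises a form by its contractions: linearity in the first slot and anticommutation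
  of contractions are assumed, and all other slots are inherited from the contracted forms. This is
  how wedge products, Lie derivatives and exterior derivatives are shown to be forms.\<close>

lemma formsI:
  assumes "\<omega> [] \<in> CM"
    and out: "\<And>X. X \<notin> VF \<Longrightarrow> contraction X \<omega> = 0"
    and contr: "\<And>X. X \<in> VF \<Longrightarrow> contraction X \<omega> \<in> forms_below N"
    and add: "\<And>X Y. X \<in> VF \<Longrightarrow> Y \<in> VF \<Longrightarrow> contraction (X + Y) \<omega> = contraction X \<omega> + contraction Y \<omega>"
    and mult: "\<And>X f. X \<in> VF \<Longrightarrow> f \<in> CM \<Longrightarrow> contraction (\<lambda>g. f * X g) \<omega> = fmult f (contraction X \<omega>)"
    and swap: "\<And>X Y. X \<in> VF \<Longrightarrow> Y \<in> VF \<Longrightarrow>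
      contraction X (contraction Y \<omega>) = - contraction Y (contraction X \<omega>)"
  shows "\<omega> \<in> forms_below (Suc N)"
proof -
  have c: "contraction X \<omega> \<in> \<Omega>" for X
    using contr out by (cases "X \<in> VF") (auto simp: forms_below_def)
  have long: "\<omega> Xs = 0" if "Suc N \<le> length Xs" for Xs
  proof (cases Xs)
    case (Cons X Ys)
    then have "contraction X \<omega> Ys = 0"
      using that contr[of X] out[of X] by (cases "X \<in> VF") (auto simp: forms_below_def fun_apply)
    with Cons show ?thesis by (simp add: contraction_apply)
  qed (use that in simp)
  have outs: "\<omega> Xs = 0" if "Xs \<notin> lists VF" for Xs
  proof (cases Xs)
    case (Cons X Ys)
    then have "contraction X \<omega> Ys = 0"
      using that form_outside[OF c] out[of X] by (cases "X \<in> VF") (auto simp: fun_apply)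
    with Cons show ?thesis by (simp add: contraction_apply)
  qed (use that in simp)
  have smooth: "\<omega> Xs \<in> CM" for Xs
    using assms(1) form_smooth[OF c] by (cases Xs) (auto simp: contraction_apply)
  have adds: "\<omega> (Xs @ (X + Y) # Ys) = \<omega> (Xs @ X # Ys) + \<omega> (Xs @ Y # Ys)"
    if "Xs \<in> lists VF" "Ys \<in> lists VF" "X \<in> VF" "Y \<in> VF" for Xs Ys X Y
  proof (cases Xs)
    case Nil
    show ?thesis
      using fun_cong[OF add[OF that(3,4)], of Ys] Nil
      by (simp add: contraction_apply plus_fun_apply[where x = Ys])
  next
    case (Cons Z Zs)
    then show ?thesis
      using form_add_slot[OF c[of Z], of Zs Ys X Y] that by (simp add: contraction_apply)
  qed
  have mults: "\<omega> (Xs @ (\<lambda>g. f * X g) # Ys) = f * \<omega> (Xs @ X # Ys)"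
    if "Xs \<in> lists VF" "Ys \<in> lists VF" "X \<in> VF" "f \<in> CM" for Xs Ys X f
  proof (cases Xs)
    case Nil
    show ?thesis
      using fun_cong[OF mult[OF that(3,4)], of Ys] Nil
      by (simp add: contraction_apply fmult_def)
  next
    case (Cons Z Zs)
    then show ?thesis
      using form_fmult_slot[OF c[of Z], of Zs Ys X f] that by (simp add: contraction_apply)
  qed
  have alt: "\<omega> (Xs @ X # Ys @ X # Zs) = 0"
    if "Xs \<in> lists VF" "Ys \<in> lists VF" "Zs \<in> lists VF" "X \<in> VF" for Xs Ys Zs X
  proof (cases Xs)
    case Xs: Nil
    show ?thesis
    proof (cases Ys)
      case Nil
      have "contraction X (contraction X \<omega>) = 0"
        using swap[OF that(4,4)] by (metis add.right_inverse add_cancel_left_left eq_neg_iff_add_eq_0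
            scaleR_2 scaleR_eq_0_iff zero_neq_numeral)
      then have "contraction X (contraction X \<omega>) Zs = 0" by (simp add: zero_fun_apply)
      with Xs Nil show ?thesis by (simp add: contraction_apply)
    next
      case (Cons Y Ys')
      \<comment> \<open>The neighbour \<open>Y\<close> is moved to the front, so that both
        occurrences of \<open>X\<close> become arguments of \<open>contraction Y \<omega>\<close>,
        which is already known to be alternating.\<close>
      have "\<omega> (X # Y # Ys' @ X # Zs) = contraction Y (contraction X \<omega>) (Ys' @ X # Zs)"
        by (simp add: contraction_apply)
      also have "\<dots> = - contraction Y \<omega> (X # Ys' @ X # Zs)"
        using swap[of Y X] that Cons by (simp add: uminus_apply) (simp add: contraction_apply)
      also have "\<dots> = 0"
        using form_alternating[OF c[of Y], of "[]" Ys' Zs X] that Cons by simp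
      finally show ?thesis using Xs Cons by simp
    qed
  next
    case (Cons Z Zs')
    then show ?thesis
      using form_alternating[OF c[of Z], of Zs' Ys Zs X] that by (simp add: contraction_apply)
  qed
  have "\<omega> \<in> \<Omega>"
    by (rule formI[where N = "Suc N", OF outs smooth adds mults alt long]) simp_all
  with long show ?thesis by (simp add: forms_below_def)
qed

lemma forms_below_diff: "\<alpha> \<in> forms_below N \<Longrightarrow> \<beta> \<in> forms_below N \<Longrightarrow> \<alpha> - \<beta> \<in> forms_below N"
  by (auto simp: forms_below_def minus_apply)

lemma forms_below_add: "\<alpha> \<in> forms_below N \<Longrightarrow> \<beta> \<in> forms_below N \<Longrightarrow> \<alpha> + \<beta> \<in> forms_below N"
  by (auto simp: forms_below_def plus_fun_apply)

lemma forms_below_parity_sign: "\<alpha> \<in> forms_below N \<Longrightarrow> parity_sign \<alpha> \<in> forms_below N"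
  by (auto simp: forms_below_def) (simp add: parity_sign_def)

lemma forms_below_zero [simp]: "0 \<in> forms_below N"
  by (simp add: forms_below_def zero_fun_apply)

lemma form_form0 [intro]: "f \<in> CM \<Longrightarrow> form0 f \<in> \<Omega>"
  by (rule formI[where N = 0]) (auto simp: form0_def)

lemma fmult_unit [simp]: "\<omega> \<in> \<Omega> \<Longrightarrow> fmult (unit_function M) \<omega> = \<omega>"
  by (rule ext) (simp add: fmult_def)

text \<open>Each of the two terms of the contracted product has only one bound lowered, so the
  induction runs over the sum of the bounds.\<close>

lemma wedge_below:
  "\<alpha> \<in> forms_below p \<Longrightarrow> \<beta> \<in> forms_below q \<Longrightarrow> wedge \<alpha> \<beta> \<in> forms_below (p + q)"
proof (induction "p + q" arbitrary: p q \<alpha> \<beta>)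
  case 0
  then show ?case by (simp add: forms_below_0)
next
  case (Suc n)
  show ?case
  \<comment> \<open>With bound 0 a factor is the zero form; otherwise both bounds have predecessors
    and \<open>contraction_below\<close> applies to either factor.\<close>
  proof (cases "p = 0 \<or> q = 0")
    case True
    with Suc.prems have "wedge \<alpha> \<beta> = 0" by (auto simp: forms_below_0)
    then show ?thesis by simp
  next
    case False
    then obtain p' q' where pq: "p = Suc p'" "q = Suc q'" by (metis not0_implies_Suc)
    have forms: "\<alpha> \<in> \<Omega>" "\<beta> \<in> \<Omega>" using Suc.prems by (auto simp: forms_below_def)
    have c: "contraction X (wedge \<alpha> \<beta>) \<in> forms_below n" for X
    proof -
      have "wedge (contraction X \<alpha>) \<beta> \<in> forms_below (p' + q)"
        using Suc.hyps(2) Suc.prems contraction_below pq by (intro Suc.hyps(1)) auto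
      moreover have "wedge (parity_sign \<alpha>) (contraction X \<beta>) \<in> forms_below (p + q')"
        using Suc.hyps(2) Suc.prems contraction_below pq forms_below_parity_sign
        by (intro Suc.hyps(1)) auto
      ultimately show ?thesis
        using Suc.hyps(2) pq by (simp add: contraction_wedge forms_below_add)
    qed
    have "wedge \<alpha> \<beta> \<in> forms_below (Suc n)"
    proof (rule formsI)
      show "wedge \<alpha> \<beta> [] \<in> CM" using forms by (simp add: smooth_mult)
      show "contraction X (contraction Y (wedge \<alpha> \<beta>)) = - contraction Y (contraction X (wedge \<alpha> \<beta>))"
        for X Y
        using forms contraction_swap[of \<alpha> X Y] contraction_swap[of \<beta> X Y]
        by (simp add: contraction_wedge contraction_add contraction_parity_sign wedge_linear)
    qed (use forms c in \<open>simp_all add: contraction_wedge contraction_outside contraction_form_add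
          contraction_form_fmult wedge_linear wedge_fmult_left wedge_fmult_right fmult_add\<close>)
    then show ?thesis using Suc.hyps(2) by simp
  qed
qed

lemma form_wedge [intro]: "\<alpha> \<in> \<Omega> \<Longrightarrow> \<beta> \<in> \<Omega> \<Longrightarrow> wedge \<alpha> \<beta> \<in> \<Omega>"
  using wedge_below forms_below_ex forms_below_form by metis

abbreviation \<L> where "\<L> \<equiv> lie_deriv M"
abbreviation \<d> where "\<d> \<equiv> ext_deriv M"

section \<open>The Lie derivative\<close>

lemma lie_deriv_Nil [simp]: "\<L> X \<omega> [] = X (\<omega> [])"
  by (simp add: lie_deriv_def)

lemma contraction_lie_deriv_outside:
  assumes "Y \<notin> VF" shows "contraction Y (\<L> X \<omega>) = 0"
proof
  fix Xs show "contraction Y (\<L> X \<omega>) Xs = 0 Xs"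
    using assms by (simp add: contraction_apply lie_deriv_def zero_fun_apply[where x = Xs])
qed

text \<open>The summand for the first argument replaces \<open>Y\<close> by its bracket with
  \<open>X\<close>; the other summands, shifted by one, are those of the contracted form. On lists
  with an entry that is no vector field both sides are 0.\<close>

lemma contraction_lie_deriv:
  assumes \<omega>: "\<omega> \<in> \<Omega>" and X: "X \<in> VF" and Y: "Y \<in> VF"
  shows "contraction Y (\<L> X \<omega>) = \<L> X (contraction Y \<omega>) - contraction (lie_bracket X Y) \<omega>"
proof
  fix Xs
  show "contraction Y (\<L> X \<omega>) Xs = (\<L> X (contraction Y \<omega>) - contraction (lie_bracket X Y) \<omega>) Xs"
  proof (cases "Xs \<in> lists VF")
    case True
    then show ?thesis
      using Y by (simp add: contraction_apply minus_apply[where x = Xs] lie_deriv_def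
          sum.lessThan_Suc_shift del: sum.lessThan_Suc)
  next
    case False
    then show ?thesis
      using form_outside[OF \<omega>, of "_ # Xs"]
      by (simp add: contraction_apply minus_apply[where x = Xs] lie_deriv_def)
  qed
qed

lemma lie_deriv_zero [simp]:
  assumes "X \<in> VF" shows "\<L> X 0 = 0"
proof
  fix Xs show "\<L> X 0 Xs = 0 Xs"
    using assms by (simp add: lie_deriv_def zero_fun_apply[where x = "_ :: _ list"])
qed

lemma lie_deriv_add:
  assumes "X \<in> VF" "\<alpha> \<in> \<Omega>" "\<beta> \<in> \<Omega>"
  shows "\<L> X (\<alpha> + \<beta>) = \<L> X \<alpha> + \<L> X \<beta>"
proof
  fix Xs show "\<L> X (\<alpha> + \<beta>) Xs = (\<L> X \<alpha> + \<L> X \<beta>) Xs"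
    unfolding plus_fun_apply[where x = Xs]
    using assms by (simp add: lie_deriv_def plus_fun_apply[where f = \<alpha>] vf_add sum.distrib)
qed

lemma lie_deriv_scaleR:
  assumes "X \<in> VF" "\<alpha> \<in> \<Omega>"
  shows "\<L> X (r *\<^sub>R \<alpha>) = r *\<^sub>R \<L> X \<alpha>"
proof
  fix Xs show "\<L> X (r *\<^sub>R \<alpha>) Xs = (r *\<^sub>R \<L> X \<alpha>) Xs"
    unfolding scaleR_fun_apply[where x = Xs] using assms
    by (simp add: lie_deriv_def scaleR_fun_apply[where f = \<alpha>] vf_scaleR scaleR_sum_right scaleR_diff_right)
qed

lemma lie_deriv_uminus: "X \<in> VF \<Longrightarrow> \<alpha> \<in> \<Omega> \<Longrightarrow> \<L> X (- \<alpha>) = - \<L> X \<alpha>"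
  using lie_deriv_scaleR[of X \<alpha> "-1"] by simp

lemma lie_deriv_diff:
  "X \<in> VF \<Longrightarrow> \<alpha> \<in> \<Omega> \<Longrightarrow> \<beta> \<in> \<Omega> \<Longrightarrow> \<L> X (\<alpha> - \<beta>) = \<L> X \<alpha> - \<L> X \<beta>"
  using lie_deriv_add[of X \<alpha> "- \<beta>"] lie_deriv_uminus[of X \<beta>] form_uminus[of \<beta>] by simp

lemma lie_deriv_fmult:
  assumes "X \<in> VF" "\<alpha> \<in> \<Omega>" "f \<in> CM"
  shows "\<L> X (fmult f \<alpha>) = fmult (X f) \<alpha> + fmult f (\<L> X \<alpha>)"
proof
  fix Xs show "\<L> X (fmult f \<alpha>) Xs = (fmult (X f) \<alpha> + fmult f (\<L> X \<alpha>)) Xs"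
    using assms form_outside[OF assms(2), of Xs]
    by (simp add: lie_deriv_def fmult_def plus_fun_apply[where x = Xs] vf_mult
        sum_distrib_left algebra_simps)
qed

lemma lie_deriv_parity_sign:
  assumes "X \<in> VF" "\<alpha> \<in> \<Omega>"
  shows "\<L> X (parity_sign \<alpha>) = parity_sign (\<L> X \<alpha>)"
proof
  fix Xs show "\<L> X (parity_sign \<alpha>) Xs = parity_sign (\<L> X \<alpha>) Xs"
    using assms by (simp add: lie_deriv_def parity_sign_def vf_signed sum_distrib_left right_diff_distrib)
qed

lemma lie_deriv_form0 [simp]: "X \<in> VF \<Longrightarrow> \<L> X (form0 f) = form0 (X f)"
  by (intro ext) (auto simp add: lie_deriv_def form0_def)

lemma lie_deriv_below: "\<omega> \<in> forms_below N \<Longrightarrow> X \<in> VF \<Longrightarrow> \<L> X \<omega> \<in> forms_below N"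
proof (induction N arbitrary: \<omega>)
  case 0
  then show ?case by (simp add: forms_below_0)
next
  case (Suc N)
  have \<omega>: "\<omega> \<in> \<Omega>" and X: "X \<in> VF" using Suc.prems by (auto simp: forms_below_def)
  note [simp] = lie_bracket_closed vf_add_closed vf_fmult
  show ?case
  proof (rule formsI)
    show "\<L> X \<omega> [] \<in> CM" using X by simp
    show "contraction Y (\<L> X \<omega>) = 0" if "Y \<notin> VF" for Y
      using that by (rule contraction_lie_deriv_outside)
    show "contraction Y (\<L> X \<omega>) \<in> forms_below N" if "Y \<in> VF" for Y
      using that Suc.IH[OF contraction_below[OF Suc.prems(1)]] X contraction_below[OF Suc.prems(1)]
      by (simp add: contraction_lie_deriv \<omega> forms_below_diff)
    show "contraction (Y + Z) (\<L> X \<omega>) = contraction Y (\<L> X \<omega>) + contraction Z (\<L> X \<omega>)"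
      if "Y \<in> VF" "Z \<in> VF" for Y Z
      using that X \<omega> by (simp add: contraction_lie_deriv contraction_form_add lie_deriv_add
          lie_bracket_add_right)
    \<comment> \<open>Linearity over functions: the term
      \<open>fmult (X f) (contraction Y \<omega>)\<close> from the Leibniz rule cancels against the
      summand X(f) Y of [X, fY].\<close>
    show "contraction (\<lambda>g. f * Y g) (\<L> X \<omega>) = fmult f (contraction Y (\<L> X \<omega>))"
      if "Y \<in> VF" "f \<in> CM" for Y f
      using that X \<omega> by (simp add: contraction_lie_deriv contraction_form_fmult lie_deriv_fmult
          lie_bracket_fmult_right contraction_form_add fmult_diff)
    show "contraction Y (contraction Z (\<L> X \<omega>)) = - contraction Z (contraction Y (\<L> X \<omega>))"
      if "Y \<in> VF" "Z \<in> VF" for Y Z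
      using that X \<omega> contraction_swap[of \<omega> Y Z] contraction_swap[of \<omega> "lie_bracket X Y" Z]
        contraction_swap[of \<omega> "lie_bracket X Z" Y]
      by (simp add: contraction_lie_deriv contraction_diff lie_deriv_uminus)
  qed
qed

lemma form_lie_deriv [simp, intro]: "\<omega> \<in> \<Omega> \<Longrightarrow> X \<in> VF \<Longrightarrow> \<L> X \<omega> \<in> \<Omega>"
  using lie_deriv_below forms_below_ex forms_below_form by metis

text \<open>Moving slot \<open>j\<close> to the front passes \<open>j\<close> arguments, each at the
  cost of one \<open>contraction_swap\<close>. It relates the Lie derivative, where a bracket
  replaces an argument in place, to the Koszul formula, where the bracket stands in front.\<close>

lemma form_list_update:
  assumes "\<omega> \<in> \<Omega>" "j < length Xs"
  shows "\<omega> (Xs[j := Y]) = (-1) ^ j * \<omega> (Y # nths Xs (- {j}))"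
  using assms
proof (induction Xs arbitrary: \<omega> j)
  case (Cons X Xs)
  show ?case
  proof (cases j)
    case 0
    then show ?thesis by (simp add: nths_Cons_Compl_0)
  next
    case (Suc i)
    have "\<omega> ((X # Xs)[j := Y]) = contraction X \<omega> (Xs[i := Y])"
      by (simp add: Suc contraction_apply)
    also have "\<dots> = (-1) ^ i * contraction Y (contraction X \<omega>) (nths Xs (- {i}))"
      using Cons.IH[of "contraction X \<omega>" i] Cons.prems Suc
      by (simp add: contraction_apply[of Y "contraction X \<omega>"])
    also have "contraction Y (contraction X \<omega>) = - contraction X (contraction Y \<omega>)"
      using Cons.prems(1) by (rule contraction_swap)
    also have "(-1) ^ i * (- contraction X (contraction Y \<omega>)) (nths Xs (- {i})) =
        (-1) ^ j * \<omega> (Y # nths (X # Xs) (- {j}))"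
      by (simp add: Suc nths_Cons_Compl_Suc contraction_apply[where Xs = "_ # _"]
          contraction_apply[where Xs = "nths _ _"] uminus_apply[where x = "nths _ _"])
    finally show ?thesis .
  qed
qed simp

section \<open>The exterior derivative and Cartan's formula\<close>

lemma ext_deriv_Nil [simp]: "\<d> \<omega> [] = 0"
  by (simp add: ext_deriv_def)

lemma ext_deriv_outside: "Xs \<notin> lists VF \<Longrightarrow> \<d> \<omega> Xs = 0"
  by (simp add: ext_deriv_def)

lemma contraction_ext_deriv_outside:
  assumes "Y \<notin> VF" shows "contraction Y (\<d> \<omega>) = 0"
proof
  fix Xs show "contraction Y (\<d> \<omega>) Xs = 0 Xs"
    using assms by (simp add: contraction_apply ext_deriv_outside zero_fun_apply[where x = Xs])
qed

text \<open>In the Koszul sum on \<open>X # Xs\<close> the terms that involve position 0 make up the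
  Lie derivative, and the remaining ones the negative of the Koszul sum of
  \<open>contraction X \<omega>\<close>.\<close>

lemma contraction_ext_deriv:
  assumes \<omega>: "\<omega> \<in> \<Omega>" and X: "X \<in> VF"
  shows "contraction X (\<d> \<omega>) = \<L> X \<omega> - \<d> (contraction X \<omega>)"
proof
  fix Xs
  show "contraction X (\<d> \<omega>) Xs = (\<L> X \<omega> - \<d> (contraction X \<omega>)) Xs"
  proof (cases "Xs \<in> lists VF")
    case False
    then show ?thesis
      by (simp add: contraction_apply minus_apply[where x = Xs] lie_deriv_def ext_deriv_outside)
  next
    case Xs: True
    let ?n = "length Xs"
    let ?a = "\<lambda>i. (-1) ^ i * (Xs ! i) (contraction X \<omega> (nths Xs (- {i})))"
    let ?b = "\<lambda>i j. (-1) ^ (i + j) *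
      contraction X \<omega> (lie_bracket (Xs ! i) (Xs ! j) # nths Xs (- {i, j}))"
    let ?A = "\<lambda>i. (-1) ^ i * ((X # Xs) ! i) (\<omega> (nths (X # Xs) (- {i})))"
    let ?B = "\<lambda>i j. (-1) ^ (i + j) *
      \<omega> (lie_bracket ((X # Xs) ! i) ((X # Xs) ! j) # nths (X # Xs) (- {i, j}))"
    have A: "?A 0 = X (\<omega> Xs)" "?A (Suc i) = - ?a i" for i
      by (simp_all add: nths_Cons_Compl_0 nths_Cons_Compl_Suc contraction_apply)
    \<comment> \<open>The sign of the pair (0, j + 1) is (-1)^(j+1), and
      \<open>form_list_update\<close> contributes (-1)^j; one minus sign is left.\<close>
    have B0: "?B 0 (Suc j) = - \<omega> (Xs[j := lie_bracket X (Xs ! j)])" if "j < ?n" for j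
      using that by (simp add: nths_Cons_Compl_0_Suc form_list_update[OF \<omega>])
    \<comment> \<open>Shifting both indices leaves the sign of the summand unchanged; the minus sign
      comes from interchanging \<open>X\<close> with the bracket in front of it.\<close>
    have B: "?B (Suc i) (Suc j) = - ?b i j" for i j
    proof -
      have "contraction (lie_bracket (Xs ! i) (Xs ! j)) (contraction X \<omega>) (nths Xs (- {i, j})) =
          - contraction X (contraction (lie_bracket (Xs ! i) (Xs ! j)) \<omega>) (nths Xs (- {i, j}))"
        by (subst contraction_swap[OF \<omega>]) (simp add: uminus_apply)
      then show ?thesis by (simp add: nths_Cons_Compl_Suc_Suc contraction_apply)
    qed
    have "\<d> \<omega> (X # Xs) = (\<Sum>i<Suc ?n. ?A i) + (\<Sum>j<Suc ?n. \<Sum>i<j. ?B i j)"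
      using Xs X by (simp add: ext_deriv_def)
    also have "(\<Sum>i<Suc ?n. ?A i) = X (\<omega> Xs) - (\<Sum>i<?n. ?a i)"
      by (simp only: sum.lessThan_Suc_shift A sum_negf) simp
    also have "(\<Sum>j<Suc ?n. \<Sum>i<j. ?B i j) = (\<Sum>j<?n. ?B 0 (Suc j) + (\<Sum>i<j. ?B (Suc i) (Suc j)))"
      by (simp only: sum.lessThan_Suc_shift lessThan_0 sum.empty add_0_left)
    also have "\<dots> = (\<Sum>j<?n. - \<omega> (Xs[j := lie_bracket X (Xs ! j)]) - (\<Sum>i<j. ?b i j))"
      by (rule sum.cong[OF refl]) (simp only: lessThan_iff B0 B sum_negf, simp)
    finally have "\<d> \<omega> (X # Xs) = X (\<omega> Xs) - (\<Sum>i<?n. ?a i) +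
        (- (\<Sum>j<?n. \<omega> (Xs[j := lie_bracket X (Xs ! j)])) - (\<Sum>j<?n. \<Sum>i<j. ?b i j))"
      by (simp only: sum_subtractf sum_negf)
    moreover have "\<L> X \<omega> Xs = X (\<omega> Xs) - (\<Sum>j<?n. \<omega> (Xs[j := lie_bracket X (Xs ! j)]))"
      using Xs by (simp add: lie_deriv_def)
    moreover have "\<d> (contraction X \<omega>) Xs = (\<Sum>i<?n. ?a i) + (\<Sum>j<?n. \<Sum>i<j. ?b i j)"
      using Xs by (simp only: ext_deriv_def if_True)
    ultimately show ?thesis
      by (simp only: contraction_apply minus_apply[where x = Xs]) (simp add: algebra_simps)
  qed
qed

lemma ext_deriv_zero [simp]: "\<d> 0 = 0"
proof
  fix Xs show "\<d> 0 Xs = 0 Xs"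
  proof (induction Xs)
    case Nil
    show ?case by (simp add: zero_fun_apply[where x = "[]"])
  next
    case (Cons X Xs)
    show ?case
    proof (cases "X \<in> VF")
      case True
      have "contraction X (\<d> 0) = - \<d> 0" using contraction_ext_deriv[OF form_zero True] True by simp
      then have "contraction X (\<d> 0) Xs = 0" using Cons by (simp add: uminus_apply zero_fun_apply[where x = Xs])
      then show ?thesis by (simp add: contraction_apply zero_fun_apply[where x = "X # Xs"])
    qed (simp add: ext_deriv_outside zero_fun_apply[where x = "X # Xs"])
  qed
qed

text \<open>Extensionality for forms: Cartan's formulas turn the contractions of both sides into the
  same identity for contracted forms, evaluated on a shorter list.\<close>

lemma form_op_eqI:
  assumes "\<And>x. P x \<Longrightarrow> A x [] = B x []"
    and "\<And>x Y. P x \<Longrightarrow> Y \<notin> VF \<Longrightarrow> contraction Y (A x) = contraction Y (B x)"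
    and "\<And>x Y Xs. P x \<Longrightarrow> Y \<in> VF \<Longrightarrow> (\<And>y. P y \<Longrightarrow> A y Xs = B y Xs) \<Longrightarrow>
      contraction Y (A x) Xs = contraction Y (B x) Xs"
    and "P x"
  shows "A x = (B x :: 'm form)"
proof
  fix Xs show "A x Xs = B x Xs"
    using assms(4)
  proof (induction Xs arbitrary: x)
    case (Cons X Xs)
    have "contraction X (A x) Xs = contraction X (B x) Xs"
    proof (cases "X \<in> VF")
      case True
      show ?thesis by (rule assms(3)[OF Cons.prems True Cons.IH])
    qed (simp add: assms(2) Cons.prems)
    then show ?case by (simp add: contraction_apply)
  qed (rule assms(1))
qed

lemma form_apply:
  fixes \<alpha> \<beta> :: "'m form"
  shows "(\<alpha> + \<beta>) Xs = \<alpha> Xs + \<beta> Xs" "(\<alpha> - \<beta>) Xs = \<alpha> Xs - \<beta> Xs" "(- \<alpha>) Xs = - \<alpha> Xs"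
    "(r *\<^sub>R \<alpha>) Xs = r *\<^sub>R \<alpha> Xs" "(0 :: 'm form) Xs = 0"
  by (rule plus_fun_apply minus_apply uminus_apply scaleR_fun_apply zero_fun_apply)+

lemma ext_deriv_add:
  assumes "\<alpha> \<in> \<Omega>" "\<beta> \<in> \<Omega>"
  shows "\<d> (\<alpha> + \<beta>) = \<d> \<alpha> + \<d> \<beta>"
proof -
  \<comment> \<open>The extensionality rule has a single parameter, so the two forms are packed into
    a pair.\<close>
  have "(\<lambda>x. \<d> (fst x + snd x)) (\<alpha>, \<beta>) = (\<lambda>x. \<d> (fst x) + \<d> (snd x)) (\<alpha>, \<beta>)"
  proof (rule form_op_eqI[where P = "\<lambda>x. fst x \<in> \<Omega> \<and> snd x \<in> \<Omega>"
      and A = "\<lambda>x. \<d> (fst x + snd x)" and B = "\<lambda>x. \<d> (fst x) + \<d> (snd x)"], goal_cases)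
    case (3 x Y Xs)
    show ?case
      using 3(1,2) 3(3)[of "(contraction Y (fst x), contraction Y (snd x))"]
      by (simp add: contraction_ext_deriv contraction_add lie_deriv_add form_add form_apply[where Xs = Xs])
  qed (use assms in \<open>auto simp: contraction_ext_deriv_outside contraction_add form_apply[where Xs = "[]"]\<close>)
  then show ?thesis by simp
qed

lemma ext_deriv_scaleR:
  assumes "\<alpha> \<in> \<Omega>"
  shows "\<d> (r *\<^sub>R \<alpha>) = r *\<^sub>R \<d> \<alpha>"
proof (rule form_op_eqI[where P = "\<lambda>\<alpha>. \<alpha> \<in> \<Omega>"
      and A = "\<lambda>\<alpha>. \<d> (r *\<^sub>R \<alpha>)" and B = "\<lambda>\<alpha>. r *\<^sub>R \<d> \<alpha>"], goal_cases)
  case (3 \<alpha> Y Xs)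
  then show ?case
    by (simp add: contraction_ext_deriv contraction_scaleR lie_deriv_scaleR form_scaleR form_apply[where Xs = Xs]
        scaleR_diff_right)
qed (use assms in \<open>auto simp: contraction_ext_deriv_outside contraction_scaleR form_apply[where Xs = "[]"]\<close>)

lemma ext_deriv_uminus: "\<alpha> \<in> \<Omega> \<Longrightarrow> \<d> (- \<alpha>) = - \<d> \<alpha>"
  using ext_deriv_scaleR[of \<alpha> "-1"] by simp

lemma ext_deriv_diff: "\<alpha> \<in> \<Omega> \<Longrightarrow> \<beta> \<in> \<Omega> \<Longrightarrow> \<d> (\<alpha> - \<beta>) = \<d> \<alpha> - \<d> \<beta>"
  using ext_deriv_add[of \<alpha> "- \<beta>"] ext_deriv_uminus[of \<beta>] form_uminus[of \<beta>] by simp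

lemma ext_deriv_parity_sign:
  assumes "\<alpha> \<in> \<Omega>"
  shows "\<d> (parity_sign \<alpha>) = - parity_sign (\<d> \<alpha>)"
proof (rule form_op_eqI[where P = "\<lambda>\<alpha>. \<alpha> \<in> \<Omega>"
      and A = "\<lambda>\<alpha>. \<d> (parity_sign \<alpha>)" and B = "\<lambda>\<alpha>. - parity_sign (\<d> \<alpha>)"], goal_cases)
  case (1 \<alpha>)
  show ?case by (simp add: parity_sign_def form_apply[where Xs = "[]"])
next
  case (3 \<alpha> Y Xs)
  then show ?case
    by (simp add: contraction_ext_deriv contraction_parity_sign contraction_uminus
        lie_deriv_parity_sign form_parity_sign ext_deriv_uminus parity_sign_diff form_apply[where Xs = Xs])
qed (use assms in \<open>auto simp: contraction_ext_deriv_outside contraction_parity_sign contraction_uminus\<close>)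

lemma parity_sign_ext_deriv_form0: "f \<in> CM \<Longrightarrow> parity_sign (\<d> (form0 f)) = - \<d> (form0 f)"
  using ext_deriv_parity_sign[of "form0 f"] by (simp add: form_form0 equation_minus_iff)

lemma contraction_ext_deriv_form0:
  "f \<in> CM \<Longrightarrow> Y \<in> VF \<Longrightarrow> contraction Y (\<d> (form0 f)) = form0 (Y f)"
  by (simp add: contraction_ext_deriv form_form0)

lemma lie_deriv_vf_add:
  assumes "X \<in> VF" "Y \<in> VF" "\<omega> \<in> \<Omega>"
  shows "\<L> (X + Y) \<omega> = \<L> X \<omega> + \<L> Y \<omega>"
proof (rule form_op_eqI[where P = "\<lambda>\<alpha>. \<alpha> \<in> \<Omega>"
      and A = "\<lambda>\<alpha>. \<L> (X + Y) \<alpha>" and B = "\<lambda>\<alpha>. \<L> X \<alpha> + \<L> Y \<alpha>"], goal_cases)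
  case (1 \<omega>)
  show ?case by (simp add: form_apply[where Xs = "[]"] plus_fun_apply[where f = X])
next
  case (3 \<alpha> Z Xs)
  then show ?case
    using assms by (simp add: contraction_lie_deriv contraction_add lie_bracket_add_left
        contraction_form_add lie_bracket_closed vf_add_closed form_apply[where Xs = Xs])
qed (use assms in \<open>auto simp: contraction_lie_deriv_outside contraction_add\<close>)

text \<open>The correction df \<and> \<iota>_X \<omega> is the same as the one in d(f \<iota>_X
  \<omega>). Their difference vanishes, which makes \<iota>_X d\<omega> linear over functions in
  X.\<close>

lemma lie_deriv_vf_fmult:
  assumes "f \<in> CM" "X \<in> VF" "\<omega> \<in> \<Omega>"
  shows "\<L> (\<lambda>g. f * X g) \<omega> = fmult f (\<L> X \<omega>) + wedge (\<d> (form0 f)) (contraction X \<omega>)"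
proof (rule form_op_eqI[where P = "\<lambda>\<alpha>. \<alpha> \<in> \<Omega>"
      and A = "\<lambda>\<omega>. \<L> (\<lambda>g. f * X g) \<omega>" and B = "\<lambda>\<omega>. fmult f (\<L> X \<omega>) + wedge (\<d> (form0 f)) (contraction X \<omega>)"], goal_cases)
  case (1 \<omega>)
  show ?case by (simp add: form_apply[where Xs = "[]"] fmult_def)
next
  case (2 \<omega> Y)
  then show ?case
    using assms by (simp add: contraction_lie_deriv_outside contraction_add contraction_wedge
      contraction_fmult contraction_ext_deriv_outside contraction_swap[of \<omega> Y X] contraction_outside)
next
  case (3 \<omega> Z Xs)
  have uZ: "(\<lambda>g. (- Z f) * X g) = - (\<lambda>g. Z f * X g)"
    by (rule ext) (simp add: uminus_apply[where x = "_ :: _ \<Rightarrow> _"])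
  \<comment> \<open>This is the summand -Z(f) X of [fX, Z]. It is subtracted by
    \<open>contraction_lie_deriv\<close> and so matches the term Z(f) \<iota>_X \<omega> that
    contracting df produces on the other side.\<close>
  have "contraction (\<lambda>g. (- Z f) * X g) \<omega> = fmult (- Z f) (contraction X \<omega>)"
    using 3 assms by (intro contraction_form_fmult smooth_uminus) auto
  moreover have "(\<lambda>g. (- Z f) * X g) \<in> VF" using 3 assms by (intro vf_fmult smooth_uminus) auto
  ultimately have "contraction Z (\<L> (\<lambda>g. f * X g) \<omega>) = \<L> (\<lambda>g. f * X g) (contraction Z \<omega>)
      - fmult f (contraction (lie_bracket X Z) \<omega>) + fmult (Z f) (contraction X \<omega>)"
    using 3 assms by (simp add: contraction_lie_deriv lie_bracket_fmult_left vf_fmult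
        contraction_form_add contraction_form_fmult lie_bracket_closed)
      (simp add: fmult_def fun_eq_iff fun_apply)
  moreover have "contraction Z (fmult f (\<L> X \<omega>) + wedge (\<d> (form0 f)) (contraction X \<omega>)) =
    fmult f (\<L> X (contraction Z \<omega>)) - fmult f (contraction (lie_bracket X Z) \<omega>)
    + fmult (Z f) (contraction X \<omega>) + wedge (\<d> (form0 f)) (contraction X (contraction Z \<omega>))"
    using 3 assms contraction_swap[of \<omega> X Z]
    by (simp add: contraction_add contraction_fmult contraction_lie_deriv contraction_wedge
        contraction_ext_deriv_form0 parity_sign_ext_deriv_form0 fmult_diff wedge_linear)
  ultimately show ?case
    using 3 by (simp add: form_apply[where Xs = Xs])
qed (use assms in auto)

text \<open>The degree 0 case of the Leibniz rule comes before the general one because it enters the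
  proof that \<open>\<d> \<omega>\<close> is a form.\<close>

lemma ext_deriv_fmult:
  assumes "f \<in> CM" "\<omega> \<in> \<Omega>"
  shows "\<d> (fmult f \<omega>) = wedge (\<d> (form0 f)) \<omega> + fmult f (\<d> \<omega>)"
proof (rule form_op_eqI[where P = "\<lambda>\<alpha>. \<alpha> \<in> \<Omega>"
      and A = "\<lambda>\<omega>. \<d> (fmult f \<omega>)" and B = "\<lambda>\<omega>. wedge (\<d> (form0 f)) \<omega> + fmult f (\<d> \<omega>)"], goal_cases)
  case (3 \<omega> Y Xs)
  then show ?case
    using assms by (simp add: contraction_ext_deriv form_fmult contraction_add contraction_wedge
        contraction_fmult contraction_ext_deriv_form0 lie_deriv_fmult parity_sign_ext_deriv_form0
        fmult_diff wedge_linear form_apply[where Xs = Xs])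
next
  case (1 \<omega>)
  then show ?case by (simp add: form_apply[where Xs = "[]"] fmult_def)
qed (use assms in \<open>auto simp: contraction_ext_deriv_outside contraction_outside contraction_wedge
    contraction_add contraction_fmult\<close>)

lemma ext_deriv_below: "\<omega> \<in> forms_below N \<Longrightarrow> \<d> \<omega> \<in> forms_below (Suc N)"
proof (induction N arbitrary: \<omega>)
  case 0
  then show ?case by (simp add: forms_below_0)
next
  case (Suc N)
  have \<omega>: "\<omega> \<in> \<Omega>" using Suc.prems by (auto simp: forms_below_def)
  show ?case
  proof (rule formsI)
    show "\<d> \<omega> [] \<in> CM" by simp
    show "contraction Y (\<d> \<omega>) = 0" if "Y \<notin> VF" for Y
      using that by (rule contraction_ext_deriv_outside)
    show "contraction Y (\<d> \<omega>) \<in> forms_below (Suc N)" if "Y \<in> VF" for Y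
      using that Suc.IH[OF contraction_below[OF Suc.prems(1)]] lie_deriv_below[OF Suc.prems(1)]
      by (simp add: contraction_ext_deriv \<omega> forms_below_diff)
    show "contraction (Y + Z) (\<d> \<omega>) = contraction Y (\<d> \<omega>) + contraction Z (\<d> \<omega>)"
      if "Y \<in> VF" "Z \<in> VF" for Y Z
      using that \<omega> by (simp add: contraction_ext_deriv contraction_form_add vf_add_closed
          lie_deriv_vf_add ext_deriv_add)
    show "contraction (\<lambda>g. f * Y g) (\<d> \<omega>) = fmult f (contraction Y (\<d> \<omega>))"
      if "Y \<in> VF" "f \<in> CM" for Y f
      using that \<omega> by (simp add: contraction_ext_deriv contraction_form_fmult vf_fmult
          lie_deriv_vf_fmult ext_deriv_fmult fmult_diff)
    \<comment> \<open>Cartan's formulas turn the left side into \<L>_Z \<iota>_Y \<omega> - \<L>_Y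
      \<iota>_Z \<omega> + \<iota>_[Y,Z] \<omega> + d \<iota>_Y \<iota>_Z \<omega>, which is
      antisymmetric in Y and Z.\<close>
    show "contraction Y (contraction Z (\<d> \<omega>)) = - contraction Z (contraction Y (\<d> \<omega>))"
      if "Y \<in> VF" "Z \<in> VF" for Y Z
      using that \<omega> contraction_swap[of \<omega> Y Z] lie_bracket_swap[of Y Z]
      by (simp add: contraction_ext_deriv contraction_diff contraction_lie_deriv ext_deriv_uminus
          contraction_form_uminus lie_bracket_closed)
  qed
qed

lemma form_ext_deriv [simp, intro]: "\<omega> \<in> \<Omega> \<Longrightarrow> \<d> \<omega> \<in> \<Omega>"
  using ext_deriv_below forms_below_ex forms_below_form by metis

section \<open>Leibniz rules and commutation relations\<close>

lemma lie_deriv_wedge: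
  assumes "X \<in> VF" "\<alpha> \<in> \<Omega>" "\<beta> \<in> \<Omega>"
  shows "\<L> X (wedge \<alpha> \<beta>) = wedge (\<L> X \<alpha>) \<beta> + wedge \<alpha> (\<L> X \<beta>)"
proof -
  have "(\<lambda>x. \<L> X (wedge (fst x) (snd x))) (\<alpha>, \<beta>) = (\<lambda>x. wedge (\<L> X (fst x)) (snd x) + wedge (fst x) (\<L> X (snd x))) (\<alpha>, \<beta>)"
  proof (rule form_op_eqI[where P = "\<lambda>x. fst x \<in> \<Omega> \<and> snd x \<in> \<Omega>"
      and A = "\<lambda>x. \<L> X (wedge (fst x) (snd x))" and B = "\<lambda>x. wedge (\<L> X (fst x)) (snd x) + wedge (fst x) (\<L> X (snd x))"], goal_cases)
    case (3 x Y Xs)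
    show ?case
      \<comment> \<open>Contraction of a product has two terms, so the induction hypothesis is used
        at two pairs; in the second pair the first factor carries its sign.\<close>
      using 3(1,2) 3(3)[of "(contraction Y (fst x), snd x)"] 3(3)[of "(parity_sign (fst x), contraction Y (snd x))"] assms(1)
      by (simp add: contraction_lie_deriv contraction_wedge form_wedge contraction_add
          form_parity_sign lie_deriv_add lie_deriv_parity_sign wedge_linear form_apply[where Xs = Xs])
  qed (use assms in \<open>auto simp: contraction_lie_deriv_outside contraction_outside contraction_add
      contraction_wedge form_apply[where Xs = "[]"] vf_mult\<close>)
  then show ?thesis by simp
qed

lemma ext_deriv_wedge:
  assumes "\<alpha> \<in> \<Omega>" "\<beta> \<in> \<Omega>"
  shows "\<d> (wedge \<alpha> \<beta>) = wedge (\<d> \<alpha>) \<beta> + wedge (parity_sign \<alpha>) (\<d> \<beta>)"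
proof -
  have "(\<lambda>x. \<d> (wedge (fst x) (snd x))) (\<alpha>, \<beta>) = (\<lambda>x. wedge (\<d> (fst x)) (snd x) + wedge (parity_sign (fst x)) (\<d> (snd x))) (\<alpha>, \<beta>)"
  proof (rule form_op_eqI[where P = "\<lambda>x. fst x \<in> \<Omega> \<and> snd x \<in> \<Omega>"
      and A = "\<lambda>x. \<d> (wedge (fst x) (snd x))" and B = "\<lambda>x. wedge (\<d> (fst x)) (snd x) + wedge (parity_sign (fst x)) (\<d> (snd x))"], goal_cases)
    case (3 x Y Xs)
    show ?case
      using 3(1,2) 3(3)[of "(contraction Y (fst x), snd x)"] 3(3)[of "(parity_sign (fst x), contraction Y (snd x))"]
      by (simp add: contraction_ext_deriv contraction_wedge form_wedge contraction_add
          form_parity_sign lie_deriv_wedge ext_deriv_add ext_deriv_parity_sign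
          contraction_parity_sign wedge_linear parity_sign_linear form_apply[where Xs = Xs])
  qed (use assms in \<open>auto simp: contraction_ext_deriv_outside contraction_outside contraction_add
      contraction_wedge contraction_parity_sign form_apply[where Xs = "[]"]\<close>)
  then show ?thesis by simp
qed

text \<open>On functions this is the definition of the bracket. After contraction with Z the terms
  with nested brackets match by the Jacobi identity for vector fields, and the mixed terms
  cancel.\<close>

lemma lie_deriv_lie_bracket:
  assumes "X \<in> VF" "Y \<in> VF" "\<omega> \<in> \<Omega>"
  shows "\<L> (lie_bracket X Y) \<omega> = \<L> X (\<L> Y \<omega>) - \<L> Y (\<L> X \<omega>)"
proof (rule form_op_eqI[where P = "\<lambda>\<alpha>. \<alpha> \<in> \<Omega>"
      and A = "\<lambda>\<omega>. \<L> (lie_bracket X Y) \<omega>" and B = "\<lambda>\<omega>. \<L> X (\<L> Y \<omega>) - \<L> Y (\<L> X \<omega>)"], goal_cases)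
  case (1 \<omega>)
  show ?case by (simp add: form_apply[where Xs = "[]"] lie_bracket_apply)
next
  case (3 \<omega> Z Xs)
  then show ?case
    using assms by (simp add: contraction_lie_deriv contraction_diff lie_bracket_closed
        lie_deriv_diff lie_bracket_jacobi[of X Y Z] contraction_form_add form_apply[where Xs = Xs])
qed (use assms in \<open>auto simp: contraction_lie_deriv_outside contraction_diff\<close>)

text \<open>Contraction with Z produces \<L>_X \<L>_Z - \<L>_[X,Z] on one side and \<L>_Z \<L>_X on
  the other; the rest is the induction hypothesis for the contracted form.\<close>

lemma lie_deriv_ext_deriv:
  assumes "X \<in> VF" "\<omega> \<in> \<Omega>"
  shows "\<L> X (\<d> \<omega>) = \<d> (\<L> X \<omega>)"
proof (rule form_op_eqI[where P = "\<lambda>\<alpha>. \<alpha> \<in> \<Omega>"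
      and A = "\<lambda>\<omega>. \<L> X (\<d> \<omega>)" and B = "\<lambda>\<omega>. \<d> (\<L> X \<omega>)"], goal_cases)
  case (3 \<omega> Z Xs)
  then show ?case
    using assms by (simp add: contraction_lie_deriv contraction_ext_deriv lie_bracket_closed
        lie_deriv_diff lie_deriv_lie_bracket ext_deriv_diff form_apply[where Xs = Xs])
qed (use assms in \<open>auto simp: contraction_lie_deriv_outside contraction_ext_deriv_outside\<close>)

text \<open>Since d commutes with \<L>_Z, Cartan's formula applied twice gives \<iota>_Z d d = d d
  \<iota>_Z, and on the empty list the value is 0.\<close>

lemma ext_deriv_ext_deriv:
  assumes "\<omega> \<in> \<Omega>"
  shows "\<d> (\<d> \<omega>) = 0"
proof (rule form_op_eqI[where P = "\<lambda>\<alpha>. \<alpha> \<in> \<Omega>"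
      and A = "\<lambda>\<omega>. \<d> (\<d> \<omega>)" and B = "\<lambda>_. 0"], goal_cases)
  case (3 \<omega> Z Xs)
  then show ?case
    by (simp add: contraction_ext_deriv lie_deriv_ext_deriv ext_deriv_diff)
qed (use assms in \<open>auto simp: contraction_ext_deriv_outside form_apply[where Xs = "[]"]\<close>)

end

section \<open>Multiplication of functions on the dg-manifold\<close>

text \<open>The coefficient of a power of \<open>t\<close>, a function of the exponent of \<open>q\<close>, is an element of
  \<open>\<Omega>M \<otimes> \<Lambda>[q]\<close>; \<open>qmult\<close> is the product there, and \<open>qsign\<close> the sign by the total parity.\<close>

definition qmult :: "(bool \<Rightarrow> 'm form) \<Rightarrow> (bool \<Rightarrow> 'm form) \<Rightarrow> bool \<Rightarrow> 'm form" where
  "qmult u v = (\<lambda>e. if e then wedge (u False) (v True) + wedge (u True) (parity_sign (v False))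
     else wedge (u False) (v False))"

definition qsign :: "(bool \<Rightarrow> 'm form) \<Rightarrow> bool \<Rightarrow> 'm form" where
  "qsign u = (\<lambda>e. if e then - parity_sign (u True) else parity_sign (u False))"

text \<open>\<open>t\<close> has even degree, so its exponent contributes no sign.\<close>

definition psign :: "'m pfun \<Rightarrow> 'm pfun" where
  "psign a = (\<lambda>n. qsign (a n))"

lemma bool_fun_eqI: "f True = g True \<Longrightarrow> f False = g False \<Longrightarrow> f = g"
  by (rule ext) (metis (full_types))

lemma pmult_conv_qmult: "pmult a b n = (\<Sum>i\<le>n. qmult (a i) (b (n - i)))"
  by (rule ext) (simp add: pmult_def qmult_def sum_function_apply[where x = "_ :: bool"])

lemma qmult_apply [simp]:
  "qmult u v True = wedge (u False) (v True) + wedge (u True) (parity_sign (v False))"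
  "qmult u v False = wedge (u False) (v False)"
  by (simp_all add: qmult_def)

lemma qsign_apply [simp]:
  "qsign u True = - parity_sign (u True)" "qsign u False = parity_sign (u False)"
  by (simp_all add: qsign_def)

lemma qfun_apply:
  fixes u v :: "bool \<Rightarrow> 'm form"
  shows "(u + v) e = u e + v e" "(- u) e = - u e" "(r *\<^sub>R u) e = r *\<^sub>R u e"
    "(0 :: bool \<Rightarrow> 'm form) e = 0"
  by (rule plus_fun_apply uminus_apply scaleR_fun_apply zero_fun_apply)+

lemma qsign_idem [simp]: "qsign (qsign u) = u"
  by (rule bool_fun_eqI) (simp_all add: parity_sign_uminus)

lemma qmult_add_left: "qmult (u + u') v = qmult u v + qmult u' v"
  by (rule bool_fun_eqI) (simp_all add: qfun_apply wedge_linear)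

lemma qmult_add_right: "qmult u (v + v') = qmult u v + qmult u v'"
  by (rule bool_fun_eqI) (simp_all add: qfun_apply wedge_linear parity_sign_linear)

lemma qmult_scaleR_left: "qmult (r *\<^sub>R u) v = r *\<^sub>R qmult u v"
  by (rule bool_fun_eqI) (simp_all add: qfun_apply wedge_linear scaleR_add_right)

lemma qmult_scaleR_right: "qmult u (r *\<^sub>R v) = r *\<^sub>R qmult u v"
  by (rule bool_fun_eqI) (simp_all add: qfun_apply wedge_linear parity_sign_linear scaleR_add_right)

lemma qmult_zero [simp]: "qmult 0 v = 0" "qmult u 0 = 0"
  by (rule bool_fun_eqI; simp add: qfun_apply)+

lemma qmult_sum_left: "qmult (\<Sum>i\<in>A. f i) v = (\<Sum>i\<in>A. qmult (f i) v)"
  by (rule additive.sum[where f = "\<lambda>u. qmult u v"]) (simp add: Modules.additive_def qmult_add_left)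

lemma qmult_sum_right: "qmult u (\<Sum>i\<in>A. f i) = (\<Sum>i\<in>A. qmult u (f i))"
  by (rule additive.sum[where f = "qmult u"]) (simp add: Modules.additive_def qmult_add_right)

lemma qmult_assoc: "qmult (qmult u v) w = qmult u (qmult v w)"
  by (rule bool_fun_eqI) (simp_all add: wedge_assoc wedge_linear parity_sign_linear parity_sign_wedge add.assoc)

text \<open>As \<open>q\<close> is odd, the coefficient \<open>u True\<close> of an even element is
  an odd form; it is therefore moved by the odd case of commutativity for forms.\<close>

lemma qmult_commute_even:
  assumes "qsign u = u"
  shows "qmult u v = qmult v u"
proof (rule bool_fun_eqI)
  have F: "parity_sign (u False) = u False" and T: "parity_sign (u True) = - u True"
    using fun_cong[OF assms, of False] fun_cong[OF assms, of True] by (simp_all add: minus_equation_iff)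
  show "qmult u v True = qmult v u True"
    using wedge_commute_even[OF F, of "v True"] wedge_commute_odd[OF T, of "parity_sign (v False)"]
    by (simp add: F)
  show "qmult u v False = qmult v u False"
    using wedge_commute_even[OF F] by simp
qed

lemma qmult_commute_odd:
  assumes "qsign u = - u"
  shows "qmult u v = qmult (qsign v) u"
proof (rule bool_fun_eqI)
  have F: "parity_sign (u False) = - u False" and T: "parity_sign (u True) = u True"
    using fun_cong[OF assms, of False] fun_cong[OF assms, of True] by (simp_all add: qfun_apply)
  show "qmult u v True = qmult (qsign v) u True"
    using wedge_commute_odd[OF F, of "v True"] wedge_commute_even[OF T, of "parity_sign (v False)"]
    by (simp add: F wedge_linear)
  show "qmult u v False = qmult (qsign v) u False"
    using wedge_commute_odd[OF F] by simp
qed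

lemma pmult_assoc: "pmult (pmult a b) c = pmult a (pmult b c)"
proof
  fix n
  have "pmult (pmult a b) c n =
      (\<Sum>i\<le>n. \<Sum>j\<le>i. qmult (a j) (qmult (b (i - j)) (c (n - i))))"
    by (simp add: pmult_conv_qmult qmult_sum_left qmult_assoc)
  \<comment> \<open>The reindexing of triples of exponents behind associativity of power series,
    taken here with the triple product of coefficients as the summand.\<close>
  also have "\<dots> = (\<Sum>j\<le>n. \<Sum>i\<le>n - j. qmult (a j) (qmult (b i) (c (n - j - i))))"
    using fps_mult_assoc_lemma[of "\<lambda>i j k. qmult (a i) (qmult (b j) (c k))" n n]
    by (simp add: atLeast0AtMost)
  also have "\<dots> = pmult a (pmult b c) n"
    by (simp add: pmult_conv_qmult qmult_sum_right)
  finally show "pmult (pmult a b) c n = pmult a (pmult b c) n" .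
qed

lemma pmult_rev: "pmult a b n = (\<Sum>i\<le>n. qmult (a (n - i)) (b i))"
  unfolding pmult_conv_qmult by (rule sum.reindex_bij_witness[of _ "\<lambda>i. n - i" "\<lambda>i. n - i"]) auto

lemma pmult_commute_even: "psign u = u \<Longrightarrow> pmult u a = pmult a u"
proof (rule ext)
  fix n assume "psign u = u"
  then have "qsign (u i) = u i" for i by (metis psign_def)
  then show "pmult u a n = pmult a u n"
    by (subst pmult_rev) (simp add: pmult_conv_qmult qmult_commute_even[of "u _"])
qed

lemma pmult_commute_odd: "psign u = - u \<Longrightarrow> pmult u a = pmult (psign a) u"
proof (rule ext)
  fix n assume "psign u = - u"
  then have "qsign (u i) = - u i" for i by (metis psign_def uminus_apply)
  then show "pmult u a n = pmult (psign a) u n"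
    by (subst pmult_rev) (simp add: pmult_conv_qmult qmult_commute_odd[of "u _"] psign_def)
qed

lemma psign_idem [simp]: "psign (psign a) = a"
  by (simp add: psign_def)

lemma pfun_apply:
  fixes a b :: "'m pfun"
  shows "(a + b) n = a n + b n" "(r *\<^sub>R a) n = r *\<^sub>R a n" "(- a) n = - a n" "(0 :: 'm pfun) n = 0"
  by (rule plus_fun_apply uminus_apply scaleR_fun_apply zero_fun_apply)+

lemma pmult_add_left: "pmult (a + a') b = pmult a b + pmult a' b"
  by (rule ext) (simp add: pmult_conv_qmult pfun_apply qmult_add_left sum.distrib)

lemma pmult_add_right: "pmult a (b + b') = pmult a b + pmult a b'"
  by (rule ext) (simp add: pmult_conv_qmult pfun_apply qmult_add_right sum.distrib)

lemma pmult_scaleR_left: "pmult (r *\<^sub>R a) b = r *\<^sub>R pmult a b"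
  by (rule ext) (simp add: pmult_conv_qmult pfun_apply qmult_scaleR_left scaleR_sum_right)

lemma pmult_scaleR_right: "pmult a (r *\<^sub>R b) = r *\<^sub>R pmult a b"
  by (rule ext) (simp add: pmult_conv_qmult pfun_apply qmult_scaleR_right scaleR_sum_right)

lemma pmult_zero [simp]: "pmult 0 b = 0" "pmult a 0 = 0"
  using pmult_scaleR_left[of 0 0 b] pmult_scaleR_right[of a 0 0] by simp_all

text \<open>The element \<open>\<beta> + \<gamma> q\<close>.\<close>

definition pconst :: "'m form \<Rightarrow> 'm form \<Rightarrow> 'm pfun" where
  "pconst \<beta> \<gamma> = (\<lambda>n e. if n = 0 then if e then \<gamma> else \<beta> else 0)"

lemma pmult_pconst: "pmult (pconst \<beta> \<gamma>) a n = qmult (\<lambda>e. if e then \<gamma> else \<beta>) (a n)"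
proof -
  have "qmult (pconst \<beta> \<gamma> i) (a (n - i)) = 0" if "i \<noteq> 0" for i
  proof -
    have "pconst \<beta> \<gamma> i = 0"
      using that by (intro ext) (simp add: pconst_def zero_fun_apply)
    then show ?thesis by simp
  qed
  then have "pmult (pconst \<beta> \<gamma>) a n = (\<Sum>i\<in>{0}. qmult (pconst \<beta> \<gamma> i) (a (n - i)))"
    unfolding pmult_conv_qmult by (intro sum.mono_neutral_right) auto
  then show ?thesis by (simp add: pconst_def)
qed

lemma pform_pconst: "pform \<omega> = pconst \<omega> 0"
  by (auto simp: pform_def pconst_def fun_eq_iff)

lemma pconst_add: "pconst \<beta> \<gamma> + pconst \<beta>' \<gamma>' = pconst (\<beta> + \<beta>') (\<gamma> + \<gamma>')"
  by (intro ext) (simp add: pconst_def fun_apply)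

text \<open>The degree is an integer, so that contraction lowers it without a special case at 0; in
  negative degrees only 0 is homogeneous.\<close>

definition form_deg :: "int \<Rightarrow> 'm form \<Rightarrow> bool" where
  "form_deg p \<omega> \<longleftrightarrow> (\<forall>Xs. \<omega> Xs \<noteq> 0 \<longrightarrow> int (length Xs) = p)"

lemma form_deg_parity_sign: "form_deg p \<omega> \<Longrightarrow> parity_sign \<omega> = int_sign p *\<^sub>R \<omega>"
proof
  fix Xs assume *: "form_deg p \<omega>"
  show "parity_sign \<omega> Xs = (int_sign p *\<^sub>R \<omega>) Xs"
  proof (cases "\<omega> Xs = 0")
    case False
    with * have "p = int (length Xs)" by (auto simp: form_deg_def)
    then show ?thesis
      by (cases "even (length Xs)") (simp_all add: parity_sign_def int_sign_def uminus_apply)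
  qed (simp add: parity_sign_def scaleR_fun_apply[where x = Xs])
qed

lemma form_degI: "(\<And>Xs. int (length Xs) \<noteq> p \<Longrightarrow> \<omega> Xs = 0) \<Longrightarrow> form_deg p \<omega>"
  by (auto simp: form_deg_def)

lemma form_degD: "form_deg p \<omega> \<Longrightarrow> int (length Xs) \<noteq> p \<Longrightarrow> \<omega> Xs = 0"
  by (auto simp: form_deg_def)

lemma form_deg_zero [simp]: "form_deg p 0"
  by (simp add: form_deg_def zero_fun_apply)

lemma form_deg_add [intro]: "form_deg p \<alpha> \<Longrightarrow> form_deg p \<beta> \<Longrightarrow> form_deg p (\<alpha> + \<beta>)"
  by (rule form_degI) (simp add: form_degD plus_fun_apply[where f = \<alpha>])

lemma form_deg_scaleR [intro]: "form_deg p \<alpha> \<Longrightarrow> form_deg p (r *\<^sub>R \<alpha>)"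
  by (rule form_degI) (simp add: form_degD scaleR_fun_apply[where f = \<alpha>])

lemma form_deg_uminus [intro]: "form_deg p \<alpha> \<Longrightarrow> form_deg p (- \<alpha>)"
  using form_deg_scaleR[of p \<alpha> "-1"] by simp

lemma form_deg_diff [intro]: "form_deg p \<alpha> \<Longrightarrow> form_deg p \<beta> \<Longrightarrow> form_deg p (\<alpha> - \<beta>)"
  using form_deg_add[of p \<alpha> "- \<beta>"] form_deg_uminus[of p \<beta>] by simp

lemma form_deg_parity [intro]: "form_deg p \<alpha> \<Longrightarrow> form_deg p (parity_sign \<alpha>)"
  by (rule form_degI) (simp add: form_degD parity_sign_def)

lemma form_deg_fmult [intro]: "form_deg p \<alpha> \<Longrightarrow> form_deg p (fmult f \<alpha>)"
  by (rule form_degI) (simp add: form_degD fmult_def)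

lemma form_deg_form0 [intro]: "form_deg 0 (form0 f)"
  by (auto simp: form_deg_def form0_def)

lemma form_deg_contraction [intro]: "form_deg p \<alpha> \<Longrightarrow> form_deg (p - 1) (contraction X \<alpha>)"
  by (fastforce simp: form_deg_def contraction_apply)

lemma form_deg_wedge [intro]:
  assumes "form_deg p \<alpha>" "form_deg q \<beta>"
  shows "form_deg (p + q) (wedge \<alpha> \<beta>)"
proof -
  have "wedge \<alpha> \<beta> Xs = 0" if "int (length Xs) \<noteq> p + q" for Xs
    using assms that
  proof (induction Xs arbitrary: p q \<alpha> \<beta>)
    case Nil
    then have "\<alpha> [] = 0 \<or> \<beta> [] = 0"
      using form_degD[of p \<alpha> "[]"] form_degD[of q \<beta> "[]"] by (cases "p = 0") simp_all
    then show ?case by auto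
  next
    case (Cons X Xs)
    have "wedge (contraction X \<alpha>) \<beta> Xs = 0"
      using Cons.prems by (intro Cons.IH[of "p - 1" _ q]) auto
    moreover have "wedge (parity_sign \<alpha>) (contraction X \<beta>) Xs = 0"
      using Cons.prems by (intro Cons.IH[of p _ "q - 1"]) auto
    ultimately show ?case by (simp add: wedge_Cons)
  qed
  then show ?thesis by (auto simp: form_deg_def)
qed

lemma kforms_form_deg: "\<omega> \<in> kforms M k \<longleftrightarrow> \<omega> \<in> forms M \<and> form_deg (int k) \<omega>"
  by (auto simp: kforms_def form_deg_def)

lemma wedge_commute_deg:
  assumes "form_deg p \<alpha>" "form_deg q \<beta>"
  shows "wedge \<alpha> \<beta> = int_sign (p * q) *\<^sub>R wedge \<beta> \<alpha>"
proof (cases "even p")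
  case True
  then show ?thesis
    using wedge_commute_even[of \<alpha> \<beta>] form_deg_parity_sign[OF assms(1)] by (simp add: int_sign_def)
next
  case False
  then show ?thesis
    using wedge_commute_odd[of \<alpha> \<beta>] form_deg_parity_sign[OF assms(1)] form_deg_parity_sign[OF assms(2)]
    by (simp add: int_sign_def wedge_linear)
qed

lemma pfuns_deg_iff:
  "a \<in> pfuns_deg M j \<longleftrightarrow> a \<in> pfuns M \<and> (\<forall>n e. form_deg (j - of_bool e - 2 * int n) (a n e))"
proof -
  have "(int l + of_bool e + 2 * int n = j) \<longleftrightarrow> (int l = j - of_bool e - 2 * int n)" for l e n
    by auto
  then show ?thesis by (simp add: pfuns_deg_def form_deg_def)
qed

lemma psign_deg:
  assumes "a \<in> pfuns_deg M j"
  shows "psign a = int_sign j *\<^sub>R a"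
proof
  fix n
  have d: "form_deg (j - of_bool e - 2 * int n) (a n e)" for e
    using assms by (simp add: pfuns_deg_iff)
  show "psign a n = (int_sign j *\<^sub>R a) n"
    using form_deg_parity_sign[OF d[of True]] form_deg_parity_sign[OF d[of False]]
    by (intro bool_fun_eqI) (auto simp: psign_def pfun_apply qfun_apply int_sign_def)
qed

section \<open>Derivations in components\<close>

lemma wedge_swap_deg:
  assumes "form_deg p \<alpha>" "form_deg q \<beta>"
  shows "wedge \<alpha> (wedge \<beta> \<omega>) = int_sign (p * q) *\<^sub>R wedge \<beta> (wedge \<alpha> \<omega>)"
  by (simp add: wedge_assoc[symmetric] wedge_commute_deg[OF assms] wedge_linear)

text \<open>The operator \<open>\<Theta> + \<alpha> \<partial>\<^sub>q + (\<beta> + \<gamma> q) \<partial>\<^sub>t\<close> in components; the coefficient \<open>\<gamma>\<close> stands to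
  the left of \<open>q\<close>, whence the parity signs.\<close>

definition gen :: "'m manifold \<Rightarrow> ('m form \<Rightarrow> 'm form) \<Rightarrow> 'm form \<Rightarrow> 'm form \<Rightarrow> 'm form \<Rightarrow> 'm pop" where
  "gen M \<Theta> \<alpha> \<beta> \<gamma> = (\<lambda>a. if a \<in> pfuns M then (\<lambda>n e.
     if e then \<Theta> (a n True) + real (Suc n) *\<^sub>R
       (wedge \<beta> (a (Suc n) True) + wedge \<gamma> (parity_sign (a (Suc n) False)))
     else \<Theta> (a n False) + wedge \<alpha> (parity_sign (a n True)) +
       real (Suc n) *\<^sub>R wedge \<beta> (a (Suc n) False)) else 0)"

text \<open>The extension of a derivation by zero on \<open>q\<close> and \<open>t\<close>. No sign
  occurs, because coefficients stand to the left of \<open>q\<close> and \<open>t\<close>.\<close>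

definition der_op :: "'m manifold \<Rightarrow> ('m form \<Rightarrow> 'm form) \<Rightarrow> 'm pop" where
  "der_op M \<Theta> = (\<lambda>a. if a \<in> pfuns M then (\<lambda>n e. \<Theta> (a n e)) else 0)"

lemma pfun_eqI: "(\<And>n. a n True = b n True) \<Longrightarrow> (\<And>n. a n False = b n False) \<Longrightarrow> a = (b :: 'm pfun)"
  by (rule ext, rule bool_fun_eqI) auto

lemma pop_apply:
  fixes D E :: "'m pop"
  shows "(D + E) a = D a + E a" "(D - E) a = D a - E a" "(- D) a = - D a"
    "(r *\<^sub>R D) a = r *\<^sub>R D a" "(0 :: 'm pop) a = 0"
  by (rule plus_fun_apply minus_apply uminus_apply scaleR_fun_apply zero_fun_apply)+

lemmas coeff_apply = pfun_apply qfun_apply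

context smooth_mfd
begin

abbreviation \<P> where "\<P> \<equiv> pfuns M"

section \<open>The graded algebra of functions on the dg-manifold\<close>

lemma pfun_form [simp]: "a \<in> \<P> \<Longrightarrow> a n e \<in> \<Omega>"
  by (simp add: pfuns_def)

lemma pfun_bounded: "a \<in> \<P> \<Longrightarrow> \<exists>N. \<forall>n\<ge>N. \<forall>e. a n e = 0"
proof -
  assume "a \<in> \<P>"
  then obtain N where "\<forall>n\<in>{n. \<exists>e. a n e \<noteq> 0}. n < N"
    unfolding pfuns_def mem_Collect_eq finite_nat_set_iff_bounded by blast
  then have "\<forall>n\<ge>N. \<forall>e. a n e = 0" by (metis (mono_tags, lifting) linorder_not_le mem_Collect_eq)
  then show ?thesis by blast
qed

lemma pfunsI:
  assumes "\<And>n e. a n e \<in> \<Omega>" "\<And>n e. N \<le> n \<Longrightarrow> a n e = 0"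
  shows "a \<in> \<P>"
proof -
  have "n < N" if "a n e \<noteq> 0" for n e using assms(2)[of n e] that by (cases "N \<le> n") simp_all
  then have "{n. \<exists>e. a n e \<noteq> 0} \<subseteq> {..<N}" by blast
  then have "finite {n. \<exists>e. a n e \<noteq> 0}" by (rule finite_subset) simp
  with assms(1) show ?thesis unfolding pfuns_def by blast
qed

lemma pfuns_zero [simp]: "0 \<in> \<P>"
  by (rule pfunsI[where N = 0]) (simp_all add: coeff_apply)

lemma pfuns_add [simp]:
  assumes "a \<in> \<P>" "b \<in> \<P>" shows "a + b \<in> \<P>"
proof -
  obtain N N' where N: "\<forall>n\<ge>N. \<forall>e. a n e = 0" "\<forall>n\<ge>N'. \<forall>e. b n e = 0"
    using assms pfun_bounded by metis
  show ?thesis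
    by (rule pfunsI[where N = "max N N'"]) (use assms N in \<open>simp_all add: coeff_apply form_add\<close>)
qed

lemma pfuns_scaleR [simp]:
  assumes "a \<in> \<P>" shows "r *\<^sub>R a \<in> \<P>"
proof -
  obtain N where N: "\<forall>n\<ge>N. \<forall>e. a n e = 0"
    using assms pfun_bounded by metis
  show ?thesis
    by (rule pfunsI[where N = N]) (use assms N in \<open>simp_all add: coeff_apply form_scaleR\<close>)
qed

lemma pfuns_diff [simp]: "a \<in> \<P> \<Longrightarrow> b \<in> \<P> \<Longrightarrow> a - b \<in> \<P>"
  using pfuns_add[of a "- b"] pfuns_scaleR[of b "-1"] by simp

lemma qmult_form: "(\<And>e. u e \<in> \<Omega>) \<Longrightarrow> (\<And>e. v e \<in> \<Omega>) \<Longrightarrow> qmult u v e \<in> \<Omega>"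
  by (cases e) (auto simp: form_wedge form_parity_sign form_add)

lemma pfuns_pmult [simp]:
  assumes "a \<in> \<P>" "b \<in> \<P>" shows "pmult a b \<in> \<P>"
proof -
  obtain N N' where N: "\<forall>n\<ge>N. \<forall>e. a n e = 0" "\<forall>n\<ge>N'. \<forall>e. b n e = 0"
    using assms pfun_bounded by metis
  show ?thesis
  proof (rule pfunsI[where N = "N + N'"])
    show "pmult a b n e \<in> \<Omega>" for n e
      unfolding pmult_conv_qmult sum_function_apply[where x = e]
      by (rule form_sum) (use assms in \<open>auto intro!: qmult_form\<close>)
    show "pmult a b n e = 0" if "N + N' \<le> n" for n e
    proof -
      have "qmult (a i) (b (n - i)) = 0" for i
      proof (cases "N \<le> i")
        case True
        then have "a i = 0" using N by (intro ext) (simp add: qfun_apply)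
        then show ?thesis by simp
      next
        case False
        then have "b (n - i) = 0" using N that by (intro ext) (simp add: qfun_apply)
        then show ?thesis by simp
      qed
      then show ?thesis by (simp add: pmult_conv_qmult qfun_apply)
    qed
  qed
qed

text \<open>Only the parity of \<open>k\<close> enters the Leibniz rule, through
  \<open>parity_sign\<close>, so the rule makes sense for inhomogeneous forms. The instances are d,
  contraction, the Lie derivative and 0, in the degrees 1, -1, 0 and arbitrary.\<close>

definition form_derivation :: "int \<Rightarrow> ('m form \<Rightarrow> 'm form) \<Rightarrow> bool" where
  "form_derivation k \<Theta> \<longleftrightarrow>
     (\<forall>\<alpha>\<in>\<Omega>. \<Theta> \<alpha> \<in> \<Omega>) \<and> (\<forall>\<alpha>\<in>\<Omega>. \<forall>\<beta>\<in>\<Omega>. \<Theta> (\<alpha> + \<beta>) = \<Theta> \<alpha> + \<Theta> \<beta>) \<and>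
     (\<forall>r. \<forall>\<alpha>\<in>\<Omega>. \<Theta> (r *\<^sub>R \<alpha>) = r *\<^sub>R \<Theta> \<alpha>) \<and>
     (\<forall>\<alpha>\<in>\<Omega>. \<Theta> (parity_sign \<alpha>) = int_sign k *\<^sub>R parity_sign (\<Theta> \<alpha>)) \<and>
     (\<forall>\<alpha>\<in>\<Omega>. \<forall>\<beta>\<in>\<Omega>. \<Theta> (wedge \<alpha> \<beta>) =
        wedge (\<Theta> \<alpha>) \<beta> + wedge (if even k then \<alpha> else parity_sign \<alpha>) (\<Theta> \<beta>)) \<and>
     (\<forall>\<alpha>\<in>\<Omega>. \<forall>p. form_deg p \<alpha> \<longrightarrow> form_deg (p + k) (\<Theta> \<alpha>))"

lemma form_derivationD:
  assumes "form_derivation k \<Theta>"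
  shows "\<alpha> \<in> \<Omega> \<Longrightarrow> \<Theta> \<alpha> \<in> \<Omega>"
    and "\<alpha> \<in> \<Omega> \<Longrightarrow> \<beta> \<in> \<Omega> \<Longrightarrow> \<Theta> (\<alpha> + \<beta>) = \<Theta> \<alpha> + \<Theta> \<beta>"
    and "\<alpha> \<in> \<Omega> \<Longrightarrow> \<Theta> (r *\<^sub>R \<alpha>) = r *\<^sub>R \<Theta> \<alpha>"
    and "\<alpha> \<in> \<Omega> \<Longrightarrow> \<Theta> (parity_sign \<alpha>) = int_sign k *\<^sub>R parity_sign (\<Theta> \<alpha>)"
    and "\<alpha> \<in> \<Omega> \<Longrightarrow> \<beta> \<in> \<Omega> \<Longrightarrow> \<Theta> (wedge \<alpha> \<beta>) =
        wedge (\<Theta> \<alpha>) \<beta> + wedge (if even k then \<alpha> else parity_sign \<alpha>) (\<Theta> \<beta>)"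
    and "\<alpha> \<in> \<Omega> \<Longrightarrow> form_deg p \<alpha> \<Longrightarrow> form_deg (p + k) (\<Theta> \<alpha>)"
    and "\<Theta> 0 = 0"
proof -
  have "\<Theta> (0 *\<^sub>R 0) = 0 *\<^sub>R \<Theta> 0"
    using assms form_zero unfolding form_derivation_def by blast
  then show "\<Theta> 0 = 0" by simp
qed (use assms in \<open>simp_all add: form_derivation_def\<close>)

lemma form_deg_lie_deriv:
  assumes "X \<in> VF" "form_deg p \<alpha>" shows "form_deg p (\<L> X \<alpha>)"
proof (rule form_degI)
  fix Xs :: "'m vf list" assume "int (length Xs) \<noteq> p"
  then have "\<alpha> Ys = 0" if "length Ys = length Xs" for Ys
    using assms(2) that by (simp add: form_degD)
  then show "\<L> X \<alpha> Xs = 0" using assms(1) by (simp add: lie_deriv_def)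
qed

lemma form_deg_ext_deriv:
  assumes "\<alpha> \<in> \<Omega>" "form_deg p \<alpha>" shows "form_deg (p + 1) (\<d> \<alpha>)"
proof -
  have "\<d> \<alpha> Xs = 0" if "int (length Xs) \<noteq> p + 1" for Xs
    using assms that
  proof (induction Xs arbitrary: p \<alpha>)
    case (Cons X Xs)
    show ?case
    proof (cases "X \<in> VF")
      case True
      have "\<L> X \<alpha> Xs = 0"
        using form_deg_lie_deriv[OF True Cons.prems(2)] Cons.prems(3) by (simp add: form_degD)
      moreover have "\<d> (contraction X \<alpha>) Xs = 0"
        using Cons.prems by (intro Cons.IH[of _ "p - 1"]) auto
      ultimately have "contraction X (\<d> \<alpha>) Xs = 0"
        using True Cons.prems(1) by (simp add: contraction_ext_deriv form_apply[where Xs = Xs])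
      then show ?thesis by (simp add: contraction_apply)
    qed (simp add: ext_deriv_outside)
  qed simp
  then show ?thesis by (rule form_degI)
qed

lemma form_derivation_ext_deriv: "form_derivation 1 \<d>"
  by (simp add: form_derivation_def ext_deriv_add ext_deriv_scaleR ext_deriv_parity_sign
      ext_deriv_wedge form_deg_ext_deriv int_sign_def)

lemma form_derivation_contraction: "form_derivation (-1) (contraction X)"
  using form_deg_contraction[where X = X]
  by (simp add: form_derivation_def contraction_add contraction_scaleR contraction_parity_sign
      contraction_wedge int_sign_def)

lemma form_derivation_lie_deriv: "X \<in> VF \<Longrightarrow> form_derivation 0 (\<L> X)"
  by (simp add: form_derivation_def lie_deriv_add lie_deriv_scaleR lie_deriv_parity_sign
      lie_deriv_wedge form_deg_lie_deriv int_sign_def)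

lemma form_derivation_zero: "form_derivation k (\<lambda>_. 0)"
  by (simp add: form_derivation_def)

text \<open>The degrees that make all summands homogeneous of degree \<open>k\<close>: removing
  \<open>q\<close> lowers the degree by 1, removing \<open>t\<close> by 2, and the factor
  \<open>q\<close> next to \<open>\<gamma>\<close> accounts for one of the latter.\<close>

definition gen_data :: "int \<Rightarrow> ('m form \<Rightarrow> 'm form) \<Rightarrow> 'm form \<Rightarrow> 'm form \<Rightarrow> 'm form \<Rightarrow> bool" where
  "gen_data k \<Theta> \<alpha> \<beta> \<gamma> \<longleftrightarrow> form_derivation k \<Theta> \<and> \<alpha> \<in> \<Omega> \<and> \<beta> \<in> \<Omega> \<and> \<gamma> \<in> \<Omega> \<and>
     form_deg (k + 1) \<alpha> \<and> form_deg (k + 2) \<beta> \<and> form_deg (k + 1) \<gamma>"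

lemma gen_outside: "a \<notin> \<P> \<Longrightarrow> gen M \<Theta> \<alpha> \<beta> \<gamma> a = 0"
  by (simp add: gen_def)

lemma gen_apply:
  assumes "a \<in> \<P>"
  shows "gen M \<Theta> \<alpha> \<beta> \<gamma> a n True = \<Theta> (a n True) + real (Suc n) *\<^sub>R
       (wedge \<beta> (a (Suc n) True) + wedge \<gamma> (parity_sign (a (Suc n) False)))"
    and "gen M \<Theta> \<alpha> \<beta> \<gamma> a n False = \<Theta> (a n False) + wedge \<alpha> (parity_sign (a n True)) +
       real (Suc n) *\<^sub>R wedge \<beta> (a (Suc n) False)"
  using assms by (simp_all add: gen_def)

lemma gen_closed:
  assumes "gen_data k \<Theta> \<alpha> \<beta> \<gamma>"
  shows "gen M \<Theta> \<alpha> \<beta> \<gamma> a \<in> \<P>"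
proof (cases "a \<in> \<P>")
  case True
  have \<Theta>: "form_derivation k \<Theta>" and f: "\<alpha> \<in> \<Omega>" "\<beta> \<in> \<Omega>" "\<gamma> \<in> \<Omega>"
    using assms by (auto simp: gen_data_def)
  obtain N where N: "\<forall>n\<ge>N. \<forall>e. a n e = 0"
    using True pfun_bounded by metis
  show ?thesis
  proof (rule pfunsI[where N = N])
    show "gen M \<Theta> \<alpha> \<beta> \<gamma> a n e \<in> \<Omega>" for n e
      using True f by (cases e) (auto simp: gen_apply
          intro!: form_add form_scaleR form_wedge form_parity_sign form_derivationD(1)[OF \<Theta>])
    show "gen M \<Theta> \<alpha> \<beta> \<gamma> a n e = 0" if "N \<le> n" for n e
      using True N that by (cases e) (simp_all add: gen_apply form_derivationD(7)[OF \<Theta>])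
  qed
qed (simp add: gen_outside)

lemma gen_add:
  assumes "gen_data k \<Theta> \<alpha> \<beta> \<gamma>" "a \<in> \<P>" "b \<in> \<P>"
  shows "gen M \<Theta> \<alpha> \<beta> \<gamma> (a + b) = gen M \<Theta> \<alpha> \<beta> \<gamma> a + gen M \<Theta> \<alpha> \<beta> \<gamma> b"
proof -
  have \<Theta>: "form_derivation k \<Theta>" using assms by (auto simp: gen_data_def)
  show ?thesis
    using assms(2,3) by (intro pfun_eqI)
      (simp_all add: gen_apply coeff_apply form_derivationD(2)[OF \<Theta>] parity_sign_linear wedge_linear
        scaleR_add_right)
qed

lemma gen_scaleR:
  assumes "gen_data k \<Theta> \<alpha> \<beta> \<gamma>" "a \<in> \<P>"
  shows "gen M \<Theta> \<alpha> \<beta> \<gamma> (r *\<^sub>R a) = r *\<^sub>R gen M \<Theta> \<alpha> \<beta> \<gamma> a"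
proof -
  have \<Theta>: "form_derivation k \<Theta>" using assms by (auto simp: gen_data_def)
  show ?thesis
    using assms(2) by (intro pfun_eqI)
      (simp_all add: gen_apply coeff_apply form_derivationD(3)[OF \<Theta>] parity_sign_linear wedge_linear
        scaleR_add_right mult.commute)
qed

lemma gen_pfuns_deg:
  assumes g: "gen_data k \<Theta> \<alpha> \<beta> \<gamma>" and a: "a \<in> pfuns_deg M j"
  shows "gen M \<Theta> \<alpha> \<beta> \<gamma> a \<in> pfuns_deg M (j + k)"
proof -
  have \<Theta>: "form_derivation k \<Theta>" and d: "form_deg (k + 1) \<alpha>" "form_deg (k + 2) \<beta>" "form_deg (k + 1) \<gamma>"
    using g by (auto simp: gen_data_def)
  have aP: "a \<in> \<P>" and ad: "\<And>n e. form_deg (j - of_bool e - 2 * int n) (a n e)"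
    using a by (auto simp: pfuns_deg_iff)
  have adT: "form_deg (j - 1 - 2 * int n) (a n True)" and adF: "form_deg (j - 2 * int n) (a n False)" for n
    using ad[of True n] ad[of False n] by simp_all
  have "form_deg (j + k - of_bool e - 2 * int n) (gen M \<Theta> \<alpha> \<beta> \<gamma> a n e)" for n e
  proof (cases e)
    case True
    have "form_deg (j - 1 - 2 * int n + k) (\<Theta> (a n True))"
      using form_derivationD(6)[OF \<Theta>] aP ad[of True n] by simp
    moreover have "form_deg (k + 2 + (j - 1 - 2 * int (Suc n))) (wedge \<beta> (a (Suc n) True))"
      by (intro form_deg_wedge d adT)
    moreover have "form_deg (k + 1 + (j - 2 * int (Suc n))) (wedge \<gamma> (parity_sign (a (Suc n) False)))"
      by (intro form_deg_wedge form_deg_parity d adF)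
    ultimately show ?thesis
      using True by (auto simp: gen_apply[OF aP] algebra_simps intro!: form_deg_add form_deg_scaleR)
  next
    case False
    have "form_deg (j - 2 * int n + k) (\<Theta> (a n False))"
      using form_derivationD(6)[OF \<Theta>] aP ad[of False n] by simp
    moreover have "form_deg (k + 1 + (j - 1 - 2 * int n)) (wedge \<alpha> (parity_sign (a n True)))"
      by (intro form_deg_wedge form_deg_parity d adT)
    moreover have "form_deg (k + 2 + (j - 2 * int (Suc n))) (wedge \<beta> (a (Suc n) False))"
      by (intro form_deg_wedge d adF)
    ultimately show ?thesis
      using False by (auto simp: gen_apply[OF aP] algebra_simps intro!: form_deg_add form_deg_scaleR)
  qed
  then show ?thesis using gen_closed[OF g] by (simp add: pfuns_deg_iff)
qed

text \<open>The graded Leibniz rule with the sign written as an operator, hence for inhomogeneous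
  \<open>a\<close>; \<open>psign_deg\<close> turns it into the rule of
  \<open>graded_derivations\<close>.\<close>

definition pder :: "int \<Rightarrow> 'm pop \<Rightarrow> bool" where
  "pder k D \<longleftrightarrow> (\<forall>a\<in>\<P>. \<forall>b\<in>\<P>.
     D (pmult a b) = pmult (D a) b + pmult (if even k then a else psign a) (D b))"

lemma pder_add: "pder k D \<Longrightarrow> pder k E \<Longrightarrow> pder k (D + E)"
  by (simp add: pder_def pop_apply pmult_add_left pmult_add_right)

text \<open>In the second term of the Leibniz rule \<open>u\<close> has to pass the first factor
  \<open>a\<close>; for odd \<open>u\<close> this contributes one more \<open>psign\<close>, which
  explains the total degree \<open>p + k\<close>.\<close>

lemma pder_left_mult:
  assumes "pder k D" "psign u = int_sign p *\<^sub>R u"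
  shows "pder (p + k) (left_mult u D)"
proof -
  have "pmult u (pmult a c) = pmult (if even p then a else psign a) (pmult u c)" for a c
  proof (cases "even p")
    case True
    then have "pmult u a = pmult a u" using assms(2) by (intro pmult_commute_even) (simp add: int_sign_def)
    with True show ?thesis by (simp add: pmult_assoc[symmetric])
  next
    case False
    then have "pmult u a = pmult (psign a) u" using assms(2) by (intro pmult_commute_odd) (simp add: int_sign_def)
    with False show ?thesis by (simp add: pmult_assoc[symmetric])
  qed
  with assms(1) show ?thesis
    by (auto simp: pder_def left_mult_def pmult_add_right pmult_assoc)
qed

lemma form_derivation_sum:
  assumes "form_derivation k \<Theta>" "\<And>i. i \<in> A \<Longrightarrow> f i \<in> \<Omega>"
  shows "\<Theta> (\<Sum>i\<in>A. f i) = (\<Sum>i\<in>A. \<Theta> (f i))"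
  using assms(2)
proof (induction A rule: infinite_finite_induct)
  case (insert i A)
  have "(\<Sum>i\<in>A. f i) \<in> \<Omega>" using insert.prems by (intro form_sum) auto
  with insert show ?case by (simp add: form_derivationD(2)[OF assms(1)])
qed (simp_all add: form_derivationD(7)[OF assms(1)])

lemma pder_der_op:
  assumes \<Theta>: "form_derivation k \<Theta>"
  shows "pder k (der_op M \<Theta>)"
  unfolding pder_def
proof (intro ballI, rule ext, rule ext)
  fix a b n e assume a: "a \<in> \<P>" and b: "b \<in> \<P>"
  have q: "\<Theta> (qmult (a i) (b j) e) = (qmult (\<lambda>e. \<Theta> (a i e)) (b j) +
      qmult ((if even k then a else psign a) i) (\<lambda>e. \<Theta> (b j e))) e" for i j
    using a b
    by (cases e) (auto simp: qfun_apply form_derivationD[OF \<Theta>] form_wedge form_parity_sign psign_def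
        parity_sign_linear wedge_linear int_sign_def)
  have "der_op M \<Theta> (pmult a b) n e = (\<Sum>i\<le>n. \<Theta> (qmult (a i) (b (n - i)) e))"
    using a b by (simp add: der_op_def pmult_conv_qmult sum_function_apply[where x = e]
        form_derivation_sum[OF \<Theta>] qmult_form)
  also have "\<dots> = (pmult (der_op M \<Theta> a) b + pmult (if even k then a else psign a) (der_op M \<Theta> b)) n e"
    using a b by (simp add: q der_op_def pmult_conv_qmult pfun_apply sum.distrib[symmetric]
        sum_function_apply[where x = e])
  finally show "der_op M \<Theta> (pmult a b) n e =
      (pmult (der_op M \<Theta> a) b + pmult (if even k then a else psign a) (der_op M \<Theta> b)) n e" .
qed

lemma pder_dq_op: "pder (-1) (dq_op M)"
  unfolding pder_def
proof (intro ballI, rule ext)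
  fix a b n assume a: "a \<in> \<P>" and b: "b \<in> \<P>"
  let ?D = "\<lambda>(u :: bool \<Rightarrow> 'm form) e. if e then 0 else parity_sign (u True)"
  have q: "?D (qmult u v) = qmult (?D u) v + qmult (qsign u) (?D v)" for u v
    by (rule bool_fun_eqI) (simp_all add: qfun_apply parity_sign_linear parity_sign_wedge wedge_linear)
  have D_sum: "?D (\<Sum>i\<in>A. f i) = (\<Sum>i\<in>A. ?D (f i))" for A :: "nat set" and f
    by (rule additive.sum[where f = ?D])
      (auto simp: Modules.additive_def parity_sign_linear qfun_apply intro!: bool_fun_eqI)
  have "dq_op M (pmult a b) n = ?D (pmult a b n)"
    using a b by (simp add: dq_op_def)
  also have "\<dots> = (\<Sum>i\<le>n. ?D (qmult (a i) (b (n - i))))"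
    by (simp only: pmult_conv_qmult[of a b n] D_sum)
  also have "\<dots> = (\<Sum>i\<le>n. qmult (?D (a i)) (b (n - i)) + qmult (qsign (a i)) (?D (b (n - i))))"
    by (simp only: q)
  also have "\<dots> = (pmult (dq_op M a) b + pmult (if even (- 1 :: int) then a else psign a) (dq_op M b)) n"
    using a b by (simp add: pmult_conv_qmult dq_op_def psign_def pfun_apply sum.distrib)
  finally show "dq_op M (pmult a b) n = (pmult (dq_op M a) b +
      pmult (if even (- 1 :: int) then a else psign a) (dq_op M b)) n" .
qed

lemma dt_op_apply: "a \<in> \<P> \<Longrightarrow> dt_op M a n = real (Suc n) *\<^sub>R a (Suc n)"
  by (rule ext) (simp add: dt_op_def qfun_apply)

lemma pder_dt_op: "pder (-2) (dt_op M)"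
  unfolding pder_def
proof (intro ballI, rule ext)
  fix a b n assume a: "a \<in> \<P>" and b: "b \<in> \<P>"
  let ?t = "\<lambda>i. qmult (a i) (b (Suc n - i))"
  have "dt_op M (pmult a b) n = (\<Sum>i\<le>Suc n. real (Suc n) *\<^sub>R ?t i)"
    using a b by (simp only: dt_op_apply pfuns_pmult pmult_conv_qmult scaleR_sum_right)
  \<comment> \<open>The exponent n + 1 is distributed as i + (n + 1 - i) over the two factors. The
    terms i = 0 and i = n + 1 drop out of the respective sums, which are then shifted to the range
    up to n.\<close>
  also have "\<dots> = (\<Sum>i\<le>Suc n. real i *\<^sub>R ?t i + real (Suc n - i) *\<^sub>R ?t i)"
    by (rule sum.cong[OF refl]) (simp add: scaleR_add_left[symmetric] of_nat_diff)
  also have "\<dots> = (\<Sum>i\<le>Suc n. real i *\<^sub>R ?t i) + (\<Sum>i\<le>Suc n. real (Suc n - i) *\<^sub>R ?t i)"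
    by (rule sum.distrib)
  also have "(\<Sum>i\<le>Suc n. real i *\<^sub>R ?t i) = (\<Sum>i\<le>n. real (Suc i) *\<^sub>R ?t (Suc i))"
    by (subst sum.atMost_Suc_shift) simp
  also have "(\<Sum>i\<le>Suc n. real (Suc n - i) *\<^sub>R ?t i) = (\<Sum>i\<le>n. real (Suc (n - i)) *\<^sub>R qmult (a i) (b (Suc (n - i))))"
    by (subst sum.atMost_Suc) (simp add: Suc_diff_le)
  also have "(\<Sum>i\<le>n. real (Suc i) *\<^sub>R ?t (Suc i)) +
      (\<Sum>i\<le>n. real (Suc (n - i)) *\<^sub>R qmult (a i) (b (Suc (n - i)))) =
      (pmult (dt_op M a) b + pmult a (dt_op M b)) n"
    using a b by (simp add: pmult_conv_qmult dt_op_apply pfun_apply qmult_scaleR_left qmult_scaleR_right)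
  finally show "dt_op M (pmult a b) n = (pmult (dt_op M a) b +
      pmult (if even (- 2 :: int) then a else psign a) (dt_op M b)) n" by simp
qed

text \<open>The bridge between components and operators: it reduces the Leibniz rule to the three
  basic derivations, and it identifies \<open>sym0\<close>, \<open>sym1\<close> and
  \<open>Q_P\<close> as instances of \<open>gen\<close>.\<close>

lemma gen_decomp:
  "gen M \<Theta> \<alpha> \<beta> \<gamma> = der_op M \<Theta> + left_mult (pform \<alpha>) (dq_op M) + left_mult (pconst \<beta> \<gamma>) (dt_op M)"
proof
  fix a
  show "gen M \<Theta> \<alpha> \<beta> \<gamma> a = (der_op M \<Theta> + left_mult (pform \<alpha>) (dq_op M) +
      left_mult (pconst \<beta> \<gamma>) (dt_op M)) a"
  proof (cases "a \<in> \<P>")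
    case True
    then show ?thesis
      by (intro pfun_eqI) (simp_all add: gen_apply pop_apply coeff_apply der_op_def left_mult_def
          pform_pconst pmult_pconst dt_op_apply dq_op_def parity_sign_linear wedge_linear scaleR_add_right)
  next
    case False
    then show ?thesis
      by (simp add: gen_outside pop_apply der_op_def left_mult_def dq_op_def dt_op_def)
  qed
qed

lemma psign_pconst:
  assumes "form_deg p \<beta>" "form_deg (p - 1) \<gamma>"
  shows "psign (pconst \<beta> \<gamma>) = int_sign p *\<^sub>R pconst \<beta> \<gamma>"
  using form_deg_parity_sign[OF assms(1)] form_deg_parity_sign[OF assms(2)]
  by (intro pfun_eqI) (auto simp: psign_def coeff_apply pconst_def int_sign_def)

lemma gen_pder:
  assumes g: "gen_data k \<Theta> \<alpha> \<beta> \<gamma>"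
  shows "pder k (gen M \<Theta> \<alpha> \<beta> \<gamma>)"
proof -
  have \<Theta>: "form_derivation k \<Theta>" and d: "form_deg (k + 1) \<alpha>" "form_deg (k + 2) \<beta>" "form_deg (k + 1) \<gamma>"
    using g by (auto simp: gen_data_def)
  have "pder (k + 1 + -1) (left_mult (pform \<alpha>) (dq_op M))"
    unfolding pform_pconst
    by (rule pder_left_mult[OF pder_dq_op psign_pconst]) (use d in \<open>simp_all add: add.commute\<close>)
  moreover have "pder (k + 2 + -2) (left_mult (pconst \<beta> \<gamma>) (dt_op M))"
    by (rule pder_left_mult[OF pder_dt_op psign_pconst]) (use d in \<open>simp_all add: add.commute\<close>)
  ultimately show ?thesis
    unfolding gen_decomp using pder_der_op[OF \<Theta>] by (intro pder_add) auto
qed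

lemma gen_graded_derivation:
  assumes g: "gen_data k \<Theta> \<alpha> \<beta> \<gamma>"
  shows "gen M \<Theta> \<alpha> \<beta> \<gamma> \<in> graded_derivations M k"
proof -
  have "gen M \<Theta> \<alpha> \<beta> \<gamma> (pmult a b) = pmult (gen M \<Theta> \<alpha> \<beta> \<gamma> a) b +
      int_sign (k * j) *\<^sub>R pmult a (gen M \<Theta> \<alpha> \<beta> \<gamma> b)" if "a \<in> pfuns_deg M j" "b \<in> \<P>" for j a b
    using gen_pder[OF g] psign_deg[OF that(1)] that
      pmult_scaleR_left[of "-1" a]
    by (auto simp: pder_def pfuns_deg_iff int_sign_def)
  then show ?thesis
    using gen_outside gen_add[OF g] gen_scaleR[OF g] gen_pfuns_deg[OF g]
    by (auto simp: graded_derivations_def)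
qed

lemma gen_zero:
  assumes "gen_data k \<Theta> \<alpha> \<beta> \<gamma>" shows "gen M \<Theta> \<alpha> \<beta> \<gamma> 0 = 0"
  using gen_scaleR[OF assms pfuns_zero, of 0] by simp

text \<open>Only the parities of the degrees matter; in each of the four cases the mixed terms cancel
  by graded commutativity.\<close>

lemma gen_commutator:
  assumes g: "gen_data k \<Theta> \<alpha> \<beta> \<gamma>" and g': "gen_data l \<Theta>' \<alpha>' \<beta>' \<gamma>'"
  defines "s \<equiv> int_sign (k * l)"
  shows "graded_commutator k l (gen M \<Theta> \<alpha> \<beta> \<gamma>) (gen M \<Theta>' \<alpha>' \<beta>' \<gamma>') =
    gen M (\<lambda>\<omega>. \<Theta> (\<Theta>' \<omega>) - s *\<^sub>R \<Theta>' (\<Theta> \<omega>)) (\<Theta> \<alpha>' - s *\<^sub>R \<Theta>' \<alpha>)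
      (\<Theta> \<beta>' - s *\<^sub>R \<Theta>' \<beta> + wedge \<alpha> (parity_sign \<gamma>') - s *\<^sub>R wedge \<alpha>' (parity_sign \<gamma>))
      (\<Theta> \<gamma>' - s *\<^sub>R \<Theta>' \<gamma>)"
proof
  fix a
  have \<Theta>: "form_derivation k \<Theta>" and d: "form_deg (k + 1) \<alpha>" "form_deg (k + 2) \<beta>" "form_deg (k + 1) \<gamma>"
    and f [simp]: "\<alpha> \<in> \<Omega>" "\<beta> \<in> \<Omega>" "\<gamma> \<in> \<Omega>"
    using g by (auto simp: gen_data_def)
  have \<Theta>': "form_derivation l \<Theta>'" and d': "form_deg (l + 1) \<alpha>'" "form_deg (l + 2) \<beta>'" "form_deg (l + 1) \<gamma>'"
    and f' [simp]: "\<alpha>' \<in> \<Omega>" "\<beta>' \<in> \<Omega>" "\<gamma>' \<in> \<Omega>"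
    using g' by (auto simp: gen_data_def)
  note [simp] = form_derivationD[OF \<Theta>] form_derivationD[OF \<Theta>'] gen_closed[OF g] gen_closed[OF g']
    form_wedge form_add form_scaleR form_parity_sign
  note par = form_deg_parity_sign[OF d(1)] form_deg_parity_sign[OF d(2)] form_deg_parity_sign[OF d(3)]
    form_deg_parity_sign[OF d'(1)] form_deg_parity_sign[OF d'(2)] form_deg_parity_sign[OF d'(3)]
  \<comment> \<open>For each mixed pair of coefficients one order is fixed, so the rules can be used
    as rewriting rules. The pairs \<open>\<alpha>\<close>, \<open>\<alpha>'\<close> and
    \<open>\<gamma>\<close>, \<open>\<gamma>'\<close> are absent because the q-derivative and
    multiplication by \<open>q\<close> square to zero.\<close>
  note swap = wedge_swap_deg[OF d'(2) d(1)] wedge_swap_deg[OF d'(1) d(2)] wedge_swap_deg[OF d'(2) d(2)]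
    wedge_swap_deg[OF d(3) d'(1)] wedge_swap_deg[OF d'(3) d(1)] wedge_swap_deg[OF d'(3) d(2)]
    wedge_swap_deg[OF d'(2) d(3)]
  show "graded_commutator k l (gen M \<Theta> \<alpha> \<beta> \<gamma>) (gen M \<Theta>' \<alpha>' \<beta>' \<gamma>') a =
    gen M (\<lambda>\<omega>. \<Theta> (\<Theta>' \<omega>) - s *\<^sub>R \<Theta>' (\<Theta> \<omega>)) (\<Theta> \<alpha>' - s *\<^sub>R \<Theta>' \<alpha>)
      (\<Theta> \<beta>' - s *\<^sub>R \<Theta>' \<beta> + wedge \<alpha> (parity_sign \<gamma>') - s *\<^sub>R wedge \<alpha>' (parity_sign \<gamma>))
      (\<Theta> \<gamma>' - s *\<^sub>R \<Theta>' \<gamma>) a"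
  proof (cases "a \<in> \<P>")
    case False
    then show ?thesis
      by (simp add: graded_commutator_def gen_outside gen_zero[OF g] gen_zero[OF g'])
  next
    case a [simp]: True
    have comm: "graded_commutator k l D E a n e = D (E a) n e - s *\<^sub>R E (D a) n e" for D E :: "'m pop" and n e
      unfolding graded_commutator_def s_def
      by (simp add: minus_apply[where x = n] minus_apply[where x = e] coeff_apply)
    show ?thesis
    proof (intro pfun_eqI)
      fix n
      show "graded_commutator k l (gen M \<Theta> \<alpha> \<beta> \<gamma>) (gen M \<Theta>' \<alpha>' \<beta>' \<gamma>') a n True =
        gen M (\<lambda>\<omega>. \<Theta> (\<Theta>' \<omega>) - s *\<^sub>R \<Theta>' (\<Theta> \<omega>)) (\<Theta> \<alpha>' - s *\<^sub>R \<Theta>' \<alpha>)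
        (\<Theta> \<beta>' - s *\<^sub>R \<Theta>' \<beta> + wedge \<alpha> (parity_sign \<gamma>') - s *\<^sub>R wedge \<alpha>' (parity_sign \<gamma>))
        (\<Theta> \<gamma>' - s *\<^sub>R \<Theta>' \<gamma>) a n True"
        unfolding comm
        by (cases "even k"; cases "even l")
          (simp_all add: gen_apply s_def int_sign_def par parity_sign_linear parity_sign_wedge
            wedge_linear wedge_assoc swap algebra_simps)
      show "graded_commutator k l (gen M \<Theta> \<alpha> \<beta> \<gamma>) (gen M \<Theta>' \<alpha>' \<beta>' \<gamma>') a n False =
        gen M (\<lambda>\<omega>. \<Theta> (\<Theta>' \<omega>) - s *\<^sub>R \<Theta>' (\<Theta> \<omega>)) (\<Theta> \<alpha>' - s *\<^sub>R \<Theta>' \<alpha>)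
        (\<Theta> \<beta>' - s *\<^sub>R \<Theta>' \<beta> + wedge \<alpha> (parity_sign \<gamma>') - s *\<^sub>R wedge \<alpha>' (parity_sign \<gamma>))
        (\<Theta> \<gamma>' - s *\<^sub>R \<Theta>' \<gamma>) a n False"
        unfolding comm
        by (cases "even k"; cases "even l")
          (simp_all add: gen_apply s_def int_sign_def par parity_sign_linear parity_sign_wedge
            wedge_linear wedge_assoc swap algebra_simps)
    qed
  qed
qed

text \<open>Cartan's formulas hold on forms only, and these are the only arguments that
  \<open>gen\<close> passes to its derivation. Through this lemma identities of operators on forms
  become equalities of derivations.\<close>

lemma gen_cong:
  assumes "\<And>\<omega>. \<omega> \<in> \<Omega> \<Longrightarrow> \<Theta> \<omega> = \<Theta>' \<omega>"
  shows "gen M \<Theta> \<alpha> \<beta> \<gamma> = gen M \<Theta>' \<alpha> \<beta> \<gamma>"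
proof
  fix a show "gen M \<Theta> \<alpha> \<beta> \<gamma> a = gen M \<Theta>' \<alpha> \<beta> \<gamma> a"
    using assms by (cases "a \<in> \<P>") (auto simp: gen_apply gen_outside intro!: pfun_eqI)
qed

lemma gen_zero_op: "gen M (\<lambda>_. 0) 0 0 0 = 0"
proof
  fix a show "gen M (\<lambda>_. 0) 0 0 0 a = 0 a"
    by (cases "a \<in> \<P>") (auto simp: gen_apply gen_outside pop_apply coeff_apply intro!: pfun_eqI)
qed

lemma gen_plus:
  "gen M \<Theta> \<alpha> \<beta> \<gamma> + gen M \<Theta>' \<alpha>' \<beta>' \<gamma>' =
    gen M (\<lambda>\<omega>. \<Theta> \<omega> + \<Theta>' \<omega>) (\<alpha> + \<alpha>') (\<beta> + \<beta>') (\<gamma> + \<gamma>')"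
proof
  fix a show "(gen M \<Theta> \<alpha> \<beta> \<gamma> + gen M \<Theta>' \<alpha>' \<beta>' \<gamma>') a =
    gen M (\<lambda>\<omega>. \<Theta> \<omega> + \<Theta>' \<omega>) (\<alpha> + \<alpha>') (\<beta> + \<beta>') (\<gamma> + \<gamma>') a"
    by (cases "a \<in> \<P>") (auto simp: gen_apply gen_outside pop_apply coeff_apply wedge_linear
        scaleR_add_right intro!: pfun_eqI)
qed

lemma gen_scale:
  "r *\<^sub>R gen M \<Theta> \<alpha> \<beta> \<gamma> = gen M (\<lambda>\<omega>. r *\<^sub>R \<Theta> \<omega>) (r *\<^sub>R \<alpha>) (r *\<^sub>R \<beta>) (r *\<^sub>R \<gamma>)"
proof
  fix a show "(r *\<^sub>R gen M \<Theta> \<alpha> \<beta> \<gamma>) a =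
    gen M (\<lambda>\<omega>. r *\<^sub>R \<Theta> \<omega>) (r *\<^sub>R \<alpha>) (r *\<^sub>R \<beta>) (r *\<^sub>R \<gamma>) a"
    by (cases "a \<in> \<P>") (auto simp: gen_apply gen_outside pop_apply coeff_apply wedge_linear
        scaleR_add_right mult.commute intro!: pfun_eqI)
qed

lemma form0_add: "form0 f + form0 g = form0 (f + g)"
  and form0_diff: "form0 f - form0 g = form0 (f - g)"
  and form0_scaleR: "r *\<^sub>R form0 f = form0 (r *\<^sub>R f)"
  and form0_zero [simp]: "form0 0 = 0"
  by (auto simp: form0_def fun_eq_iff fun_apply)

lemma form0_eq_iff: "form0 f = form0 g \<longleftrightarrow> f = g"
  by (metis form0_def)

lemma form_deg_0: "form_deg 0 \<omega> \<Longrightarrow> form0 (\<omega> []) = \<omega>"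
  by (rule ext) (auto simp: form0_def form_degD)

lemma form0_Nil [simp]: "form0 f [] = f"
  by (simp add: form0_def)

lemma pconst_apply:
  "pconst \<beta> \<gamma> n True = (if n = 0 then \<gamma> else 0)" "pconst \<beta> \<gamma> n False = (if n = 0 then \<beta> else 0)"
  by (simp_all add: pconst_def)

lemma q_var_apply:
  "q_var M n True = (if n = 0 then form0 (unit_function M) else 0)" "q_var M n False = 0"
  by (simp_all add: q_var_def)

lemma pform_apply: "pform \<omega> n True = 0" "pform \<omega> n False = (if n = 0 then \<omega> else 0)"
  by (simp_all add: pform_def)

text \<open>Translates from \<open>q\<close> on the left of a coefficient to the convention of
  \<open>gen\<close>. The sign is trivial in both uses, for a function and for the 2-form F.\<close>

lemma q_mult_pform: "\<omega> \<in> \<Omega> \<Longrightarrow> pmult (q_var M) (pform \<omega>) = pconst 0 (parity_sign \<omega>)"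
proof -
  assume \<omega>: "\<omega> \<in> \<Omega>"
  have q: "q_var M = pconst 0 (form0 (unit_function M))"
    by (auto simp: q_var_def pconst_def fun_eq_iff)
  show ?thesis
    unfolding q using \<omega>
    by (intro pfun_eqI) (simp_all add: pmult_pconst pform_pconst pconst_apply form_parity_sign)
qed

lemma der_op_zero: "der_op M (\<lambda>_. 0) = 0"
proof
  fix a show "der_op M (\<lambda>_. 0) a = 0 a"
    by (intro pfun_eqI) (simp_all add: der_op_def pop_apply coeff_apply)
qed

lemma left_mult_zero: "left_mult 0 D = 0"
  by (rule ext) (simp add: left_mult_def pop_apply)

lemma pform_zero: "pform 0 = 0"
  by (intro pfun_eqI) (simp_all add: pform_def coeff_apply)

lemma contraction_vf_zero [simp]: "\<omega> \<in> \<Omega> \<Longrightarrow> contraction 0 \<omega> = 0"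
  using contraction_form_add[of \<omega> 0 0] by simp

text \<open>Forms are linear over smooth functions, and the real scalar \<open>r\<close> acts on
  vector fields as the function \<open>r\<close> times the unit of the algebra.\<close>

lemma contraction_form_scaleR:
  assumes "\<omega> \<in> \<Omega>" "X \<in> VF"
  shows "contraction (r *\<^sub>R X) \<omega> = r *\<^sub>R contraction X \<omega>"
proof -
  have u: "(r *\<^sub>R unit_function M) * f = r *\<^sub>R f" if "f \<in> CM" for f
    using that by (simp add: scaleR_mult_fun)
  have "r *\<^sub>R X = (\<lambda>g. (r *\<^sub>R unit_function M) * X g)"
    using assms(2) by (intro ext) (simp add: u scaleR_fun_apply[where f = X])
  then have "contraction (r *\<^sub>R X) \<omega> = fmult (r *\<^sub>R unit_function M) (contraction X \<omega>)"
    using contraction_form_fmult[OF assms, of "r *\<^sub>R unit_function M"] smooth_unit by (auto simp: smooth_scaleR)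
  also have "\<dots> = r *\<^sub>R contraction X \<omega>"
    using assms by (intro ext) (simp add: fmult_def u form_apply)
  finally show ?thesis .
qed

lemma lie_deriv_vf_zero [simp]: "\<omega> \<in> \<Omega> \<Longrightarrow> \<L> 0 \<omega> = 0"
  using lie_deriv_vf_add[of 0 0 \<omega>] by simp

lemma lie_bracket_zero [simp]:
  "X \<in> VF \<Longrightarrow> lie_bracket X 0 = 0" "X \<in> VF \<Longrightarrow> lie_bracket 0 X = 0"
  by (intro ext; simp add: lie_bracket_apply zero_fun_apply[where x = "_ :: _ \<Rightarrow> _"])+

section \<open>Derived symmetries and their coefficients\<close>

lemma sym0_gen:
  "sym0 M X f f' C = gen M (contraction X) (form0 f) C (form0 f')" if "f' \<in> CM"
  unfolding gen_decomp sym0_def iota_op_def der_op_def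
  using that by (simp add: q_mult_pform form_form0) (simp add: pform_pconst pconst_add)

lemma sym1_gen: "sym1 M h = gen M (\<lambda>_. 0) 0 (form0 h) 0"
  unfolding gen_decomp sym1_def der_op_zero pform_zero left_mult_zero
  by (simp add: pform_pconst)

lemma gen_data_sym0:
  "f \<in> CM \<Longrightarrow> f' \<in> CM \<Longrightarrow> C \<in> kforms M 1 \<Longrightarrow>
    gen_data (-1) (contraction X) (form0 f) C (form0 f')"
  by (auto simp: gen_data_def kforms_form_deg form_derivation_contraction form_form0)

lemma gen_data_sym1: "h \<in> CM \<Longrightarrow> gen_data (-2) (\<lambda>_. 0) 0 (form0 h) 0"
  by (auto simp: gen_data_def form_derivation_zero form_form0)

definition t_var :: "'m pfun" where
  "t_var = (\<lambda>n e. if n = 1 \<and> \<not> e then form0 (unit_function M) else 0)"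

lemma t_var_pfun: "t_var \<in> \<P>"
  by (rule pfunsI[where N = 2]) (auto simp: t_var_def form_form0 smooth_unit)

lemma t_var_apply:
  "t_var n True = 0" "t_var n False = (if n = 1 then form0 (unit_function M) else 0)"
  by (simp_all add: t_var_def)

lemma q_var_pfun: "q_var M \<in> \<P>"
  by (rule pfunsI[where N = 1]) (auto simp: q_var_def form_form0 smooth_unit)

lemma pform_pfun: "\<omega> \<in> \<Omega> \<Longrightarrow> pform \<omega> \<in> \<P>"
  by (rule pfunsI[where N = 1]) (auto simp: pform_def)

text \<open>The coefficients are read off from test elements: \<open>q\<close> detects
  \<open>\<alpha>\<close>, \<open>t\<close> detects \<open>\<beta>\<close> and
  \<open>\<gamma>\<close>, and forms without \<open>q\<close> and \<open>t\<close> detect the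
  derivation. Since the derivation kills 0, it does not disturb the first two tests.\<close>

lemma gen_coefficients:
  assumes "gen M \<Theta> \<alpha> \<beta> \<gamma> = gen M \<Theta>' \<alpha>' \<beta>' \<gamma>'"
    and "\<Theta> 0 = 0" "\<Theta>' 0 = 0" "\<alpha> \<in> \<Omega>" "\<alpha>' \<in> \<Omega>" "\<beta> \<in> \<Omega>" "\<beta>' \<in> \<Omega>" "\<gamma> \<in> \<Omega>" "\<gamma>' \<in> \<Omega>"
  shows "\<alpha> = \<alpha>'" "\<beta> = \<beta>'" "\<gamma> = \<gamma>'" "\<And>\<omega>. \<omega> \<in> \<Omega> \<Longrightarrow> \<Theta> \<omega> = \<Theta>' \<omega>"
proof -
  have ap: "gen M \<Theta> \<alpha> \<beta> \<gamma> a n e = gen M \<Theta>' \<alpha>' \<beta>' \<gamma>' a n e" for a n e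
    using assms(1) by simp
  show "\<alpha> = \<alpha>'"
    using ap[of "q_var M" 0 False] assms(2-) by (simp add: gen_apply q_var_pfun q_var_apply)
  show "\<beta> = \<beta>'"
    using ap[of t_var 0 False] assms(2-) by (simp add: gen_apply t_var_pfun t_var_apply)
  show "\<gamma> = \<gamma>'"
    using ap[of t_var 0 True] assms(2-) by (simp add: gen_apply t_var_pfun t_var_apply)
  show "\<Theta> \<omega> = \<Theta>' \<omega>" if "\<omega> \<in> \<Omega>" for \<omega>
    using ap[of "pform \<omega>" 0 False] that by (simp add: gen_apply pform_pfun pform_apply)
qed

lemma sym0_unique:
  assumes "sym0 M X f f' C = sym0 M Y g g' D"
    and "X \<in> VF" "Y \<in> VF" "f \<in> CM" "f' \<in> CM" "g \<in> CM" "g' \<in> CM" "C \<in> kforms M 1" "D \<in> kforms M 1"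
  shows "X = Y \<and> f = g \<and> f' = g' \<and> C = D"
proof -
  have *: "gen M (contraction X) (form0 f) C (form0 f') = gen M (contraction Y) (form0 g) D (form0 g')"
    using assms by (simp add: sym0_gen)
  have forms: "form0 f \<in> \<Omega>" "form0 f' \<in> \<Omega>" "form0 g \<in> \<Omega>" "form0 g' \<in> \<Omega>" "C \<in> \<Omega>" "D \<in> \<Omega>"
    using assms by (auto simp: form_form0 kforms_form_deg)
  note c = gen_coefficients[OF * contraction_zero contraction_zero forms(1,3,5,6,2,4)]
  have "X h = Y h" for h
  proof (cases "h \<in> CM")
    case True
    \<comment> \<open>Contraction with an exact one-form dh recovers the action of the vector field
      on h.\<close>
    then have "contraction X (\<d> (form0 h)) [] = contraction Y (\<d> (form0 h)) []"
      by (simp add: c(4) form_form0)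
    then show ?thesis
      using True assms(2,3) by (simp add: contraction_ext_deriv_form0)
  qed (simp add: vf_nonsmooth assms)
  with c show ?thesis by (auto simp: form0_eq_iff)
qed

lemma sym1_unique: "sym1 M h = sym1 M k \<Longrightarrow> h \<in> CM \<Longrightarrow> k \<in> CM \<Longrightarrow> h = k"
  unfolding sym1_gen using gen_coefficients(2)[of "\<lambda>_. 0" 0 "form0 h" 0 "\<lambda>_. 0" 0 "form0 k" 0]
  by (simp add: form_form0 form0_eq_iff)

lemma sym0_add:
  assumes "X \<in> VF" "Y \<in> VF" "f' \<in> CM" "g' \<in> CM"
  shows "sym0 M X f f' C + sym0 M Y g g' D = sym0 M (X + Y) (f + g) (f' + g') (C + D)"
  using assms
  by (simp add: sym0_gen smooth_add gen_plus form0_add)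
    (rule gen_cong, simp add: contraction_form_add)

lemma sym0_scaleR:
  assumes "X \<in> VF" "f' \<in> CM"
  shows "r *\<^sub>R sym0 M X f f' C = sym0 M (r *\<^sub>R X) (r *\<^sub>R f) (r *\<^sub>R f') (r *\<^sub>R C)"
  using assms
  by (simp add: sym0_gen smooth_scaleR gen_scale form0_scaleR)
    (rule gen_cong, simp add: contraction_form_scaleR)

lemma sym0_zero: "sym0 M 0 0 0 0 = 0"
proof -
  have "gen M (contraction 0) 0 0 0 = gen M (\<lambda>_. 0) 0 0 0" by (rule gen_cong) simp
  then show ?thesis by (simp add: sym0_gen gen_zero_op)
qed

lemma sym1_add: "sym1 M h + sym1 M k = sym1 M (h + k)"
  by (simp add: sym1_gen gen_plus form0_add)

lemma sym1_scaleR: "r *\<^sub>R sym1 M h = sym1 M (r *\<^sub>R h)"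
  by (simp add: sym1_gen gen_scale form0_scaleR)

lemma sym1_zero: "sym1 M 0 = 0"
  by (simp add: sym1_gen gen_zero_op)

text \<open>The identities for derived brackets below are formal in the composition of operators;
  linearity and closure are what their expansion uses, and the Leibniz rule does not enter.\<close>

definition lin_op :: "'m pop \<Rightarrow> bool" where
  "lin_op D \<longleftrightarrow> (\<forall>a. D a \<in> \<P>) \<and> (\<forall>a. a \<notin> \<P> \<longrightarrow> D a = 0) \<and>
     (\<forall>a\<in>\<P>. \<forall>b\<in>\<P>. D (a + b) = D a + D b) \<and> (\<forall>r. \<forall>a\<in>\<P>. D (r *\<^sub>R a) = r *\<^sub>R D a)"

lemma lin_op_gen: "gen_data k \<Theta> \<alpha> \<beta> \<gamma> \<Longrightarrow> lin_op (gen M \<Theta> \<alpha> \<beta> \<gamma>)"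
  by (simp add: lin_op_def gen_closed gen_outside gen_add gen_scaleR)

lemma lin_opD:
  assumes "lin_op D"
  shows "D a \<in> \<P>" "a \<in> \<P> \<Longrightarrow> b \<in> \<P> \<Longrightarrow> D (a + b) = D a + D b"
    "a \<in> \<P> \<Longrightarrow> D (r *\<^sub>R a) = r *\<^sub>R D a" "D 0 = 0" "a \<in> \<P> \<Longrightarrow> D (- a) = - D a"
    "a \<in> \<P> \<Longrightarrow> b \<in> \<P> \<Longrightarrow> D (a - b) = D a - D b"
proof -
  show *: "D a \<in> \<P>" "a \<in> \<P> \<Longrightarrow> b \<in> \<P> \<Longrightarrow> D (a + b) = D a + D b"
    "a \<in> \<P> \<Longrightarrow> D (r *\<^sub>R a) = r *\<^sub>R D a" for a b r
    using assms by (auto simp: lin_op_def)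
  show "D 0 = 0" using *(3)[of 0 0] by simp
  show neg: "a \<in> \<P> \<Longrightarrow> D (- a) = - D a" for a using *(3)[of a "-1"] by simp
  show "a \<in> \<P> \<Longrightarrow> b \<in> \<P> \<Longrightarrow> D (a - b) = D a - D b"
    using *(2)[of a "- b"] neg[of b] pfuns_diff[of 0 b] by simp
qed

lemma pfuns_uminus [simp]: "a \<in> \<P> \<Longrightarrow> - a \<in> \<P>"
  using pfuns_diff[of 0 a] by simp

text \<open>The graded Jacobi identity together with \<open>Q\<^sup>2 = 0\<close>.\<close>

lemma derived_bracket_leibniz:
  assumes "lin_op Q" "lin_op a" "lin_op b" "lin_op c" "\<And>x. Q (Q x) = 0"
  shows "derived_bracket Q i (j + k) a (derived_bracket Q j k b c) =
    derived_bracket Q (i + j) k (derived_bracket Q i j a b) c +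
    int_sign (i * j) *\<^sub>R derived_bracket Q j (i + k) b (derived_bracket Q i k a c)"
proof
  fix x
  note [simp] = lin_opD[OF assms(1)] lin_opD[OF assms(2)] lin_opD[OF assms(3)] lin_opD[OF assms(4)] assms(5)
  show "derived_bracket Q i (j + k) a (derived_bracket Q j k b c) x =
    (derived_bracket Q (i + j) k (derived_bracket Q i j a b) c +
    int_sign (i * j) *\<^sub>R derived_bracket Q j (i + k) b (derived_bracket Q i k a c)) x"
    by (cases "even i"; cases "even j"; cases "even k")
      (simp_all add: derived_bracket_def graded_commutator_def pop_apply
        int_sign_def algebra_simps)
qed

text \<open>The commutator with Q is a graded derivation of the commutator and annihilates [Q, a],
  so only the term with [Q, b] survives.\<close>

lemma derived_diff_bracket:
  assumes "lin_op Q" "lin_op a" "lin_op b" "\<And>x. Q (Q x) = 0"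
  shows "derived_diff Q (i + j) (derived_bracket Q i j a b) =
    int_sign i *\<^sub>R derived_bracket Q i (j + 1) a (derived_diff Q j b)"
proof
  fix x
  note [simp] = lin_opD[OF assms(1)] lin_opD[OF assms(2)] lin_opD[OF assms(3)] assms(4)
  show "derived_diff Q (i + j) (derived_bracket Q i j a b) x =
    (int_sign i *\<^sub>R derived_bracket Q i (j + 1) a (derived_diff Q j b)) x"
    by (cases "even i"; cases "even j")
      (simp_all add: derived_bracket_def derived_diff_def graded_commutator_def pop_apply
        int_sign_def algebra_simps)
qed

text \<open>From Q^2 = 0 one gets [Q, [Q, a]] = 0, so exact elements act trivially from the left.
  The bracket is not antisymmetric, and on the right they act nontrivially in general.\<close>

lemma derived_bracket_diff_left:
  assumes "lin_op Q" "lin_op a" "lin_op b" "\<And>x. Q (Q x) = 0"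
  shows "derived_bracket Q (i + 1) j (derived_diff Q i a) b = 0"
proof
  fix x
  note [simp] = lin_opD[OF assms(1)] lin_opD[OF assms(2)] lin_opD[OF assms(3)] assms(4)
  show "derived_bracket Q (i + 1) j (derived_diff Q i a) b x = 0 x"
    by (cases "even i"; cases "even j")
      (simp_all add: derived_bracket_def derived_diff_def graded_commutator_def pop_apply
        int_sign_def)
qed

lemma derived_bracket_add_right:
  assumes "lin_op Q" "lin_op a" "lin_op b" "lin_op c"
  shows "derived_bracket Q i j a (b + c) = derived_bracket Q i j a b + derived_bracket Q i j a c"
proof
  fix x
  note [simp] = lin_opD[OF assms(1)] lin_opD[OF assms(2)] lin_opD[OF assms(3)] lin_opD[OF assms(4)]
  show "derived_bracket Q i j a (b + c) x = (derived_bracket Q i j a b + derived_bracket Q i j a c) x"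
    by (simp add: derived_bracket_def graded_commutator_def pop_apply algebra_simps)
qed

lemma derived_bracket_add_left:
  assumes "lin_op Q" "lin_op a" "lin_op b" "lin_op c"
  shows "derived_bracket Q i j (a + b) c = derived_bracket Q i j a c + derived_bracket Q i j b c"
proof
  fix x
  note [simp] = lin_opD[OF assms(1)] lin_opD[OF assms(2)] lin_opD[OF assms(3)] lin_opD[OF assms(4)]
  show "derived_bracket Q i j (a + b) c x = (derived_bracket Q i j a c + derived_bracket Q i j b c) x"
    by (simp add: derived_bracket_def graded_commutator_def pop_apply algebra_simps)
qed

lemma derived_bracket_scaleR_right:
  assumes "lin_op Q" "lin_op a" "lin_op b"
  shows "derived_bracket Q i j a (r *\<^sub>R b) = r *\<^sub>R derived_bracket Q i j a b"
proof
  fix x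
  note [simp] = lin_opD[OF assms(1)] lin_opD[OF assms(2)] lin_opD[OF assms(3)]
  show "derived_bracket Q i j a (r *\<^sub>R b) x = (r *\<^sub>R derived_bracket Q i j a b) x"
    by (simp add: derived_bracket_def graded_commutator_def pop_apply algebra_simps)
qed

lemma derived_bracket_scaleR_left:
  assumes "lin_op Q" "lin_op a" "lin_op b"
  shows "derived_bracket Q i j (r *\<^sub>R a) b = r *\<^sub>R derived_bracket Q i j a b"
proof
  fix x
  note [simp] = lin_opD[OF assms(1)] lin_opD[OF assms(2)] lin_opD[OF assms(3)]
  show "derived_bracket Q i j (r *\<^sub>R a) b x = (r *\<^sub>R derived_bracket Q i j a b) x"
    by (simp add: derived_bracket_def graded_commutator_def pop_apply algebra_simps)
qed

lemma derived_diff_add: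
  assumes "lin_op Q" "lin_op a" "lin_op b"
  shows "derived_diff Q i (a + b) = derived_diff Q i a + derived_diff Q i b"
proof
  fix x
  note [simp] = lin_opD[OF assms(1)] lin_opD[OF assms(2)] lin_opD[OF assms(3)]
  show "derived_diff Q i (a + b) x = (derived_diff Q i a + derived_diff Q i b) x"
    by (simp add: derived_diff_def graded_commutator_def pop_apply algebra_simps)
qed

lemma derived_diff_scaleR:
  assumes "lin_op Q" "lin_op a"
  shows "derived_diff Q i (r *\<^sub>R a) = r *\<^sub>R derived_diff Q i a"
proof
  fix x
  note [simp] = lin_opD[OF assms(1)] lin_opD[OF assms(2)]
  show "derived_diff Q i (r *\<^sub>R a) x = (r *\<^sub>R derived_diff Q i a) x"
    by (simp add: derived_diff_def graded_commutator_def pop_apply algebra_simps)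
qed

lemma lin_op_zero: "lin_op 0"
  by (simp add: lin_op_def pop_apply)

end

section \<open>Transport of dg-Leibniz structures\<close>

lemma dg_leibnizD:
  assumes "dg_leibniz L"
  shows "subspace (dgl_comp L k)"
    and "k > 0 \<Longrightarrow> dgl_comp L k = {0}"
    and "lin_between (dgl_comp L k) (dgl_comp L (k + 1)) (dgl_diff L k)"
    and "a \<in> dgl_comp L k \<Longrightarrow> dgl_diff L (k + 1) (dgl_diff L k a) = 0"
    and "a \<in> dgl_comp L i \<Longrightarrow> lin_between (dgl_comp L j) (dgl_comp L (i + j)) (dgl_br L i j a)"
    and "b \<in> dgl_comp L j \<Longrightarrow> lin_between (dgl_comp L i) (dgl_comp L (i + j)) (\<lambda>a. dgl_br L i j a b)"
    and "j < 0 \<Longrightarrow> a \<in> dgl_comp L i \<Longrightarrow> b \<in> dgl_comp L j \<Longrightarrow>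
        dgl_diff L (i + j) (dgl_br L i j a b) =
          dgl_br L (i + 1) j (dgl_diff L i a) b +
          int_sign i *\<^sub>R dgl_br L i (j + 1) a (dgl_diff L j b)"
    and "a \<in> dgl_comp L i \<Longrightarrow> b \<in> dgl_comp L j \<Longrightarrow> c \<in> dgl_comp L k \<Longrightarrow>
        dgl_br L i (j + k) a (dgl_br L j k b c) =
          dgl_br L (i + j) k (dgl_br L i j a b) c +
          int_sign (i * j) *\<^sub>R dgl_br L j (i + k) b (dgl_br L i k a c)"
proof -
  note c1 = assms[unfolded dg_leibniz_def]
  note c2 = conjunct2[OF c1] note c3 = conjunct2[OF c2] note c4 = conjunct2[OF c3]
  note c5 = conjunct2[OF c4] note c6 = conjunct2[OF c5] note c7 = conjunct2[OF c6]
  show "subspace (dgl_comp L k)" using conjunct1[OF c1] by blast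
  show "k > 0 \<Longrightarrow> dgl_comp L k = {0}" using conjunct1[OF c2] by blast
  show "lin_between (dgl_comp L k) (dgl_comp L (k + 1)) (dgl_diff L k)"
    using conjunct1[OF c3] by blast
  show "a \<in> dgl_comp L k \<Longrightarrow> dgl_diff L (k + 1) (dgl_diff L k a) = 0"
    using conjunct1[OF c4] by blast
  show "a \<in> dgl_comp L i \<Longrightarrow> lin_between (dgl_comp L j) (dgl_comp L (i + j)) (dgl_br L i j a)"
    using conjunct1[OF c5] by blast
  show "b \<in> dgl_comp L j \<Longrightarrow> lin_between (dgl_comp L i) (dgl_comp L (i + j)) (\<lambda>a. dgl_br L i j a b)"
    using conjunct1[OF c6] by blast
  show "j < 0 \<Longrightarrow> a \<in> dgl_comp L i \<Longrightarrow> b \<in> dgl_comp L j \<Longrightarrow>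
        dgl_diff L (i + j) (dgl_br L i j a b) =
          dgl_br L (i + 1) j (dgl_diff L i a) b +
          int_sign i *\<^sub>R dgl_br L i (j + 1) a (dgl_diff L j b)"
    using conjunct1[OF c7] by blast
  show "a \<in> dgl_comp L i \<Longrightarrow> b \<in> dgl_comp L j \<Longrightarrow> c \<in> dgl_comp L k \<Longrightarrow>
        dgl_br L i (j + k) a (dgl_br L j k b c) =
          dgl_br L (i + j) k (dgl_br L i j a b) c +
          int_sign (i * j) *\<^sub>R dgl_br L j (i + k) b (dgl_br L i k a c)"
    using conjunct2[OF c7] by blast
qed

lemma lin_betweenD:
  assumes "lin_between V W f"
  shows "x \<in> V \<Longrightarrow> f x \<in> W" "x \<in> V \<Longrightarrow> y \<in> V \<Longrightarrow> f (x + y) = f x + f y"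
    "x \<in> V \<Longrightarrow> f (r *\<^sub>R x) = r *\<^sub>R f x"
  using assms unfolding lin_between_def by blast+

lemma lin_betweenI:
  assumes "\<And>x. x \<in> V \<Longrightarrow> f x \<in> W" "\<And>x y. x \<in> V \<Longrightarrow> y \<in> V \<Longrightarrow> f (x + y) = f x + f y"
    "\<And>r x. x \<in> V \<Longrightarrow> f (r *\<^sub>R x) = r *\<^sub>R f x"
  shows "lin_between V W f"
  using assms unfolding lin_between_def by blast

lemma lin_between_zero: "lin_between V W f \<Longrightarrow> 0 \<in> V \<Longrightarrow> f 0 = 0"
  using lin_betweenD(3)[of V W f 0 0] by simp

lemma dg_leibniz_isoD:
  assumes "dg_leibniz_iso L L' \<phi>"
  shows "dg_leibniz L" "dg_leibniz L'"
    "lin_between (dgl_comp L k) (dgl_comp L' k) (\<phi> k)"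
    "bij_betw (\<phi> k) (dgl_comp L k) (dgl_comp L' k)"
    "a \<in> dgl_comp L k \<Longrightarrow> \<phi> (k + 1) (dgl_diff L k a) = dgl_diff L' k (\<phi> k a)"
    "a \<in> dgl_comp L i \<Longrightarrow> b \<in> dgl_comp L j \<Longrightarrow>
      \<phi> (i + j) (dgl_br L i j a b) = dgl_br L' i j (\<phi> i a) (\<phi> j b)"
  using assms unfolding dg_leibniz_iso_def by blast+

text \<open>An automorphism commutes with the operations, so these preserve its fixed points; by
  linearity the fixed points form subspaces.\<close>

lemma dg_leibniz_sub_fixed_points:
  assumes iso: "dg_leibniz_iso L L \<phi>"
  shows "dg_leibniz_sub (fixed_points L \<phi>) L"
proof -
  have L: "dg_leibniz L" and lin: "lin_between (dgl_comp L k) (dgl_comp L k) (\<phi> k)" for k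
    using dg_leibniz_isoD[OF iso] by auto
  note LD = dg_leibnizD[OF L]
  note isoD = dg_leibniz_isoD(5,6)[OF iso]
  let ?S = "fixed_points L \<phi>"
  have comp: "dgl_comp ?S k = {a \<in> dgl_comp L k. \<phi> k a = a}" for k
    by (simp add: fixed_points_def)
  have ops [simp]: "dgl_diff ?S = dgl_diff L" "dgl_br ?S = dgl_br L"
    by (simp_all add: fixed_points_def)
  have zero: "0 \<in> dgl_comp L k" for k
    using LD(1) by (rule subspace_0)
  have diff: "dgl_diff L k a \<in> dgl_comp ?S (k + 1)" if "a \<in> dgl_comp ?S k" for k a
    using that lin_betweenD(1)[OF LD(3)] isoD(1)[of a k] by (simp add: comp)
  have br: "dgl_br L i j a b \<in> dgl_comp ?S (i + j)"
    if "a \<in> dgl_comp ?S i" "b \<in> dgl_comp ?S j" for i j a b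
    using that lin_betweenD(1)[OF LD(5)] isoD(2)[of a i b j] by (simp add: comp)
  have "dg_leibniz ?S"
    unfolding dg_leibniz_def ops
  proof (intro conjI allI impI ballI)
    show "subspace (dgl_comp ?S k)" for k
      using LD(1)[of k] lin_betweenD(2,3)[OF lin[of k]] lin_between_zero[OF lin[of k] zero]
      by (auto simp: comp subspace_def)
    show "dgl_comp ?S k = {0}" if "k > 0" for k
      using LD(2)[OF that] lin_between_zero[OF lin[of k] zero] by (auto simp: comp)
    show "lin_between (dgl_comp ?S k) (dgl_comp ?S (k + 1)) (dgl_diff L k)" for k
      using diff lin_betweenD(2,3)[OF LD(3)[of k]] by (intro lin_betweenI) (auto simp: comp)
    show "lin_between (dgl_comp ?S j) (dgl_comp ?S (i + j)) (dgl_br L i j a)"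
      if "a \<in> dgl_comp ?S i" for i j a
      using br[OF that] that lin_betweenD(2,3)[OF LD(5)[of a i j]]
      by (intro lin_betweenI) (auto simp: comp)
    show "lin_between (dgl_comp ?S i) (dgl_comp ?S (i + j)) (\<lambda>a. dgl_br L i j a b)"
      if "b \<in> dgl_comp ?S j" for i j b
      using br[OF _ that] that lin_betweenD(2,3)[OF LD(6)[of b j i]]
      by (intro lin_betweenI) (auto simp: comp)
  \<comment> \<open>What remains are equations between elements, which hold in the larger algebra
    already.\<close>
  qed ((rule LD(4) LD(7) LD(8); simp add: comp)+)
  then show ?thesis
    unfolding dg_leibniz_sub_def using L by (auto simp: comp)
qed

text \<open>Each identity holds in \<open>L'\<close> after applying \<open>\<phi>\<close>, and
  injectivity pulls it back. For \<open>L\<close> itself only closure has to be known, which spares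
  the expansion of the Leibniz identity for the B_n bracket.\<close>

lemma dg_leibniz_iso_transport:
  assumes L': "dg_leibniz L'"
    and sub: "\<And>k. subspace (dgl_comp L k)" and pos: "\<And>k. k > 0 \<Longrightarrow> dgl_comp L k = {0}"
    and diff: "\<And>k a. a \<in> dgl_comp L k \<Longrightarrow> dgl_diff L k a \<in> dgl_comp L (k + 1)"
    and br: "\<And>i j a b. a \<in> dgl_comp L i \<Longrightarrow> b \<in> dgl_comp L j \<Longrightarrow> dgl_br L i j a b \<in> dgl_comp L (i + j)"
    and lin: "\<And>k. lin_between (dgl_comp L k) (dgl_comp L' k) (\<phi> k)"
    and bij: "\<And>k. bij_betw (\<phi> k) (dgl_comp L k) (dgl_comp L' k)"
    and \<phi>diff: "\<And>k a. a \<in> dgl_comp L k \<Longrightarrow> \<phi> (k + 1) (dgl_diff L k a) = dgl_diff L' k (\<phi> k a)"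
    and \<phi>br: "\<And>i j a b. a \<in> dgl_comp L i \<Longrightarrow> b \<in> dgl_comp L j \<Longrightarrow>
      \<phi> (i + j) (dgl_br L i j a b) = dgl_br L' i j (\<phi> i a) (\<phi> j b)"
  shows "dg_leibniz_iso L L' \<phi>"
proof -
  note LD = dg_leibnizD[OF L']
  note [simp] = lin_betweenD[OF lin] diff br \<phi>diff \<phi>br
  note [simp] = subspace_add[OF sub] subspace_scale[OF sub]
  have zero [simp]: "0 \<in> dgl_comp L k" for k using sub by (rule subspace_0)
  have inj: "x = y" if "\<phi> k x = \<phi> k y" "x \<in> dgl_comp L k" "y \<in> dgl_comp L k" for x y k
    using bij[of k] that by (auto simp: bij_betw_def inj_on_def)
  have "dg_leibniz L"
    unfolding dg_leibniz_def
  proof (intro conjI allI impI ballI)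
    show "lin_between (dgl_comp L k) (dgl_comp L (k + 1)) (dgl_diff L k)" for k
      by (rule lin_betweenI; (rule inj[where k = "k + 1"])?)
        (simp_all add: lin_betweenD[OF LD(3)])
    show "dgl_diff L (k + 1) (dgl_diff L k a) = 0" if "a \<in> dgl_comp L k" for k a
    proof (rule inj[where k = "k + 1 + 1"])
      show "\<phi> (k + 1 + 1) (dgl_diff L (k + 1) (dgl_diff L k a)) = \<phi> (k + 1 + 1) 0"
        using that LD(4)[of "\<phi> k a" k] lin_between_zero[OF lin zero, of "k + 1 + 1"]
        by (simp only: \<phi>diff diff lin_betweenD[OF lin])
      show "dgl_diff L (k + 1) (dgl_diff L k a) \<in> dgl_comp L (k + 1 + 1)"
        using that by (intro diff)
    qed simp
    show "lin_between (dgl_comp L j) (dgl_comp L (i + j)) (dgl_br L i j a)"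
      if "a \<in> dgl_comp L i" for i j a
      by (rule lin_betweenI; (rule inj[where k = "i + j"])?)
        (use that in \<open>simp_all add: lin_betweenD[OF LD(5)]\<close>)
    show "lin_between (dgl_comp L i) (dgl_comp L (i + j)) (\<lambda>a. dgl_br L i j a b)"
      if "b \<in> dgl_comp L j" for i j b
      by (rule lin_betweenI; (rule inj[where k = "i + j"])?)
        (use that in \<open>simp_all add: lin_betweenD[OF LD(6)]\<close>)
    show "dgl_diff L (i + j) (dgl_br L i j a b) = dgl_br L (i + 1) j (dgl_diff L i a) b +
        int_sign i *\<^sub>R dgl_br L i (j + 1) a (dgl_diff L j b)"
      if "j < 0" "a \<in> dgl_comp L i" "b \<in> dgl_comp L j" for i j a b
    proof (rule inj[where k = "i + j + 1"])
      \<comment> \<open>The operations depend on degree parameters, so the two summands can be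
        compared under \<open>\<phi>\<close> only once these sums of integers have the same
        form.\<close>
      have e: "i + 1 + j = i + j + 1" "i + (j + 1) = i + j + 1" by simp_all
      have m: "dgl_br L (i + 1) j (dgl_diff L i a) b \<in> dgl_comp L (i + j + 1)"
        "dgl_br L i (j + 1) a (dgl_diff L j b) \<in> dgl_comp L (i + j + 1)"
        using br[of "dgl_diff L i a" "i + 1" b j] br[of a i "dgl_diff L j b" "j + 1"] that diff
        unfolding e by blast+
      then show "dgl_br L (i + 1) j (dgl_diff L i a) b +
        int_sign i *\<^sub>R dgl_br L i (j + 1) a (dgl_diff L j b) \<in> dgl_comp L (i + j + 1)"
        by simp
      have "\<phi> (i + j + 1) (dgl_br L (i + 1) j (dgl_diff L i a) b) =
          dgl_br L' (i + 1) j (dgl_diff L' i (\<phi> i a)) (\<phi> j b)"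
        "\<phi> (i + j + 1) (dgl_br L i (j + 1) a (dgl_diff L j b)) =
          dgl_br L' i (j + 1) (\<phi> i a) (dgl_diff L' j (\<phi> j b))"
        using \<phi>br[of "dgl_diff L i a" "i + 1" b j] \<phi>br[of a i "dgl_diff L j b" "j + 1"] that
        unfolding e by simp_all
      then show "\<phi> (i + j + 1) (dgl_diff L (i + j) (dgl_br L i j a b)) =
        \<phi> (i + j + 1) (dgl_br L (i + 1) j (dgl_diff L i a) b +
        int_sign i *\<^sub>R dgl_br L i (j + 1) a (dgl_diff L j b))"
        using that m LD(7)[of j "\<phi> i a" i "\<phi> j b"] by simp
    qed (use that in simp)
    show "dgl_br L i (j + k) a (dgl_br L j k b c) = dgl_br L (i + j) k (dgl_br L i j a b) c +
        int_sign (i * j) *\<^sub>R dgl_br L j (i + k) b (dgl_br L i k a c)"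
      if "a \<in> dgl_comp L i" "b \<in> dgl_comp L j" "c \<in> dgl_comp L k" for i j k a b c
    proof (rule inj[where k = "i + (j + k)"])
      have e: "i + j + k = i + (j + k)" "j + (i + k) = i + (j + k)" by simp_all
      have m: "dgl_br L (i + j) k (dgl_br L i j a b) c \<in> dgl_comp L (i + (j + k))"
        "dgl_br L j (i + k) b (dgl_br L i k a c) \<in> dgl_comp L (i + (j + k))"
        using br[of "dgl_br L i j a b" "i + j" c k] br[of b j "dgl_br L i k a c" "i + k"] that br
        unfolding e by blast+
      then show "dgl_br L (i + j) k (dgl_br L i j a b) c +
        int_sign (i * j) *\<^sub>R dgl_br L j (i + k) b (dgl_br L i k a c) \<in> dgl_comp L (i + (j + k))"
        by simp
      have "\<phi> (i + (j + k)) (dgl_br L (i + j) k (dgl_br L i j a b) c) =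
          dgl_br L' (i + j) k (dgl_br L' i j (\<phi> i a) (\<phi> j b)) (\<phi> k c)"
        "\<phi> (i + (j + k)) (dgl_br L j (i + k) b (dgl_br L i k a c)) =
          dgl_br L' j (i + k) (\<phi> j b) (dgl_br L' i k (\<phi> i a) (\<phi> k c))"
        using \<phi>br[of "dgl_br L i j a b" "i + j" c k] \<phi>br[of b j "dgl_br L i k a c" "i + k"] that
        unfolding e by simp_all
      then show "\<phi> (i + (j + k)) (dgl_br L i (j + k) a (dgl_br L j k b c)) =
        \<phi> (i + (j + k)) (dgl_br L (i + j) k (dgl_br L i j a b) c +
        int_sign (i * j) *\<^sub>R dgl_br L j (i + k) b (dgl_br L i k a c))"
        using that m LD(8)[of "\<phi> i a" i "\<phi> j b" j "\<phi> k c" k] by simp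
    qed (use that in simp)
  qed (use sub pos in auto)
  then show ?thesis
    unfolding dg_leibniz_iso_def using L' lin bij \<phi>diff \<phi>br by blast
qed

section \<open>Derived symmetries of the self T-dual dg-manifold\<close>

locale twisted_mfd = smooth_mfd M for M :: "'m manifold" +
  fixes F H :: "'m form"
  assumes F_form: "F \<in> kforms M 2" and F_closed: "ext_deriv M F = 0"
    and H_form: "H \<in> kforms M 3" and H_twisted: "ext_deriv M H + wedge F F = 0"
begin

abbreviation \<Q> where "\<Q> \<equiv> Q_P M F H"

lemma FH_forms [simp]: "F \<in> \<Omega>" "H \<in> \<Omega>"
  using F_form H_form by (auto simp: kforms_form_deg)

lemma FH_deg: "form_deg 2 F" "form_deg 3 H"
  using F_form H_form by (auto simp: kforms_form_deg)

lemma parity_sign_F [simp]: "parity_sign F = F"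
  using form_deg_parity_sign[OF FH_deg(1)] by (simp add: int_sign_def)

lemma Q_gen: "\<Q> = gen M \<d> F H F"
  unfolding gen_decomp Q_P_def d_op_def der_op_def
  by (simp add: q_mult_pform) (simp add: pform_pconst pconst_add)

lemma gen_data_Q: "gen_data 1 \<d> F H F"
  using FH_deg by (simp add: gen_data_def form_derivation_ext_deriv)

lemma lin_op_Q: "lin_op \<Q>"
  unfolding Q_gen by (rule lin_op_gen[OF gen_data_Q])

text \<open>For an odd operator the commutator with itself is twice its square. By dF = 0 and d^2 =
  0 its only remaining coefficient is 2 (dH + F \<and> F), that of the t-derivative.\<close>

lemma Q_Q: "\<Q> (\<Q> a) = 0"
proof -
  have "graded_commutator 1 1 \<Q> \<Q> = gen M (\<lambda>\<omega>. \<d> (\<d> \<omega>) + \<d> (\<d> \<omega>)) 0 (2 *\<^sub>R (\<d> H + wedge F F)) 0"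
    unfolding Q_gen gen_commutator[OF gen_data_Q gen_data_Q]
    by (simp add: int_sign_def F_closed scaleR_2 algebra_simps)
  also have "\<dots> = gen M (\<lambda>_. 0) 0 0 0"
    unfolding H_twisted by (simp, rule gen_cong, simp add: ext_deriv_ext_deriv)
  finally have "graded_commutator 1 1 \<Q> \<Q> a = 0"
    by (simp add: gen_zero_op pop_apply)
  then have "2 *\<^sub>R \<Q> (\<Q> a) = 0"
    by (simp add: graded_commutator_def int_sign_def scaleR_2)
  then show ?thesis by simp
qed

lemma homological_Q: "homological M \<Q>"
  unfolding homological_def using gen_graded_derivation[OF gen_data_Q] Q_Q by (simp add: Q_gen[symmetric])

lemma kforms_zero [simp]: "0 \<in> kforms M k"
  by (simp add: kforms_form_deg)

lemma form_deg_ext_deriv_form0: "f \<in> CM \<Longrightarrow> form_deg 1 (\<d> (form0 f))"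
  using form_deg_ext_deriv[of "form0 f" 0] by (simp add: form_form0 form_deg_form0)

lemma kforms_ext_deriv_form0: "h \<in> CM \<Longrightarrow> \<d> (form0 h) \<in> kforms M 1"
  by (simp add: kforms_form_deg form_form0 form_deg_ext_deriv_form0)

lemma derived_diff_sym1:
  assumes h: "h \<in> CM"
  shows "derived_diff \<Q> (-1) (sym1 M h) = sym0 M 0 0 0 (\<d> (form0 h))"
proof -
  have "derived_diff \<Q> (-1) (sym1 M h) = gen M (\<lambda>_. 0) 0 (\<d> (form0 h)) 0"
    unfolding derived_diff_def Q_gen sym1_gen
    using gen_commutator[OF gen_data_Q gen_data_sym1[OF h]] by (simp add: int_sign_def)
  also have "\<dots> = gen M (contraction 0) 0 (\<d> (form0 h)) 0"
    by (rule gen_cong) simp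
  finally show ?thesis by (simp add: sym0_gen)
qed

text \<open>The degree 0 derivation [Q, a] for \<open>a = sym0 M X f f' C\<close>, through which
  \<open>a\<close> acts in the derived bracket. The summand with \<open>f'\<close> arises from the
  q-derivative in Q applied to q f', the one with \<open>f\<close> from the q-derivative in
  \<open>a\<close> applied to qF.\<close>

definition ad_Q_sym0 :: "'m vf \<Rightarrow> ('m \<Rightarrow> real) \<Rightarrow> ('m \<Rightarrow> real) \<Rightarrow> 'm form \<Rightarrow> 'm pop" where
  "ad_Q_sym0 X f f' C = gen M (\<L> X) (\<d> (form0 f) + contraction X F)
     (\<d> C + contraction X H + fmult f' F + fmult f F) (\<d> (form0 f') + contraction X F)"

lemma form_deg_contraction_F: "form_deg 1 (contraction X F)"
  using form_deg_contraction[OF FH_deg(1), of X] by simp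

lemma form_deg_contraction_H: "form_deg 2 (contraction X H)"
  using form_deg_contraction[OF FH_deg(2), of X] by simp

lemma gen_data_ad_Q_sym0:
  assumes "X \<in> VF" "f \<in> CM" "f' \<in> CM" "C \<in> kforms M 1"
  shows "gen_data 0 (\<L> X) (\<d> (form0 f) + contraction X F)
     (\<d> C + contraction X H + fmult f' F + fmult f F) (\<d> (form0 f') + contraction X F)"
proof -
  have C: "C \<in> \<Omega>" "form_deg 1 C" using assms by (auto simp: kforms_form_deg)
  have "form_deg 2 (\<d> C)" using form_deg_ext_deriv[OF C] by simp
  then show ?thesis
    using assms C FH_deg(1) form_deg_contraction_H form_deg_contraction_F
    by (auto simp: gen_data_def form_derivation_lie_deriv form_deg_ext_deriv_form0
        intro!: form_add form_fmult form_form0 form_deg_add form_deg_fmult)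
qed

lemma derived_diff_sym0:
  assumes "X \<in> VF" "f \<in> CM" "f' \<in> CM" "C \<in> kforms M 1"
  shows "derived_diff \<Q> 0 (sym0 M X f f' C) = ad_Q_sym0 X f f' C"
proof -
  have "derived_diff \<Q> 0 (sym0 M X f f' C) =
    gen M (\<lambda>\<omega>. \<d> (contraction X \<omega>) + contraction X (\<d> \<omega>)) (\<d> (form0 f) + contraction X F)
      (\<d> C + contraction X H + fmult f' F + fmult f F) (\<d> (form0 f') + contraction X F)"
    unfolding derived_diff_def Q_gen sym0_gen[OF assms(3)]
    using gen_commutator[OF gen_data_Q gen_data_sym0[OF assms(2-4)], of X] by (simp add: int_sign_def)
  also have "\<dots> = ad_Q_sym0 X f f' C"
    unfolding ad_Q_sym0_def using assms(1) by (intro gen_cong) (simp add: contraction_ext_deriv)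
  finally show ?thesis .
qed

abbreviation flux :: "'m vf \<Rightarrow> 'm vf \<Rightarrow> 'm \<Rightarrow> real" where
  "flux X Y \<equiv> contraction Y (contraction X F) []"

text \<open>The one-form component of the derived bracket of two degree 0 elements, before
  \<open>f\<close> and \<open>f'\<close> are identified; the order of the summands keeps the pairs
  visible that coincide on the diagonal.\<close>

definition bracket_form :: "'m vf \<Rightarrow> ('m \<Rightarrow> real) \<Rightarrow> ('m \<Rightarrow> real) \<Rightarrow> 'm form \<Rightarrow>
    'm vf \<Rightarrow> ('m \<Rightarrow> real) \<Rightarrow> ('m \<Rightarrow> real) \<Rightarrow> 'm form \<Rightarrow> 'm form" where
  "bracket_form X f f' C Y g g' D =
     \<L> X D - contraction Y (\<d> C) - contraction Y (contraction X H)
     - fmult f' (contraction Y F) - fmult f (contraction Y F)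
     + fmult g' (\<d> (form0 f) + contraction X F) + fmult g (\<d> (form0 f') + contraction X F)"

lemma form0_flux: "form0 (flux X Y) = contraction Y (contraction X F)"
  by (rule form_deg_0) (use form_deg_contraction[OF form_deg_contraction_F, of Y X] in simp)

lemma derived_bracket_sym0_sym0:
  assumes X: "X \<in> VF" "f \<in> CM" "f' \<in> CM" "C \<in> kforms M 1"
    and Y: "Y \<in> VF" "g \<in> CM" "g' \<in> CM" "D \<in> kforms M 1"
  shows "derived_bracket \<Q> 0 0 (sym0 M X f f' C) (sym0 M Y g g' D) =
    sym0 M (lie_bracket X Y) (X g - Y f - flux X Y) (X g' - Y f' - flux X Y)
      (bracket_form X f f' C Y g g' D)"
proof -
  have smooth: "X g' - Y f' - flux X Y \<in> CM"
    using X Y by (auto intro!: smooth_diff)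
  \<comment> \<open>The coefficients of the q-part of [Q, a] are one-forms, hence odd; their sign
    turns the last, subtracted term of the commutator into the positive summand with
    \<open>g\<close>. Both orders of the sum are provided for rewriting.\<close>
  have one: "parity_sign (\<d> (form0 u) + contraction X F) = - (\<d> (form0 u) + contraction X F)"
    and one': "parity_sign (contraction X F + \<d> (form0 u)) = - (\<d> (form0 u) + contraction X F)"
    if "u \<in> CM" for u
    using form_deg_parity_sign[of 1 "\<d> (form0 u) + contraction X F"] that
      form_deg_ext_deriv_form0 form_deg_contraction_F by (simp_all add: int_sign_def form_deg_add add.commute)
  have "derived_bracket \<Q> 0 0 (sym0 M X f f' C) (sym0 M Y g g' D) =
      graded_commutator 0 (-1) (ad_Q_sym0 X f f' C) (sym0 M Y g g' D)"
    using derived_diff_sym0[OF X] by (simp add: derived_bracket_def derived_diff_def int_sign_def)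
  also have "\<dots> = gen M (\<lambda>\<omega>. \<L> X (contraction Y \<omega>) - contraction Y (\<L> X \<omega>))
      (form0 (X g - Y f - flux X Y)) (bracket_form X f f' C Y g g' D) (form0 (X g' - Y f' - flux X Y))"
    unfolding ad_Q_sym0_def sym0_gen[OF Y(3)]
      gen_commutator[OF gen_data_ad_Q_sym0[OF X] gen_data_sym0[OF Y(2-4)]]
    using X Y
    by (simp add: int_sign_def one one' contraction_add contraction_fmult contraction_ext_deriv_form0
        form0_diff[symmetric] form0_add[symmetric] form0_flux bracket_form_def fmult_uminus fmult_add wedge_linear algebra_simps)
  also have "\<dots> = gen M (contraction (lie_bracket X Y))
      (form0 (X g - Y f - flux X Y)) (bracket_form X f f' C Y g g' D) (form0 (X g' - Y f' - flux X Y))"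
    using X Y by (intro gen_cong) (simp add: contraction_lie_deriv)
  finally show ?thesis using smooth by (simp add: sym0_gen)
qed

lemma bracket_form_kform:
  assumes X: "X \<in> VF" "f \<in> CM" "f' \<in> CM" "C \<in> kforms M 1"
    and Y: "Y \<in> VF" "g \<in> CM" "g' \<in> CM" "D \<in> kforms M 1"
  shows "bracket_form X f f' C Y g g' D \<in> kforms M 1"
proof -
  have CD: "C \<in> \<Omega>" "form_deg 1 C" "D \<in> \<Omega>" "form_deg 1 D" using X Y by (auto simp: kforms_form_deg)
  have "form_deg 1 (contraction Y (\<d> C))" "form_deg 1 (contraction Y (contraction X H))"
    using form_deg_contraction[OF form_deg_ext_deriv[OF CD(1,2)], of Y]
      form_deg_contraction[OF form_deg_contraction_H, of Y X] by simp_all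
  then show ?thesis
    unfolding bracket_form_def kforms_form_deg using CD X Y form_deg_contraction_F
    by (auto simp: form_deg_lie_deriv form_deg_ext_deriv_form0 intro!: form_add form_diff form_fmult
        form_form0 form_deg_add form_deg_diff form_deg_fmult)
qed

lemma derived_bracket_sym0_sym1:
  assumes X: "X \<in> VF" "f \<in> CM" "f' \<in> CM" "C \<in> kforms M 1" and h: "h \<in> CM"
  shows "derived_bracket \<Q> 0 (-1) (sym0 M X f f' C) (sym1 M h) = sym1 M (X h)"
proof -
  have "derived_bracket \<Q> 0 (-1) (sym0 M X f f' C) (sym1 M h) =
      graded_commutator 0 (-2) (ad_Q_sym0 X f f' C) (sym1 M h)"
    using derived_diff_sym0[OF X] by (simp add: derived_bracket_def derived_diff_def int_sign_def)
  also have "\<dots> = sym1 M (X h)"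
    unfolding ad_Q_sym0_def sym1_gen
      gen_commutator[OF gen_data_ad_Q_sym0[OF X] gen_data_sym1[OF h]]
    using X by (simp add: int_sign_def)
  finally show ?thesis .
qed

text \<open>The differential of \<open>sym1 M h\<close> is the degree 0 element with one-form dh and
  all other coefficients 0, and contracting dh with Y gives Y(h). The minus sign is that of the
  degree -1 in the derived bracket.\<close>

lemma derived_bracket_sym1_sym0:
  assumes h: "h \<in> CM" and Y: "Y \<in> VF" "g \<in> CM" "g' \<in> CM" "D \<in> kforms M 1"
  shows "derived_bracket \<Q> (-1) 0 (sym1 M h) (sym0 M Y g g' D) = sym1 M (- Y h)"
proof -
  note g0 = gen_data_sym0[OF smooth_zero smooth_zero kforms_ext_deriv_form0[OF h], of 0]
  have "derived_bracket \<Q> (-1) 0 (sym1 M h) (sym0 M Y g g' D) =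
      - graded_commutator (-1) (-1) (sym0 M 0 0 0 (\<d> (form0 h))) (sym0 M Y g g' D)"
    using derived_diff_sym1[OF h] by (simp add: derived_bracket_def derived_diff_def int_sign_def)
  also have "graded_commutator (-1) (-1) (sym0 M 0 0 0 (\<d> (form0 h))) (sym0 M Y g g' D) =
      gen M (\<lambda>\<omega>. contraction 0 (contraction Y \<omega>) + contraction Y (contraction 0 \<omega>)) 0 (form0 (Y h)) 0"
    unfolding sym0_gen[OF smooth_zero] sym0_gen[OF Y(3)] gen_commutator[OF g0 gen_data_sym0[OF Y(2-4)]]
    using Y h by (simp add: int_sign_def contraction_ext_deriv_form0 kforms_form_deg)
  also have "\<dots> = sym1 M (Y h)"
    unfolding sym1_gen by (rule gen_cong) simp
  also have "- sym1 M (Y h) = sym1 M (- Y h)"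
    using sym1_scaleR[of "-1" "Y h"] by simp
  finally show ?thesis .
qed

text \<open>Both operators are forms times the t-derivative, which annihilates coefficients free of
  \<open>t\<close>, so they commute in the graded sense.\<close>

lemma derived_bracket_sym1_sym1:
  assumes h: "h \<in> CM" and k: "k \<in> CM"
  shows "derived_bracket \<Q> (-1) (-1) (sym1 M h) (sym1 M k) = 0"
proof -
  note g0 = gen_data_sym0[OF smooth_zero smooth_zero kforms_ext_deriv_form0[OF h], of 0]
  have "derived_bracket \<Q> (-1) (-1) (sym1 M h) (sym1 M k) =
      - graded_commutator (-1) (-2) (sym0 M 0 0 0 (\<d> (form0 h))) (sym1 M k)"
    using derived_diff_sym1[OF h] by (simp add: derived_bracket_def derived_diff_def int_sign_def)
  also have "graded_commutator (-1) (-2) (sym0 M 0 0 0 (\<d> (form0 h))) (sym1 M k) = 0"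
    unfolding sym0_gen[OF smooth_zero] sym1_gen gen_commutator[OF g0 gen_data_sym1[OF k]]
    by (simp add: int_sign_def gen_zero_op)
  finally show ?thesis by simp
qed

section \<open>The dg-Leibniz algebra of derived symmetries\<close>

lemma Dsym_comp_cases:
  assumes "a \<in> Dsym_comp M i"
  obtains (sym0) X f f' C where "i = 0" "X \<in> VF" "f \<in> CM" "f' \<in> CM" "C \<in> kforms M 1" "a = sym0 M X f f' C"
    | (sym1) h where "i = -1" "h \<in> CM" "a = sym1 M h"
    | (zero) "i \<noteq> 0" "i \<noteq> -1" "a = 0"
  using assms unfolding Dsym_comp_def by (auto split: if_splits)

lemma sym0_Dsym [intro]:
  "X \<in> VF \<Longrightarrow> f \<in> CM \<Longrightarrow> f' \<in> CM \<Longrightarrow> C \<in> kforms M 1 \<Longrightarrow> sym0 M X f f' C \<in> Dsym_comp M 0"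
  unfolding Dsym_comp_def using gen_graded_derivation[OF gen_data_sym0[of f f' C]]
  by (auto simp: sym0_gen)

lemma sym1_Dsym [intro]: "h \<in> CM \<Longrightarrow> sym1 M h \<in> Dsym_comp M (-1)"
  unfolding Dsym_comp_def using gen_graded_derivation[OF gen_data_sym1[of h]]
  by (auto simp: sym1_gen)

lemma zero_Dsym [simp]: "0 \<in> Dsym_comp M k"
proof -
  have "0 \<in> Dsym_comp M 0" using sym0_Dsym[of 0 0 0 0] by (simp add: sym0_zero)
  moreover have "0 \<in> Dsym_comp M (-1)" using sym1_Dsym[of 0] by (simp add: sym1_zero)
  ultimately show ?thesis by (cases "k = 0"; cases "k = -1") (simp_all add: Dsym_comp_def)
qed

lemma kforms_add: "\<alpha> \<in> kforms M k \<Longrightarrow> \<beta> \<in> kforms M k \<Longrightarrow> \<alpha> + \<beta> \<in> kforms M k"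
  and kforms_scaleR: "\<alpha> \<in> kforms M k \<Longrightarrow> r *\<^sub>R \<alpha> \<in> kforms M k"
  by (auto simp: kforms_form_deg)

lemma subspace_Dsym: "subspace (Dsym_comp M k)"
proof (rule subspaceI)
  show "a + b \<in> Dsym_comp M k" if a: "a \<in> Dsym_comp M k" and b: "b \<in> Dsym_comp M k" for a b
    using a
  proof (cases rule: Dsym_comp_cases)
    case 1: (sym0 X f f' C)
    from b show ?thesis
      by (cases rule: Dsym_comp_cases) (use 1 in \<open>auto simp: sym0_add intro!: sym0_Dsym kforms_add\<close>)
  next
    case 1: (sym1 h)
    from b show ?thesis
      by (cases rule: Dsym_comp_cases) (use 1 in \<open>auto simp: sym1_add\<close>)
  qed (use b in simp)
  show "r *\<^sub>R a \<in> Dsym_comp M k" if "a \<in> Dsym_comp M k" for r a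
    using that
    by (cases rule: Dsym_comp_cases)
      (auto simp: sym0_scaleR sym1_scaleR intro!: sym0_Dsym sym1_Dsym kforms_scaleR)
qed simp

lemma lin_op_Dsym: "a \<in> Dsym_comp M i \<Longrightarrow> lin_op a"
  by (erule Dsym_comp_cases)
    (auto simp: sym0_gen sym1_gen lin_op_zero intro: lin_op_gen gen_data_sym0[simplified] gen_data_sym1)

lemma derived_bracket_zero [simp]:
  "lin_op b \<Longrightarrow> derived_bracket \<Q> i j 0 b = 0" "lin_op a \<Longrightarrow> derived_bracket \<Q> i j a 0 = 0"
  using derived_bracket_scaleR_left[OF lin_op_Q lin_op_zero, of b i j 0]
    derived_bracket_scaleR_right[OF lin_op_Q _ lin_op_zero, of a i j 0] by simp_all

lemma derived_diff_zero [simp]: "derived_diff \<Q> i 0 = 0"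
  using derived_diff_scaleR[OF lin_op_Q lin_op_zero, of i 0] by simp

lemma derived_bracket_Dsym:
  assumes a: "a \<in> Dsym_comp M i" and b: "b \<in> Dsym_comp M j"
  shows "derived_bracket \<Q> i j a b \<in> Dsym_comp M (i + j)"
  using a
proof (cases rule: Dsym_comp_cases)
  case 1: (sym0 X f f' C)
  from b show ?thesis
  proof (cases rule: Dsym_comp_cases)
    case (sym0 Y g g' D)
    with 1 show ?thesis
      by (auto simp: derived_bracket_sym0_sym0 intro!: sym0_Dsym lie_bracket_closed smooth_diff
          bracket_form_kform[simplified])
  next
    case (sym1 h)
    with 1 show ?thesis by (auto simp: derived_bracket_sym0_sym1 intro!: sym1_Dsym)
  qed (use a lin_op_Dsym in simp)
next
  case 1: (sym1 h)
  from b show ?thesis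
  proof (cases rule: Dsym_comp_cases)
    case (sym0 Y g g' D)
    with 1 show ?thesis by (auto simp: derived_bracket_sym1_sym0 intro!: sym1_Dsym smooth_uminus)
  next
    case (sym1 k)
    with 1 show ?thesis by (simp add: derived_bracket_sym1_sym1)
  qed (use a lin_op_Dsym in simp)
qed (use b lin_op_Dsym in simp)

text \<open>This includes \<open>b\<close> of degree 0, whose commutator with Q lies outside the
  truncated complex; the identity used holds for arbitrary linear operators.\<close>

lemma derived_compatible_Q: "derived_compatible M \<Q>"
  unfolding derived_compatible_def
proof (intro allI ballI)
  fix i j a b assume "a \<in> Dsym_comp M i" "b \<in> Dsym_comp M j"
  then have ab: "lin_op a" "lin_op b" by (auto dest: lin_op_Dsym)
  show "derived_diff \<Q> (i + j) (derived_bracket \<Q> i j a b) =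
    derived_bracket \<Q> (i + 1) j (derived_diff \<Q> i a) b +
    int_sign i *\<^sub>R derived_bracket \<Q> i (j + 1) a (derived_diff \<Q> j b)"
    unfolding derived_diff_bracket[OF lin_op_Q ab Q_Q] derived_bracket_diff_left[OF lin_op_Q ab Q_Q]
    by simp
qed

lemma derived_diff_Dsym: "a \<in> Dsym_comp M (-1) \<Longrightarrow> derived_diff \<Q> (-1) a \<in> Dsym_comp M 0"
  by (erule Dsym_comp_cases) (auto simp: derived_diff_sym1 intro!: sym0_Dsym kforms_ext_deriv_form0[simplified])

abbreviation \<D> where "\<D> \<equiv> Dsym M \<Q>"

lemma Dsym_simps [simp]:
  "dgl_comp \<D> = Dsym_comp M" "dgl_br \<D> = derived_bracket \<Q>"
  "dgl_diff \<D> k a = (if k = -1 then derived_diff \<Q> k a else 0)"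
  by (simp_all add: Dsym_def zero_fun_apply)

lemma dg_leibniz_Dsym: "dg_leibniz \<D>"
  unfolding dg_leibniz_def
proof (intro conjI allI impI ballI)
  show "subspace (dgl_comp \<D> k)" for k by (simp add: subspace_Dsym)
  show "dgl_comp \<D> k = {0}" if "k > 0" for k using that by (simp add: Dsym_comp_def)
  show "lin_between (dgl_comp \<D> k) (dgl_comp \<D> (k + 1)) (dgl_diff \<D> k)" for k
    by (rule lin_betweenI)
      (auto simp: derived_diff_Dsym derived_diff_add derived_diff_scaleR lin_op_Q lin_op_Dsym)
  \<comment> \<open>Of two consecutive degrees at most one is -1, so at least one of the two
    differentials is the default 0.\<close>
  show "dgl_diff \<D> (k + 1) (dgl_diff \<D> k a) = 0" for k a by simp
  show "lin_between (dgl_comp \<D> j) (dgl_comp \<D> (i + j)) (dgl_br \<D> i j a)"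
    if "a \<in> dgl_comp \<D> i" for i j a
    using that by (intro lin_betweenI)
      (auto simp: derived_bracket_Dsym derived_bracket_add_right derived_bracket_scaleR_right lin_op_Q lin_op_Dsym)
  show "lin_between (dgl_comp \<D> i) (dgl_comp \<D> (i + j)) (\<lambda>a. dgl_br \<D> i j a b)"
    if "b \<in> dgl_comp \<D> j" for i j b
    using that by (intro lin_betweenI)
      (auto simp: derived_bracket_Dsym derived_bracket_add_left derived_bracket_scaleR_left lin_op_Q lin_op_Dsym)
  show "dgl_br \<D> i (j + k) a (dgl_br \<D> j k b c) = dgl_br \<D> (i + j) k (dgl_br \<D> i j a b) c +
      int_sign (i * j) *\<^sub>R dgl_br \<D> j (i + k) b (dgl_br \<D> i k a c)"
    if "a \<in> dgl_comp \<D> i" "b \<in> dgl_comp \<D> j" "c \<in> dgl_comp \<D> k" for i j k a b c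
    using that unfolding Dsym_simps by (intro derived_bracket_leibniz lin_op_Q lin_op_Dsym Q_Q)
  show "dgl_diff \<D> (i + j) (dgl_br \<D> i j a b) = dgl_br \<D> (i + 1) j (dgl_diff \<D> i a) b +
      int_sign i *\<^sub>R dgl_br \<D> i (j + 1) a (dgl_diff \<D> j b)"
    if "j < 0" and "a \<in> dgl_comp \<D> i" and "b \<in> dgl_comp \<D> j" for i j a b
  proof -
    from that have a: "a \<in> Dsym_comp M i" and b: "b \<in> Dsym_comp M j" by simp_all
    have ab: "lin_op a" "lin_op b" using a b by (auto dest: lin_op_Dsym)
    note diff = derived_diff_bracket[OF lin_op_Q ab Q_Q]
    have left: "dgl_br \<D> (i + 1) j (dgl_diff \<D> i a) b = 0"
      using derived_bracket_diff_left[OF lin_op_Q ab Q_Q, of i j] ab by auto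
    \<comment> \<open>Only \<open>j = -1\<close> has content, as the components below it are
      zero.\<close>
    show ?thesis
    proof (cases "j = -1")
      case True
      \<comment> \<open>For \<open>i \<noteq> 0\<close> the bracket has a degree in which the
        differential is cut off to 0, so the general identity agrees with the required one only
        because the bracket itself vanishes.\<close>
      have "derived_bracket \<Q> i j a b = 0" if "i \<noteq> 0"
        using a b ab True that
        by (elim Dsym_comp_cases) (auto simp: derived_bracket_sym1_sym1)
      then show ?thesis
        unfolding left using True diff[of i j] by (cases "i = 0") auto
    next
      case False
      with \<open>j < 0\<close> b have "b = 0" by (auto elim: Dsym_comp_cases)
      then show ?thesis unfolding left using ab False by simp
    qed
  qed
qed

section \<open>The T-duality automorphism\<close>

lemma DPhi_sym0:
  assumes "X \<in> VF" "f \<in> CM" "f' \<in> CM" "C \<in> kforms M 1"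
  shows "DPhi M 0 (sym0 M X f f' C) = sym0 M X f' f C"
  unfolding DPhi_def if_P[OF refl]
proof (rule the_equality)
  show "\<exists>Y\<in>VF. \<exists>g\<in>CM. \<exists>g'\<in>CM. \<exists>D\<in>kforms M 1.
      sym0 M X f f' C = sym0 M Y g g' D \<and> sym0 M X f' f C = sym0 M Y g' g D"
    using assms by blast
next
  fix E assume "\<exists>Y\<in>VF. \<exists>g\<in>CM. \<exists>g'\<in>CM. \<exists>D\<in>kforms M 1.
      sym0 M X f f' C = sym0 M Y g g' D \<and> E = sym0 M Y g' g D"
  then obtain Y g g' D where *: "Y \<in> VF" "g \<in> CM" "g' \<in> CM" "D \<in> kforms M 1"
      "sym0 M X f f' C = sym0 M Y g g' D" "E = sym0 M Y g' g D" by blast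
  show "E = sym0 M X f' f C"
    using sym0_unique[OF *(5) assms(1) *(1) assms(2,3) *(2,3) assms(4) *(4)] *(6) by simp
qed

lemma DPhi_other: "k \<noteq> 0 \<Longrightarrow> DPhi M k D = D"
  by (simp add: DPhi_def)

lemma DPhi_zero [simp]: "DPhi M k 0 = 0"
  using DPhi_sym0[of 0 0 0 0] by (cases "k = 0") (simp_all add: sym0_zero DPhi_other)

lemma DPhi_Dsym: "a \<in> Dsym_comp M k \<Longrightarrow> DPhi M k a \<in> Dsym_comp M k"
  by (erule Dsym_comp_cases) (auto simp: DPhi_sym0 DPhi_other intro!: sym0_Dsym)

lemma DPhi_DPhi: "a \<in> Dsym_comp M k \<Longrightarrow> DPhi M k (DPhi M k a) = a"
  by (erule Dsym_comp_cases) (auto simp: DPhi_sym0 DPhi_other)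

lemma DPhi_add:
  assumes "a \<in> Dsym_comp M k" "b \<in> Dsym_comp M k"
  shows "DPhi M k (a + b) = DPhi M k a + DPhi M k b"
proof (cases "k = 0")
  case True
  with assms show ?thesis
    by (elim Dsym_comp_cases) (auto simp: sym0_add DPhi_sym0 vf_add_closed smooth_add kforms_add[simplified])
qed (simp add: DPhi_other)

lemma DPhi_scaleR:
  assumes "a \<in> Dsym_comp M k"
  shows "DPhi M k (r *\<^sub>R a) = r *\<^sub>R DPhi M k a"
proof (cases "k = 0")
  case True
  with assms show ?thesis
    by (elim Dsym_comp_cases)
      (auto simp: sym0_scaleR DPhi_sym0 vf_scaleR_closed smooth_scaleR kforms_scaleR[simplified])
qed (simp add: DPhi_other)

text \<open>Self T-duality enters here: the same F twists both components, so the exchange merely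
  permutes the two terms with \<open>contraction Y F\<close> and the two terms with \<open>g\<close>
  and \<open>g'\<close>.\<close>

lemma bracket_form_swap: "bracket_form X f' f C Y g' g D = bracket_form X f f' C Y g g' D"
  by (simp add: bracket_form_def algebra_simps)

lemma DPhi_bracket:
  assumes a: "a \<in> Dsym_comp M i" and b: "b \<in> Dsym_comp M j"
  shows "DPhi M (i + j) (derived_bracket \<Q> i j a b) = derived_bracket \<Q> i j (DPhi M i a) (DPhi M j b)"
  using a
proof (cases rule: Dsym_comp_cases)
  case 1: (sym0 X f f' C)
  from b show ?thesis
  proof (cases rule: Dsym_comp_cases)
    case (sym0 Y g g' D)
    have "DPhi M 0 (sym0 M (lie_bracket X Y) (X g - Y f - flux X Y) (X g' - Y f' - flux X Y)
        (bracket_form X f f' C Y g g' D)) =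
      sym0 M (lie_bracket X Y) (X g' - Y f' - flux X Y) (X g - Y f - flux X Y)
        (bracket_form X f f' C Y g g' D)"
      using 1 sym0 by (intro DPhi_sym0 bracket_form_kform lie_bracket_closed smooth_diff) auto
    with 1 sym0 show ?thesis
      by (simp add: derived_bracket_sym0_sym0 DPhi_sym0 bracket_form_swap)
  next
    case (sym1 h)
    with 1 show ?thesis by (simp add: derived_bracket_sym0_sym1 DPhi_sym0 DPhi_other)
  qed (use 1 lin_op_Dsym[OF a] lin_op_Dsym[OF DPhi_Dsym[OF a]] in simp)
next
  case 1: (sym1 h)
  from b show ?thesis
  proof (cases rule: Dsym_comp_cases)
    case (sym0 Y g g' D)
    with 1 show ?thesis by (simp add: derived_bracket_sym1_sym0 DPhi_sym0 DPhi_other)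
  qed (use 1 a lin_op_Dsym in \<open>simp_all add: DPhi_other derived_bracket_sym1_sym1\<close>)
qed (use lin_op_Dsym[OF b] lin_op_Dsym[OF DPhi_Dsym[OF b]] in simp)

text \<open>An exact element has only a one-form coefficient, so there is nothing to
  exchange.\<close>

lemma DPhi_diff:
  assumes "a \<in> Dsym_comp M (-1)"
  shows "DPhi M 0 (derived_diff \<Q> (-1) a) = derived_diff \<Q> (-1) a"
  using assms
  by (elim Dsym_comp_cases) (auto simp: derived_diff_sym1 DPhi_sym0 kforms_ext_deriv_form0[simplified])

lemma DPhi_iso: "dg_leibniz_iso \<D> \<D> (DPhi M)"
  unfolding dg_leibniz_iso_def Dsym_simps
proof (intro conjI allI ballI)
  show "dg_leibniz \<D>" "dg_leibniz \<D>" by (rule dg_leibniz_Dsym)+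
  show "lin_between (Dsym_comp M k) (Dsym_comp M k) (DPhi M k)" for k
    by (rule lin_betweenI) (auto simp: DPhi_Dsym DPhi_add DPhi_scaleR)
  show "bij_betw (DPhi M k) (Dsym_comp M k) (Dsym_comp M k)" for k
    by (rule bij_betwI[where g = "DPhi M k"]) (auto simp: DPhi_Dsym DPhi_DPhi)
  show "DPhi M (k + 1) (if k = -1 then derived_diff \<Q> k a else 0) =
      (if k = -1 then derived_diff \<Q> k (DPhi M k a) else 0)" if "a \<in> Dsym_comp M k" for k a
    using that by (auto simp: DPhi_diff DPhi_other)
qed (rule DPhi_bracket)

section \<open>Fixed points and the B_n structure\<close>

abbreviation \<F> where "\<F> \<equiv> fixed_points \<D> (DPhi M)"

lemma fixed_points_simps [simp]:
  "dgl_comp \<F> k = {a \<in> Dsym_comp M k. DPhi M k a = a}"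
  "dgl_br \<F> = derived_bracket \<Q>" "dgl_diff \<F> = dgl_diff \<D>"
  by (simp_all add: fixed_points_def Dsym_def)

lemma dg_leibniz_fixed_points: "dg_leibniz \<F>"
  using dg_leibniz_sub_fixed_points[OF DPhi_iso] by (simp add: dg_leibniz_sub_def)

lemma fixed_points_0:
  assumes "a \<in> dgl_comp \<F> 0"
  obtains X f C where "X \<in> VF" "f \<in> CM" "C \<in> kforms M 1" "a = sym0 M X f f C"
proof -
  from assms have "a \<in> Dsym_comp M 0" "DPhi M 0 a = a" by simp_all
  then obtain X f f' C where a: "X \<in> VF" "f \<in> CM" "f' \<in> CM" "C \<in> kforms M 1" "a = sym0 M X f f' C"
    by (auto elim: Dsym_comp_cases)
  with \<open>DPhi M 0 a = a\<close> have "sym0 M X f' f C = sym0 M X f f' C" by (simp add: DPhi_sym0)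
  then have "f' = f" using sym0_unique a by blast
  with a that show thesis by blast
qed

text \<open>The inclusion of the diagonal \<open>f' = f\<close>. The degree selects the component of
  the quadruple that is used; outside the degrees 0 and -1 the value is 0, as both complexes are
  zero there.\<close>

definition bn_map :: "int \<Rightarrow> 'm bn \<Rightarrow> 'm pop" where
  "bn_map k = (\<lambda>(X, f, C, h). if k = 0 then sym0 M X f f C else if k = -1 then sym1 M h else 0)"

abbreviation \<B> where "\<B> \<equiv> Bn_structure M F H"

lemma Bn_simps [simp]:
  "dgl_comp \<B> = Bn_comp M" "dgl_br \<B> i j = Bn_bracket M F H" "dgl_diff \<B> k = Bn_diff M"
  by (simp_all add: Bn_structure_def)

lemma Bn_comp_cases:
  assumes "a \<in> Bn_comp M i"
  obtains (deg0) X f C where "i = 0" "X \<in> VF" "f \<in> CM" "C \<in> kforms M 1" "a = (X, f, C, 0)"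
    | (deg1) h where "i = -1" "h \<in> CM" "a = (0, 0, 0, h)"
    | (zero) "i \<noteq> 0" "i \<noteq> -1" "a = 0"
  using assms unfolding Bn_comp_def by (auto split: if_splits)

lemma Bn_compI:
  "X \<in> VF \<Longrightarrow> f \<in> CM \<Longrightarrow> C \<in> kforms M 1 \<Longrightarrow> (X, f, C, 0) \<in> Bn_comp M 0"
  "h \<in> CM \<Longrightarrow> (0, 0, 0, h) \<in> Bn_comp M (-1)"
  by (simp_all add: Bn_comp_def)

lemma zero_Bn [simp]: "0 \<in> Bn_comp M k"
  by (simp add: Bn_comp_def zero_prod_def)

lemma fmult_zero_left [simp]: "fmult 0 \<omega> = 0"
  by (rule ext) (simp add: fmult_def zero_fun_apply[where x = "_ :: _ list"])

text \<open>The pairs of terms that T-duality exchanges become equal, which is the origin of the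
  three factors 2 of the B_n bracket.\<close>

lemma bracket_form_diagonal:
  "bracket_form X f f C Y g g D = \<L> X D - contraction Y (\<d> C) - contraction Y (contraction X H)
     - 2 *\<^sub>R fmult f (contraction Y F) + 2 *\<^sub>R fmult g (contraction X F) + 2 *\<^sub>R fmult g (\<d> (form0 f))"
  by (simp add: bracket_form_def scaleR_2 fmult_add algebra_simps)

lemma Bn_bracket_deg0_deg0:
  "Bn_bracket M F H (X, f, C, 0) (Y, g, D, 0) =
    (lie_bracket X Y, X g - Y f - flux X Y, bracket_form X f f C Y g g D, 0)"
  if "X \<in> VF" "Y \<in> VF"
  using that by (simp add: Bn_bracket_def bracket_form_diagonal)

lemma Bn_bracket_deg0_deg1:
  assumes "X \<in> VF" "f \<in> CM" "C \<in> kforms M 1" "h \<in> CM"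
  shows "Bn_bracket M F H (X, f, C, 0) (0, 0, 0, h) = (0, 0, 0, X h)"
  using assms by (simp add: Bn_bracket_def kforms_form_deg zero_fun_apply[where x = "_ :: _ \<Rightarrow> _"]
      form_apply[where Xs = "[]"])

lemma Bn_bracket_deg1_deg0:
  assumes "Y \<in> VF" "g \<in> CM" "D \<in> kforms M 1" "h \<in> CM"
  shows "Bn_bracket M F H (0, 0, 0, h) (Y, g, D, 0) = (0, 0, 0, - Y h)"
  using assms by (simp add: Bn_bracket_def kforms_form_deg zero_fun_apply[where x = "_ :: _ \<Rightarrow> _"]
      form_apply[where Xs = "[]"])

lemma Bn_bracket_deg1_deg1: "Bn_bracket M F H (0, 0, 0, h) (0, 0, 0, k) = 0"
  by (simp add: Bn_bracket_def zero_fun_apply[where x = "_ :: _ \<Rightarrow> _"]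
      form_apply[where Xs = "[]"] zero_prod_def)

lemma Bn_bracket_zero:
  "b \<in> Bn_comp M j \<Longrightarrow> Bn_bracket M F H 0 b = 0" "a \<in> Bn_comp M i \<Longrightarrow> Bn_bracket M F H a 0 = 0"
  using Bn_bracket_deg1_deg0[of _ _ _ 0] Bn_bracket_deg0_deg1[of _ _ _ 0] Bn_bracket_deg1_deg1[of 0]
    Bn_bracket_deg1_deg1[of _ 0]
  by (auto simp: zero_prod_def elim!: Bn_comp_cases)

lemma Bn_bracket_closed:
  assumes a: "a \<in> Bn_comp M i" and b: "b \<in> Bn_comp M j"
  shows "Bn_bracket M F H a b \<in> Bn_comp M (i + j)"
  using a
proof (cases rule: Bn_comp_cases)
  case 1: (deg0 X f C)
  from b show ?thesis
  proof (cases rule: Bn_comp_cases)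
    case (deg0 Y g D)
    have "bracket_form X f f C Y g g D \<in> kforms M 1" using 1 deg0 by (intro bracket_form_kform)
    with 1 deg0 show ?thesis
      by (auto simp: Bn_bracket_deg0_deg0 intro!: Bn_compI lie_bracket_closed smooth_diff)
  qed (use 1 a Bn_bracket_zero in \<open>auto simp: Bn_bracket_deg0_deg1 intro!: Bn_compI\<close>)
next
  case 1: (deg1 h)
  from b show ?thesis
    by (cases rule: Bn_comp_cases)
      (use 1 a Bn_bracket_zero in \<open>auto simp: Bn_bracket_deg1_deg0 Bn_bracket_deg1_deg1
        intro!: Bn_compI smooth_uminus\<close>)
qed (use b Bn_bracket_zero in simp)

lemma bn_map_simps:
  "bn_map 0 (X, f, C, h) = sym0 M X f f C" "bn_map (-1) (X, f, C, h) = sym1 M h"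
  by (simp_all add: bn_map_def)

lemma bn_map_zero [simp]: "bn_map k 0 = 0"
  by (simp add: bn_map_def zero_prod_def sym0_zero sym1_zero)

lemma bn_map_bracket:
  assumes a: "a \<in> Bn_comp M i" and b: "b \<in> Bn_comp M j"
  shows "bn_map (i + j) (Bn_bracket M F H a b) = derived_bracket \<Q> i j (bn_map i a) (bn_map j b)"
proof -
  have lin: "lin_op (bn_map i a)" "lin_op (bn_map j b)"
    using a b by (auto simp: bn_map_simps lin_op_zero elim!: Bn_comp_cases
        intro!: lin_op_Dsym[OF sym0_Dsym[simplified]] lin_op_Dsym[OF sym1_Dsym])
  from a show ?thesis
  proof (cases rule: Bn_comp_cases)
    case 1: (deg0 X f C)
    from b show ?thesis
      by (cases rule: Bn_comp_cases)
        (use 1 a lin Bn_bracket_zero in \<open>auto simp: Bn_bracket_deg0_deg0 Bn_bracket_deg0_deg1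
          bn_map_simps derived_bracket_sym0_sym0 derived_bracket_sym0_sym1\<close>)
  next
    case 1: (deg1 h)
    from b show ?thesis
      by (cases rule: Bn_comp_cases)
        (use 1 a lin Bn_bracket_zero in \<open>auto simp: Bn_bracket_deg1_deg0 Bn_bracket_deg1_deg1
          bn_map_simps derived_bracket_sym1_sym0 derived_bracket_sym1_sym1\<close>)
  qed (use b lin Bn_bracket_zero in simp)
qed

lemma bn_map_iso: "dg_leibniz_iso \<B> \<F> bn_map"
\<comment> \<open>With the fixed points as target the transport also yields that the B_n structure
  is a dg-Leibniz algebra.\<close>
proof (rule dg_leibniz_iso_transport[OF dg_leibniz_fixed_points], unfold Bn_simps)
  show "subspace (Bn_comp M k)" for k
    by (rule subspaceI) (auto simp: Bn_comp_def zero_prod_def smooth_add smooth_scaleR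
        vf_add_closed vf_scaleR_closed kforms_add[simplified] kforms_scaleR[simplified])
  show "Bn_comp M k = {0}" if "k > 0" for k using that by (simp add: Bn_comp_def)
  have Bn_diff: "Bn_diff M (X, f, C, 0) = 0" "Bn_diff M (0, 0, 0, h) = (0, 0, \<d> (form0 h), 0)"
    "Bn_diff M 0 = 0" for X f C h
    by (simp_all add: Bn_diff_def zero_prod_def)
  show "Bn_diff M a \<in> Bn_comp M (k + 1)" if "a \<in> Bn_comp M k" for k a
    using that by (cases rule: Bn_comp_cases)
      (auto simp: Bn_diff intro!: Bn_compI kforms_ext_deriv_form0[simplified])
  show "Bn_bracket M F H a b \<in> Bn_comp M (i + j)" if "a \<in> Bn_comp M i" "b \<in> Bn_comp M j" for i j a b
    using that by (rule Bn_bracket_closed)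
  have closed: "bn_map k a \<in> dgl_comp \<F> k" if "a \<in> Bn_comp M k" for k a
    using that by (cases rule: Bn_comp_cases)
      (auto simp: bn_map_simps DPhi_sym0 DPhi_other intro!: sym0_Dsym sym1_Dsym)
  show "lin_between (Bn_comp M k) (dgl_comp \<F> k) (bn_map k)" for k
  proof (rule lin_betweenI)
    show "bn_map k (a + b) = bn_map k a + bn_map k b" if "a \<in> Bn_comp M k" "b \<in> Bn_comp M k" for a b
      using that by (elim Bn_comp_cases) (auto simp: bn_map_simps sym0_add sym1_add)
    show "bn_map k (r *\<^sub>R a) = r *\<^sub>R bn_map k a" if "a \<in> Bn_comp M k" for r a
      using that by (elim Bn_comp_cases) (auto simp: bn_map_simps sym0_scaleR sym1_scaleR)
  qed (rule closed)
  show "bij_betw (bn_map k) (Bn_comp M k) (dgl_comp \<F> k)" for k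
    unfolding bij_betw_def
  proof
    show "inj_on (bn_map k) (Bn_comp M k)"
    proof (rule inj_onI)
      fix a b assume "a \<in> Bn_comp M k" "b \<in> Bn_comp M k" "bn_map k a = bn_map k b"
      then show "a = b"
        by (elim Bn_comp_cases) (auto simp: bn_map_simps dest: sym0_unique sym1_unique)
    qed
    show "bn_map k ` Bn_comp M k = dgl_comp \<F> k"
    proof (intro equalityI subsetI)
      fix a assume "a \<in> bn_map k ` Bn_comp M k"
      then show "a \<in> dgl_comp \<F> k" using closed by blast
    next
      fix a assume a: "a \<in> dgl_comp \<F> k"
      then have D: "a \<in> Dsym_comp M k" by simp
      show "a \<in> bn_map k ` Bn_comp M k"
      proof (cases "k = 0")
        case True
        with a obtain X f C where "X \<in> VF" "f \<in> CM" "C \<in> kforms M 1" "a = sym0 M X f f C"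
          using fixed_points_0 by metis
        with True show ?thesis
          using Bn_compI(1)[of X f C] bn_map_simps(1)[of X f C 0] by (metis imageI)
      next
        case False
        show ?thesis
          using D
        proof (cases rule: Dsym_comp_cases)
          case (sym1 h)
          then show ?thesis
            using Bn_compI(2)[of h] bn_map_simps(2)[of 0 0 0 h] by (metis imageI)
        next
          case zero
          then show ?thesis using zero_Bn[of k] bn_map_zero[of k] by (metis imageI)
        qed (use False in simp)
      qed
    qed
  qed
  show "bn_map (k + 1) (Bn_diff M a) = dgl_diff \<F> k (bn_map k a)" if "a \<in> Bn_comp M k" for k a
    using that by (cases rule: Bn_comp_cases)
      (auto simp: Bn_diff bn_map_simps derived_diff_sym1)
  show "bn_map (i + j) (Bn_bracket M F H a b) = dgl_br \<F> i j (bn_map i a) (bn_map j b)"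
    if "a \<in> Bn_comp M i" "b \<in> Bn_comp M j" for i j a b
    using bn_map_bracket[OF that] by simp
qed

end

theorem theorem4p6:
  fixes M :: "'m manifold" and F H :: "'m form"
  assumes "smooth_manifold M"
    and "F \<in> kforms M 2" and "ext_deriv M F = 0"
    and "H \<in> kforms M 3" and "ext_deriv M H + wedge F F = 0"
  shows "homological M (Q_P M F H) \<and>
    derived_compatible M (Q_P M F H) \<and>
    dg_leibniz_iso (Dsym M (Q_P M F H)) (Dsym M (Q_P M F H)) (DPhi M) \<and>
    dg_leibniz_sub (fixed_points (Dsym M (Q_P M F H)) (DPhi M)) (Dsym M (Q_P M F H)) \<and>
    dg_leibniz_isomorphic (Bn_structure M F H)
      (fixed_points (Dsym M (Q_P M F H)) (DPhi M))"
proof -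
  interpret twisted_mfd M F H
    using assms by unfold_locales
  show ?thesis
    unfolding dg_leibniz_isomorphic_def
    using homological_Q derived_compatible_Q DPhi_iso dg_leibniz_sub_fixed_points[OF DPhi_iso] bn_map_iso
    by blast
qed

end
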